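(* Let $\Bbbk$ be a field and let $S$ be a connected commutative $\Bbbk$-algebra of finite type. If $I_1, I_2 \subseteq S[\mathbf{x}] = S[x_1,\dots,x_n]$ are two ideals, then the set of points $$\{\mathfrak{p} \in \operatorname{Spec} S \mid I_1\kappa_{\mathfrak{p}}[\mathbf{x}] \subseteq I_2\kappa_{\mathfrak{p}}[\mathbf{x}]\}$$ is constructible in $\operatorname{Spec} S$. If the quotient $S[\tilde{\mathbf{x}}]/\widetilde{I}_2$ by the homogenization $\widetilde{I}_2$ of $I_2$ is flat over $S$, then this set is closed.
   Context: A ring is connected if it has no nontrivial idempotents (equivalently, its spectrum is connected). A subset of $\operatorname{Spec} S$ is constructible if it is a finite union $\bigcup_{i=1}^s U_i\cap C_i$ with each $U_i$ open and each $C_i$ closed in $\operatorname{Spec} S$. For a prime $\mathfrak{p}$ of $S$, $\kappa_{\mathfrak{p}} = S_{\mathfrak{p}}/\mathfrak{p}S_{\mathfrak{p}}$ is the residue field and, for an ideal $J\subseteq S[\mathbf{x}]$, $J\kappa_{\mathfrak{p}}[\mathbf{x}]$ is the extension of $J$ to the polynomial ring $\kappa_{\mathfrak{p}}[\mathbf{x}]$ (the ideal generated by the image of $J$). For a polynomial $f$ of total degree $d$ in $x_1,\dots,x_n$, its homogenization is $\widetilde f = x_0^d f(x_1/x_0,\dots,x_n/x_0)$, a homogeneous polynomial of degree $d$ in $\tilde{\mathbf{x}} = x_0,\dots,x_n$. The homogenization of an ideal $I\subseteq S[\mathbf{x}]$ is the ideal $\widetilde I\subseteq S[\tilde{\mathbf{x}}]$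 generated by $\{\widetilde f \mid f\in I\}$. *)

theory Defs
  imports
    "HOL-Algebra.Algebra"
    "HOL-Algebra.Indexed_Polynomials"
    "HOL-Algebra.Free_Abelian_Groups"
    "HOL-Analysis.Abstract_Topology"
begin

section \<open>Polynomial rings in several variables\<close>

text \<open>The library's indexed polynomials (functions from monomials, i.e. multisets of variables,
  to coefficients) come without a product; the convolution product is added here.\<close>

definition mpoly_ring :: "('a, 'r) ring_scheme \<Rightarrow> 'v set \<Rightarrow> ('v multiset \<Rightarrow> 'a) ring" where
  "mpoly_ring R V =
    \<lparr>carrier = ring.indexed_pset R V (carrier R),
     monoid.mult = (\<lambda>f g m. \<Oplus>\<^bsub>R\<^esub>a \<in> {a. a \<subseteq># m}. f a \<otimes>\<^bsub>R\<^esub> g (m - a)),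
     monoid.one = ring.indexed_const R \<one>\<^bsub>R\<^esub>,
     ring.zero = ring.indexed_const R \<zero>\<^bsub>R\<^esub>,
     ring.add = ring.indexed_padd R\<rparr>"

section \<open>Algebras of finite type and connected rings\<close>

definition finite_type_algebra ::
  "('k, 'r) ring_scheme \<Rightarrow> ('k, 'a, 'm) module_scheme \<Rightarrow> bool" where
  "finite_type_algebra K S \<longleftrightarrow>
     Module.algebra K S \<and>
     (\<exists>(r::nat) h. h \<in> ring_hom (mpoly_ring K {1..r}) S \<and>
        (\<forall>c \<in> carrier K. h (ring.indexed_const K c) = c \<odot>\<^bsub>S\<^esub> \<one>\<^bsub>S\<^esub>) \<and>
        h ` carrier (mpoly_ring K {1..r}) = carrier S)"

definition connected_ring :: "('a, 'r) ring_scheme \<Rightarrow> bool" where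
  "connected_ring R \<longleftrightarrow>
     (\<forall>e \<in> carrier R. e \<otimes>\<^bsub>R\<^esub> e = e \<longrightarrow> e = \<zero>\<^bsub>R\<^esub> \<or> e = \<one>\<^bsub>R\<^esub>)"

section \<open>The Zariski topology and constructible sets\<close>

definition Spec :: "('a, 'r) ring_scheme \<Rightarrow> 'a set set" where
  "Spec R = {\<pp>. primeideal \<pp> R}"

definition zariski_open :: "('a, 'r) ring_scheme \<Rightarrow> 'a set set \<Rightarrow> bool" where
  "zariski_open R U \<longleftrightarrow> (\<exists>J. ideal J R \<and> U = {\<pp> \<in> Spec R. \<not> J \<subseteq> \<pp>})"

definition zariski :: "('a, 'r) ring_scheme \<Rightarrow> 'a set topology" where
  "zariski R = topology (zariski_open R)"

lemma istopology_zariski_open: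
  assumes "cring R"
  shows "istopology (zariski_open R)"
proof -
  interpret cring R by fact
  have "zariski_open R (U \<inter> V)" if UV: "zariski_open R U" "zariski_open R V" for U V
  proof -
    obtain I J where I: "ideal I R" "U = {\<pp> \<in> Spec R. \<not> I \<subseteq> \<pp>}"
      and J: "ideal J R" "V = {\<pp> \<in> Spec R. \<not> J \<subseteq> \<pp>}"
      using UV unfolding zariski_open_def by blast
    have "I \<inter> J \<subseteq> \<pp> \<longleftrightarrow> I \<subseteq> \<pp> \<or> J \<subseteq> \<pp>" if p: "primeideal \<pp> R" for \<pp>
    proof
      assume IJ: "I \<inter> J \<subseteq> \<pp>"
      show "I \<subseteq> \<pp> \<or> J \<subseteq> \<pp>"
      proof (rule ccontr)
        assume "\<not> (I \<subseteq> \<pp> \<or> J \<subseteq> \<pp>)"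
        then obtain a b where ab: "a \<in> I" "a \<notin> \<pp>" "b \<in> J" "b \<notin> \<pp>" by blast
        have c: "a \<in> carrier R" "b \<in> carrier R"
          using ab ideal.Icarr[OF I(1)] ideal.Icarr[OF J(1)] by auto
        have "a \<otimes>\<^bsub>R\<^esub> b \<in> I \<inter> J"
          using ab c ideal.I_r_closed[OF I(1)] ideal.I_l_closed[OF J(1)] by auto
        then show False using primeideal.I_prime[OF p c] IJ ab by blast
      qed
    qed blast
    then have "U \<inter> V = {\<pp> \<in> Spec R. \<not> I \<inter> J \<subseteq> \<pp>}"
      unfolding I J Spec_def by blast
    then show ?thesis
      using i_intersect[OF I(1) J(1)] unfolding zariski_open_def by blast
  qed
  moreover have "zariski_open R (\<Union>\<K>)" if K: "\<forall>U\<in>\<K>. zariski_open R U" for \<K>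
  proof -
    have "\<forall>U\<in>\<K>. \<exists>J. ideal J R \<and> U = {\<pp> \<in> Spec R. \<not> J \<subseteq> \<pp>}"
      using K unfolding zariski_open_def .
    from bchoice[OF this] obtain J
      where J: "\<forall>U\<in>\<K>. ideal (J U) R \<and> U = {\<pp> \<in> Spec R. \<not> J U \<subseteq> \<pp>}" ..
    have idl: "ideal (J U) R" if "U \<in> \<K>" for U
      using bspec[OF J that] by (rule conjunct1)
    have mem: "\<pp> \<in> U \<longleftrightarrow> \<pp> \<in> Spec R \<and> \<not> J U \<subseteq> \<pp>" if "U \<in> \<K>" for U \<pp>
      using eqset_imp_iff[OF conjunct2[OF bspec[OF J that]], of \<pp>] by (simp only: mem_Collect_eq)
    have sub: "(\<Union>U\<in>\<K>. J U) \<subseteq> carrier R"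
      using ideal.Icarr[OF idl] by (intro UN_least subsetI)
    have Idl: "Idl\<^bsub>R\<^esub> (\<Union>U\<in>\<K>. J U) \<subseteq> \<pp> \<longleftrightarrow> (\<forall>U\<in>\<K>. J U \<subseteq> \<pp>)" if "\<pp> \<in> Spec R" for \<pp>
    proof -
      have "ideal \<pp> R"
        using that primeideal.axioms(1) unfolding Spec_def by blast
      from Idl_subset_ideal[OF this sub] show ?thesis by blast
    qed
    have "\<Union>\<K> = {\<pp> \<in> Spec R. \<not> Idl\<^bsub>R\<^esub> (\<Union>U\<in>\<K>. J U) \<subseteq> \<pp>}"
    proof (rule Set.set_eqI)
      fix \<pp>
      have "\<pp> \<in> \<Union>\<K> \<longleftrightarrow> \<pp> \<in> Spec R \<and> (\<exists>U\<in>\<K>. \<not> J U \<subseteq> \<pp>)"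
        using mem unfolding Union_iff by meson
      then show "\<pp> \<in> \<Union>\<K> \<longleftrightarrow>
          \<pp> \<in> {\<pp> \<in> Spec R. \<not> Idl\<^bsub>R\<^esub> (\<Union>U\<in>\<K>. J U) \<subseteq> \<pp>}"
        using Idl unfolding mem_Collect_eq by meson
    qed
    then show ?thesis
      using genideal_ideal[OF sub] unfolding zariski_open_def by blast
  qed
  ultimately show ?thesis unfolding istopology_def by blast
qed

definition constructible_in :: "'p topology \<Rightarrow> 'p set \<Rightarrow> bool" where
  "constructible_in T A \<longleftrightarrow>
     (\<exists>(s::nat) U Z. (\<forall>i \<in> {1..s}. openin T (U i) \<and> closedin T (Z i)) \<and>
        A = (\<Union>i \<in> {1..s}. U i \<inter> Z i))"

section \<open>Localization, residue fields, extension of ideals\<close>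

definition fraction_class :: "('a, 'r) ring_scheme \<Rightarrow> 'a set \<Rightarrow> 'a \<Rightarrow> 'a \<Rightarrow> ('a \<times> 'a) set" where
  "fraction_class R T a s =
     {(b, t). b \<in> carrier R \<and> t \<in> T \<and>
        (\<exists>u \<in> T. u \<otimes>\<^bsub>R\<^esub> (a \<otimes>\<^bsub>R\<^esub> t) = u \<otimes>\<^bsub>R\<^esub> (b \<otimes>\<^bsub>R\<^esub> s))}"

text \<open>Meaningful for a multiplicatively closed \<open>T\<close> with \<open>\<one> \<in> T\<close>: a fraction is the class of
  all pairs representing it, and the unions below are over all representatives.\<close>

definition localization :: "('a, 'r) ring_scheme \<Rightarrow> 'a set \<Rightarrow> ('a \<times> 'a) set ring" where
  "localization R T =
    \<lparr>carrier = {fraction_class R T a s | a s. a \<in> carrier R \<and> s \<in> T},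
     monoid.mult = (\<lambda>\<xi> \<eta>. \<Union>(a, s) \<in> \<xi>. \<Union>(b, t) \<in> \<eta>. fraction_class R T (a \<otimes>\<^bsub>R\<^esub> b) (s \<otimes>\<^bsub>R\<^esub> t)),
     monoid.one = fraction_class R T \<one>\<^bsub>R\<^esub> \<one>\<^bsub>R\<^esub>,
     ring.zero = fraction_class R T \<zero>\<^bsub>R\<^esub> \<one>\<^bsub>R\<^esub>,
     ring.add = (\<lambda>\<xi> \<eta>. \<Union>(a, s) \<in> \<xi>. \<Union>(b, t) \<in> \<eta>.
              fraction_class R T (a \<otimes>\<^bsub>R\<^esub> t \<oplus>\<^bsub>R\<^esub> b \<otimes>\<^bsub>R\<^esub> s) (s \<otimes>\<^bsub>R\<^esub> t))\<rparr>"

definition local_ring_at :: "('a, 'r) ring_scheme \<Rightarrow> 'a set \<Rightarrow> ('a \<times> 'a) set ring" where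
  "local_ring_at R \<pp> = localization R (carrier R - \<pp>)"

definition maximal_ideal_at :: "('a, 'r) ring_scheme \<Rightarrow> 'a set \<Rightarrow> ('a \<times> 'a) set set" where
  "maximal_ideal_at R \<pp> =
     Idl\<^bsub>local_ring_at R \<pp>\<^esub> ((\<lambda>a. fraction_class R (carrier R - \<pp>) a \<one>\<^bsub>R\<^esub>) ` \<pp>)"

definition residue_field :: "('a, 'r) ring_scheme \<Rightarrow> 'a set \<Rightarrow> ('a \<times> 'a) set set ring" where
  "residue_field R \<pp> = local_ring_at R \<pp> Quot maximal_ideal_at R \<pp>"

definition residue_map :: "('a, 'r) ring_scheme \<Rightarrow> 'a set \<Rightarrow> 'a \<Rightarrow> ('a \<times> 'a) set set" where
  "residue_map R \<pp> a =
     maximal_ideal_at R \<pp> +>\<^bsub>local_ring_at R \<pp>\<^esub> fraction_class R (carrier R - \<pp>) a \<one>\<^bsub>R\<^esub>"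

definition residue_extension ::
  "('a, 'r) ring_scheme \<Rightarrow> 'v set \<Rightarrow> 'a set \<Rightarrow> ('v multiset \<Rightarrow> 'a) set
     \<Rightarrow> ('v multiset \<Rightarrow> ('a \<times> 'a) set set) set" where
  "residue_extension R V \<pp> J =
     Idl\<^bsub>mpoly_ring (residue_field R \<pp>) V\<^esub> ((\<lambda>f m. residue_map R \<pp> (f m)) ` J)"

section \<open>Homogenization\<close>

definition total_degree :: "('a, 'r) ring_scheme \<Rightarrow> ('v multiset \<Rightarrow> 'a) \<Rightarrow> nat" where
  "total_degree R f = Max (insert 0 (size ` {m. f m \<noteq> \<zero>\<^bsub>R\<^esub>}))"

text \<open>For \<open>f\<close> of degree \<open>d\<close> in the variables \<open>1, \<dots>, n\<close>, a term \<open>c x\<^sup>\<mu>\<close> of \<open>f\<close>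
  becomes \<open>c x\<^sub>0\<^bsup>d - |\<mu>|\<^esup> x\<^sup>\<mu>\<close>. Read coefficientwise: the
  coefficient at a monomial of degree \<open>d\<close> in \<open>x\<^sub>0, \<dots>, x\<^sub>n\<close> is the coefficient of \<open>f\<close> at
  that monomial with \<open>x\<^sub>0\<close> set to 1.\<close>

definition homogenize ::
  "('a, 'r) ring_scheme \<Rightarrow> (nat multiset \<Rightarrow> 'a) \<Rightarrow> (nat multiset \<Rightarrow> 'a)" where
  "homogenize R f =
     (\<lambda>m. if size m = total_degree R f then f (filter_mset (\<lambda>i. i \<noteq> 0) m) else \<zero>\<^bsub>R\<^esub>)"

definition homogenized_ideal ::
  "('a, 'r) ring_scheme \<Rightarrow> nat \<Rightarrow> (nat multiset \<Rightarrow> 'a) set \<Rightarrow> (nat multiset \<Rightarrow> 'a) set" where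
  "homogenized_ideal R n I = Idl\<^bsub>mpoly_ring R {0..n}\<^esub> (homogenize R ` I)"

section \<open>Tensor products and flatness\<close>

definition restrict_scalars ::
  "('a \<Rightarrow> 'b) \<Rightarrow> ('b, 's) ring_scheme \<Rightarrow> ('a, 'b) module" where
  "restrict_scalars h A =
    \<lparr>carrier = carrier A, monoid.mult = monoid.mult A,
     monoid.one = \<one>\<^bsub>A\<^esub>, ring.zero = \<zero>\<^bsub>A\<^esub>, ring.add = ring.add A,
     smult = (\<lambda>a x. h a \<otimes>\<^bsub>A\<^esub> x)\<rparr>"

definition mpoly_quotient ::
  "('a, 'r) ring_scheme \<Rightarrow> 'v set \<Rightarrow> ('v multiset \<Rightarrow> 'a) set
     \<Rightarrow> ('a, ('v multiset \<Rightarrow> 'a) set) module" where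
  "mpoly_quotient R V J =
     restrict_scalars (\<lambda>a. J +>\<^bsub>mpoly_ring R V\<^esub> ring.indexed_const R a) (mpoly_ring R V Quot J)"

definition module_homs ::
  "('a, 'r) ring_scheme \<Rightarrow> ('a, 'b, 'm) module_scheme \<Rightarrow> ('a, 'c, 'n) module_scheme
     \<Rightarrow> ('b \<Rightarrow> 'c) set" where
  "module_homs R M N =
     {f. f \<in> carrier M \<rightarrow> carrier N \<and>
        (\<forall>x \<in> carrier M. \<forall>y \<in> carrier M. f (x \<oplus>\<^bsub>M\<^esub> y) = f x \<oplus>\<^bsub>N\<^esub> f y) \<and>
        (\<forall>a \<in> carrier R. \<forall>x \<in> carrier M. f (a \<odot>\<^bsub>M\<^esub> x) = a \<odot>\<^bsub>N\<^esub> f x)}"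

definition tensor_relations ::
  "('a, 'r) ring_scheme \<Rightarrow> ('a, 'b, 'm) module_scheme \<Rightarrow> ('a, 'c, 'n) module_scheme
     \<Rightarrow> ('b \<times> 'c \<Rightarrow>\<^sub>0 int) set" where
  "tensor_relations R M N = generate (free_Abelian_group (carrier M \<times> carrier N))
     ({frag_of (x \<oplus>\<^bsub>M\<^esub> x', y) - frag_of (x, y) - frag_of (x', y) | x x' y.
         x \<in> carrier M \<and> x' \<in> carrier M \<and> y \<in> carrier N} \<union>
      {frag_of (x, y \<oplus>\<^bsub>N\<^esub> y') - frag_of (x, y) - frag_of (x, y') | x y y'.
         x \<in> carrier M \<and> y \<in> carrier N \<and> y' \<in> carrier N} \<union>
      {frag_of (a \<odot>\<^bsub>M\<^esub> x, y) - frag_of (x, a \<odot>\<^bsub>N\<^esub> y) | a x y.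
         a \<in> carrier R \<and> x \<in> carrier M \<and> y \<in> carrier N})"

text \<open>Only the underlying abelian group of \<open>M \<otimes> N\<close> is needed to speak about exactness.\<close>

definition tensor ::
  "('a, 'r) ring_scheme \<Rightarrow> ('a, 'b, 'm) module_scheme \<Rightarrow> ('a, 'c, 'n) module_scheme
     \<Rightarrow> ('b \<times> 'c \<Rightarrow>\<^sub>0 int) set monoid" where
  "tensor R M N =
     free_Abelian_group (carrier M \<times> carrier N) Mod tensor_relations R M N"

text \<open>The map \<open>id \<otimes> f\<close> from \<open>M \<otimes> N\<close> to \<open>M \<otimes> N'\<close>; the union is over all representatives of a
  coset, which all give the same result.\<close>

definition tensor_map ::
  "('a, 'r) ring_scheme \<Rightarrow> ('a, 'b, 'm) module_scheme \<Rightarrow> ('a, 'c, 'n) module_scheme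
     \<Rightarrow> ('d \<Rightarrow> 'c) \<Rightarrow> ('b \<times> 'd \<Rightarrow>\<^sub>0 int) set \<Rightarrow> ('b \<times> 'c \<Rightarrow>\<^sub>0 int) set" where
  "tensor_map R M N' f \<xi> =
     (\<Union>z \<in> \<xi>. tensor_relations R M N' #>\<^bsub>free_Abelian_group (carrier M \<times> carrier N')\<^esub>
        frag_extend (\<lambda>(x, y). frag_of (x, f y)) z)"

text \<open>Tensoring with \<open>M\<close> is exact. A formula cannot quantify over modules on all types; the test
  modules have carriers in \<^typ>\<open>(nat \<Rightarrow> 'a) set\<close>, where \<^typ>\<open>'a\<close> is the type of the scalars.
  Every finitely generated \<open>R\<close>-module has an isomorphic copy there (a quotient of \<open>R\<^sup>k\<close> is a set
  of subsets of \<^typ>\<open>nat \<Rightarrow> 'a\<close>), and flatness can be tested on finitely generated modules, so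
  this is no restriction.\<close>

definition flat :: "('a, 'r) ring_scheme \<Rightarrow> ('a, 'b, 'm) module_scheme \<Rightarrow> bool" where
  "flat R M \<longleftrightarrow>
     module R M \<and>
     (\<forall>(N1 :: ('a, (nat \<Rightarrow> 'a) set) module) (N2 :: ('a, (nat \<Rightarrow> 'a) set) module)
       (N3 :: ('a, (nat \<Rightarrow> 'a) set) module) f g.
        module R N1 \<and> module R N2 \<and> module R N3 \<and>
        f \<in> module_homs R N1 N2 \<and> g \<in> module_homs R N2 N3 \<and>
        f ` carrier N1 = {x \<in> carrier N2. g x = \<zero>\<^bsub>N3\<^esub>} \<longrightarrow>
        tensor_map R M N2 f ` carrier (tensor R M N1) =
          kernel (tensor R M N2) (tensor R M N3) (tensor_map R M N3 g))"

end

theory Submission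
  imports Defs "HOL-Library.Multiset_Order"
begin

text \<open>Let \<open>E\<close> be the set of primes \<open>\<pp>\<close> with \<open>I\<^sub>1\<kappa>\<^sub>\<pp>[x] \<subseteq> I\<^sub>2\<kappa>\<^sub>\<pp>[x]\<close>. Clearing denominators
  removes the residue field from the definition: \<open>f\<close> lies in \<open>I\<^sub>2\<kappa>\<^sub>\<pp>[x]\<close> iff \<open>s f \<in> I\<^sub>2 + \<pp>S[x]\<close> for some
  \<open>s \<notin> \<pp>\<close> (\<open>mem_extension_iff\<close>). By Hilbert's basis theorem, applied first over \<open>\<bbbk>\<close> and then over
  \<open>S\<close>, the ring \<open>S\<close> is Noetherian and \<open>I\<^sub>1\<close> is generated by finitely many \<open>f\<close>.

  The core is that \<open>E\<close> is constant near the generic point of each irreducible closed set \<open>V(\<pp>)\<close>. If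
  \<open>\<pp> \<in> E\<close>, the scalars \<open>s\<close> of the finitely many generators work for every prime above \<open>\<pp>\<close> that avoids
  them. If \<open>\<pp> \<notin> E\<close>, some generator \<open>f\<close> has a nonzero normal form with respect to \<open>I\<^sub>2\<close> over the fraction field of
  \<open>S/\<pp>\<close>. Only finitely many leading coefficients matter by Dickson's lemma, and as long as they and one
  coefficient of the normal form stay invertible, \<open>f\<close> stays outside (\<open>fibre_nonmember_generic\<close>).
  Noetherian induction on closed sets turns this local statement into constructibility. It
  also shows that \<open>E\<close> is closed as soon as \<open>E\<close> is stable under specialization.

  Flatness of \<open>M = S[x\<^sub>0, x]/J\<close>, with \<open>J\<close> the homogenization of \<open>I\<^sub>2\<close>, gives this stability. Tensoring
  the injection \<open>s: S/\<pp> \<rightarrow> S/\<pp>\<close> with \<open>M\<close> shows that \<open>M/\<pp>M\<close> has no torsion over the domain \<open>S/\<pp>\<close>, so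
  \<open>s g \<in> J + \<pp>S[x\<^sub>0, x]\<close> implies \<open>g \<in> J + \<pp>S[x\<^sub>0, x]\<close>. Homogenizing \<open>s f \<in> I\<^sub>2 + \<pp>S[x]\<close> in a large degree,
  cancelling \<open>s\<close> and setting \<open>x\<^sub>0 = 1\<close> again yields \<open>f \<in> I\<^sub>2 + \<pp>S[x]\<close>, a condition that persists
  when \<open>\<pp>\<close> grows.\<close>

section \<open>Polynomial rings\<close>

definition (in ring) mpoly_term :: "'a \<Rightarrow> 'v multiset \<Rightarrow> 'v multiset \<Rightarrow> 'a" where
  "mpoly_term c a = (\<lambda>m. if m = a then c else \<zero>)"

text \<open>An explicit form of the inductively defined carrier of the polynomial ring, see
  \<open>mem_mpoly_ring_iff\<close>.\<close>

definition (in ring) is_mpoly :: "'v set \<Rightarrow> ('v multiset \<Rightarrow> 'a) \<Rightarrow> bool" where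
  "is_mpoly V f \<longleftrightarrow> (\<forall>m. f m \<in> carrier R) \<and> finite {m. f m \<noteq> \<zero>} \<and>
     (\<forall>m. f m \<noteq> \<zero> \<longrightarrow> set_mset m \<subseteq> V)"

lemma finite_submultisets: "finite {a. a \<subseteq># m}"
proof -
  have "{a. a \<subseteq># m} \<subseteq> (\<Union>k \<le> size m. multisets_of_size (set_mset m) k)"
    by (auto simp: multisets_of_size_def dest: mset_subset_eqD size_mset_mono)
  then show ?thesis
    by (rule finite_subset) auto
qed

context ring
begin

lemma is_mpoly_coeff: "is_mpoly V f \<Longrightarrow> f m \<in> carrier R"
  by (simp add: is_mpoly_def)

lemma is_mpoly_support: "is_mpoly V f \<Longrightarrow> f m \<noteq> \<zero> \<Longrightarrow> set_mset m \<subseteq> V"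
  by (simp add: is_mpoly_def)

lemma is_mpoly_term:
  assumes "c \<in> carrier R" "set_mset a \<subseteq> V"
  shows "is_mpoly V (mpoly_term c a)"
proof -
  have "{m. mpoly_term c a m \<noteq> \<zero>} \<subseteq> {a}"
    by (auto simp: mpoly_term_def)
  from finite_subset[OF this] show ?thesis
    using assms by (auto simp: is_mpoly_def mpoly_term_def)
qed

lemma is_mpoly_zero: "is_mpoly V (\<lambda>_. \<zero>)"
  by (simp add: is_mpoly_def)

lemma is_mpoly_add:
  assumes f: "is_mpoly V f" and g: "is_mpoly V g"
  shows "is_mpoly V (\<lambda>m. f m \<oplus> g m)"
proof -
  have "{m. f m \<oplus> g m \<noteq> \<zero>} \<subseteq> {m. f m \<noteq> \<zero>} \<union> {m. g m \<noteq> \<zero>}"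
    using f g by (auto simp: is_mpoly_def)
  then have "finite {m. f m \<oplus> g m \<noteq> \<zero>}"
    by (rule finite_subset) (use f g in \<open>simp add: is_mpoly_def\<close>)
  moreover have "set_mset m \<subseteq> V" if "f m \<oplus> g m \<noteq> \<zero>" for m
  proof (cases "f m = \<zero>")
    case True
    then have "g m \<noteq> \<zero>" using that by auto
    then show ?thesis using g by (simp add: is_mpoly_def)
  next
    case False
    then show ?thesis using f by (simp add: is_mpoly_def)
  qed
  ultimately show ?thesis
    using f g by (simp add: is_mpoly_def)
qed

text \<open>Induction over the support. Every term that is added keeps its coefficient in \<open>C\<close>; with an
  ideal for \<open>C\<close> this reaches the polynomials with coefficients in that ideal.\<close>

lemma is_mpoly_coeff_induct [consumes 3, case_names zero add_monom]:
  assumes f: "is_mpoly V f" and C: "\<And>m. f m \<in> C" "\<zero> \<in> C"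
    and zero: "Q (\<lambda>_. \<zero>)"
    and add_monom: "\<And>c a g. c \<in> carrier R \<Longrightarrow> c \<in> C \<Longrightarrow> set_mset a \<subseteq> V \<Longrightarrow> is_mpoly V g \<Longrightarrow>
      (\<And>m. g m \<in> C) \<Longrightarrow> Q g \<Longrightarrow> Q (\<lambda>m. mpoly_term c a m \<oplus> g m)"
  shows "Q f"
proof -
  have fin: "finite {m. f m \<noteq> \<zero>}" using f by (simp add: is_mpoly_def)
  have "Q f" if "finite A" "is_mpoly V f" "\<And>m. f m \<in> C" "{m. f m \<noteq> \<zero>} = A" for A f
    using that
  proof (induction A arbitrary: f rule: finite_induct)
    case empty
    then have "f = (\<lambda>_. \<zero>)" by auto
    then show ?case using zero by simp
  next
    case (insert a A)
    have fa: "f a \<in> carrier R" "set_mset a \<subseteq> V"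
      using insert.prems by (auto simp: is_mpoly_def)
    have supp: "{m. (f(a := \<zero>)) m \<noteq> \<zero>} = A"
      using insert.prems(3) insert.hyps by auto
    have g: "is_mpoly V (f(a := \<zero>))"
      using insert.prems(1) insert.hyps(1) supp by (auto simp: is_mpoly_def)
    have gC: "(f(a := \<zero>)) m \<in> C" for m using insert.prems(2) C(2) by simp
    have "f = (\<lambda>m. mpoly_term (f a) a m \<oplus> (f(a := \<zero>)) m)"
      using insert.prems(1) by (auto simp: mpoly_term_def is_mpoly_def)
    moreover have "Q (\<lambda>m. mpoly_term (f a) a m \<oplus> (f(a := \<zero>)) m)"
      by (rule add_monom[OF fa(1) insert.prems(2) fa(2) g gC insert.IH[OF g gC supp]])
    ultimately show ?case by simp
  qed
  from this[OF fin f C(1) refl] show ?thesis .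
qed

text \<open>Identities that are additive in a polynomial need to be verified on single terms only. The
  ring laws below are all obtained in this way.\<close>

lemma is_mpoly_induct [consumes 1, case_names zero monom add]:
  assumes f: "is_mpoly V f"
    and zero: "Q (\<lambda>_. \<zero>)"
    and monom: "\<And>c a. c \<in> carrier R \<Longrightarrow> set_mset a \<subseteq> V \<Longrightarrow> Q (mpoly_term c a)"
    and add: "\<And>f g. is_mpoly V f \<Longrightarrow> is_mpoly V g \<Longrightarrow> Q f \<Longrightarrow> Q g \<Longrightarrow> Q (\<lambda>m. f m \<oplus> g m)"
  shows "Q f"
  using f is_mpoly_coeff[OF f] zero_closed
proof (induction rule: is_mpoly_coeff_induct)
  case (add_monom c a g)
  then show ?case by (intro add is_mpoly_term monom)
qed (rule zero)

lemma indexed_const_eq_term: "indexed_const c = mpoly_term c {#}"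
  by (auto simp: indexed_const_def mpoly_term_def)

lemma indexed_pset_eq_is_mpoly: "indexed_pset V (carrier R) = Collect (is_mpoly V)"
proof (intro equalityI subsetI CollectI; (elim CollectE)?)
  fix f assume "f \<in> indexed_pset V (carrier R)"
  then show "is_mpoly V f"
  proof induction
    case (indexed_const k)
    then show ?case by (simp add: indexed_const_eq_term is_mpoly_term)
  next
    case (indexed_padd P Q)
    then show ?case
      using is_mpoly_add[of V P Q] by (simp add: indexed_padd_def)
  next
    case (indexed_pmult P i)
    have "{m. (if i \<in># m then P (m - {#i#}) else \<zero>) \<noteq> \<zero>} \<subseteq> add_mset i ` {m. P m \<noteq> \<zero>}"
    proof
      fix m assume "m \<in> {m. (if i \<in># m then P (m - {#i#}) else \<zero>) \<noteq> \<zero>}"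
      then have "i \<in># m" "P (m - {#i#}) \<noteq> \<zero>" by (auto split: if_splits)
      then show "m \<in> add_mset i ` {m. P m \<noteq> \<zero>}"
        by (intro image_eqI[of _ _ "m - {#i#}"]) auto
    qed
    moreover have "finite (add_mset i ` {m. P m \<noteq> \<zero>})"
      using indexed_pmult by (simp add: is_mpoly_def)
    moreover have "set_mset m \<subseteq> V" if "i \<in># m" "P (m - {#i#}) \<noteq> \<zero>" for m
    proof -
      have "set_mset (m - {#i#}) \<subseteq> V" using that indexed_pmult by (simp add: is_mpoly_def)
      then have "set_mset (add_mset i (m - {#i#})) \<subseteq> V" using indexed_pmult by simp
      then show ?thesis using that by simp
    qed
    ultimately show ?case
      using indexed_pmult.IH
      by (auto simp: indexed_pmult_def is_mpoly_def split: if_splits intro: finite_subset)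
  qed
next
  fix f assume "is_mpoly V f"
  then show "f \<in> indexed_pset V (carrier R)"
  proof (induction rule: is_mpoly_induct)
    case zero
    show ?case using indexed_pset.indexed_const[of \<zero> "carrier R" V] by (simp add: indexed_zero_def)
  next
    case (monom c a)
    from monom(2) show ?case
    proof (induction a)
      case empty
      show ?case using monom(1) indexed_pset.indexed_const by (simp flip: indexed_const_eq_term)
    next
      case (add i a)
      have "mpoly_term c (add_mset i a) = indexed_pmult (mpoly_term c a) i"
        by (auto simp: indexed_pmult_def mpoly_term_def fun_eq_iff)
      then show ?case
        using add indexed_pset.indexed_pmult[of "mpoly_term c a" V "carrier R" i] by simp
    qed
  next
    case (add f g)
    then show ?case
      using indexed_pset.indexed_padd[of f V "carrier R" g] by (simp add: indexed_padd_def)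
  qed
qed

lemma carrier_mpoly_ring: "carrier (mpoly_ring R V) = Collect (is_mpoly V)"
  by (simp add: mpoly_ring_def indexed_pset_eq_is_mpoly)

lemma mem_mpoly_ring_iff: "f \<in> carrier (mpoly_ring R V) \<longleftrightarrow> is_mpoly V f"
  by (simp add: carrier_mpoly_ring)

lemma zero_mpoly_ring: "\<zero>\<^bsub>mpoly_ring R V\<^esub> = (\<lambda>_. \<zero>)"
  by (simp add: mpoly_ring_def indexed_zero_def)

lemma one_mpoly_ring: "\<one>\<^bsub>mpoly_ring R V\<^esub> = mpoly_term \<one> {#}"
  by (auto simp: mpoly_ring_def indexed_const_def mpoly_term_def)

lemma add_mpoly_ring: "f \<oplus>\<^bsub>mpoly_ring R V\<^esub> g = (\<lambda>m. f m \<oplus> g m)"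
  by (simp add: mpoly_ring_def indexed_padd_def)

lemma mult_mpoly_ring:
  "f \<otimes>\<^bsub>mpoly_ring R V\<^esub> g = (\<lambda>m. \<Oplus>a \<in> {a. a \<subseteq># m}. f a \<otimes> g (m - a))"
  by (simp add: mpoly_ring_def)

lemma term_mult_mpoly:
  assumes c: "c \<in> carrier R" and g: "is_mpoly V g"
  shows "mpoly_term c a \<otimes>\<^bsub>mpoly_ring R V\<^esub> g =
    (\<lambda>m. if a \<subseteq># m then c \<otimes> g (m - a) else \<zero>)"
proof
  fix m
  have "(\<Oplus>b \<in> {b. b \<subseteq># m}. mpoly_term c a b \<otimes> g (m - b)) =
      (\<Oplus>b \<in> {b. b \<subseteq># m}. if a = b then c \<otimes> g (m - b) else \<zero>)"
    using c is_mpoly_coeff[OF g] by (intro finsum_cong') (auto simp: mpoly_term_def)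
  also have "\<dots> = (if a \<subseteq># m then c \<otimes> g (m - a) else \<zero>)"
  proof (cases "a \<subseteq># m")
    case True
    then show ?thesis
      using c is_mpoly_coeff[OF g] add.finprod_singleton[of a "{b. b \<subseteq># m}" "\<lambda>b. c \<otimes> g (m - b)"]
      by (simp add: finite_submultisets)
  next
    case False
    have "(\<Oplus>b \<in> {b. b \<subseteq># m}. if a = b then c \<otimes> g (m - b) else \<zero>) =
        (\<Oplus>b \<in> {b. b \<subseteq># m}. \<zero>)"
      using False by (intro finsum_cong') auto
    then show ?thesis using False by simp
  qed
  finally show "(mpoly_term c a \<otimes>\<^bsub>mpoly_ring R V\<^esub> g) m = (if a \<subseteq># m then c \<otimes> g (m - a) else \<zero>)"
    by (simp add: mult_mpoly_ring)
qed

lemma term_mult_term: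
  assumes c: "c \<in> carrier R" and d: "d \<in> carrier R"
  shows "mpoly_term c a \<otimes>\<^bsub>mpoly_ring R V\<^esub> mpoly_term d b = mpoly_term (c \<otimes> d) (a + b)"
proof
  fix m
  have "(mpoly_term c a \<otimes>\<^bsub>mpoly_ring R V\<^esub> mpoly_term d b) m
      = (mpoly_term c a \<otimes>\<^bsub>mpoly_ring R UNIV\<^esub> mpoly_term d b) m"
    by (simp add: mult_mpoly_ring)
  also have "\<dots> = (if a \<subseteq># m then c \<otimes> mpoly_term d b (m - a) else \<zero>)"
    using term_mult_mpoly[OF c is_mpoly_term[OF d subset_UNIV]] by (rule fun_cong)
  also have "\<dots> = mpoly_term (c \<otimes> d) (a + b) m"
  proof (cases "a \<subseteq># m")
    case True
    then have "m - a = b \<longleftrightarrow> m = a + b" by auto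
    then show ?thesis using True c by (simp add: mpoly_term_def)
  next
    case False
    then have "m \<noteq> a + b" by auto
    then show ?thesis using False by (simp add: mpoly_term_def)
  qed
  finally show "(mpoly_term c a \<otimes>\<^bsub>mpoly_ring R V\<^esub> mpoly_term d b) m = mpoly_term (c \<otimes> d) (a + b) m" .
qed

lemma mpoly_mult_distrib:
  assumes "is_mpoly V f" "is_mpoly V g" "is_mpoly V h"
  shows "(\<lambda>m. f m \<oplus> g m) \<otimes>\<^bsub>mpoly_ring R V\<^esub> h =
    (\<lambda>m. (f \<otimes>\<^bsub>mpoly_ring R V\<^esub> h) m \<oplus> (g \<otimes>\<^bsub>mpoly_ring R V\<^esub> h) m)"
    and "h \<otimes>\<^bsub>mpoly_ring R V\<^esub> (\<lambda>m. f m \<oplus> g m) =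
    (\<lambda>m. (h \<otimes>\<^bsub>mpoly_ring R V\<^esub> f) m \<oplus> (h \<otimes>\<^bsub>mpoly_ring R V\<^esub> g) m)"
proof -
  note coeff = is_mpoly_coeff[OF assms(1)] is_mpoly_coeff[OF assms(2)] is_mpoly_coeff[OF assms(3)]
  show "(\<lambda>m. f m \<oplus> g m) \<otimes>\<^bsub>mpoly_ring R V\<^esub> h =
    (\<lambda>m. (f \<otimes>\<^bsub>mpoly_ring R V\<^esub> h) m \<oplus> (g \<otimes>\<^bsub>mpoly_ring R V\<^esub> h) m)"
  proof
    fix m
    have "(\<Oplus>a \<in> {a. a \<subseteq># m}. (f a \<oplus> g a) \<otimes> h (m - a)) =
        (\<Oplus>a \<in> {a. a \<subseteq># m}. f a \<otimes> h (m - a) \<oplus> g a \<otimes> h (m - a))"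
      using coeff by (simp add: l_distr)
    also have "\<dots> = (\<Oplus>a \<in> {a. a \<subseteq># m}. f a \<otimes> h (m - a)) \<oplus> (\<Oplus>a \<in> {a. a \<subseteq># m}. g a \<otimes> h (m - a))"
      using coeff by (intro finsum_addf) auto
    finally show "((\<lambda>m. f m \<oplus> g m) \<otimes>\<^bsub>mpoly_ring R V\<^esub> h) m =
        (f \<otimes>\<^bsub>mpoly_ring R V\<^esub> h) m \<oplus> (g \<otimes>\<^bsub>mpoly_ring R V\<^esub> h) m"
      by (simp add: mult_mpoly_ring)
  qed
  show "h \<otimes>\<^bsub>mpoly_ring R V\<^esub> (\<lambda>m. f m \<oplus> g m) =
    (\<lambda>m. (h \<otimes>\<^bsub>mpoly_ring R V\<^esub> f) m \<oplus> (h \<otimes>\<^bsub>mpoly_ring R V\<^esub> g) m)"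
  proof
    fix m
    have "(\<Oplus>a \<in> {a. a \<subseteq># m}. h a \<otimes> (f (m - a) \<oplus> g (m - a))) =
        (\<Oplus>a \<in> {a. a \<subseteq># m}. h a \<otimes> f (m - a) \<oplus> h a \<otimes> g (m - a))"
      using coeff by (simp add: r_distr)
    also have "\<dots> = (\<Oplus>a \<in> {a. a \<subseteq># m}. h a \<otimes> f (m - a)) \<oplus> (\<Oplus>a \<in> {a. a \<subseteq># m}. h a \<otimes> g (m - a))"
      using coeff by (intro finsum_addf) auto
    finally show "(h \<otimes>\<^bsub>mpoly_ring R V\<^esub> (\<lambda>m. f m \<oplus> g m)) m =
        (h \<otimes>\<^bsub>mpoly_ring R V\<^esub> f) m \<oplus> (h \<otimes>\<^bsub>mpoly_ring R V\<^esub> g) m"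
      by (simp add: mult_mpoly_ring)
  qed
qed

lemma mpoly_mult_zero:
  assumes "is_mpoly V f"
  shows "(\<lambda>_. \<zero>) \<otimes>\<^bsub>mpoly_ring R V\<^esub> f = (\<lambda>_. \<zero>)" "f \<otimes>\<^bsub>mpoly_ring R V\<^esub> (\<lambda>_. \<zero>) = (\<lambda>_. \<zero>)"
  using is_mpoly_coeff[OF assms] by (auto simp: mult_mpoly_ring fun_eq_iff intro!: add.finprod_one_eqI)

lemma is_mpoly_mult:
  assumes f: "is_mpoly V f" and g: "is_mpoly V g"
  shows "is_mpoly V (f \<otimes>\<^bsub>mpoly_ring R V\<^esub> g)"
  using f
proof (induction rule: is_mpoly_induct)
  case zero
  show ?case using g by (simp add: mpoly_mult_zero is_mpoly_zero)
next
  case (monom c a)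
  show ?case
    using g
  proof (induction rule: is_mpoly_induct)
    case zero
    show ?case using monom by (simp add: mpoly_mult_zero is_mpoly_term is_mpoly_zero)
  next
    case inner: (monom d b)
    show ?case
      using monom inner by (simp add: term_mult_term is_mpoly_term)
  next
    case (add g h)
    then show ?case
      using mpoly_mult_distrib(2)[OF add(1,2) is_mpoly_term[OF monom]] by (simp add: is_mpoly_add)
  qed
next
  case (add h k)
  then show ?case
    using mpoly_mult_distrib(1)[OF add(1,2) g] by (simp add: is_mpoly_add)
qed

lemma mpoly_mult_assoc:
  assumes f: "is_mpoly V f" and g: "is_mpoly V g" and h: "is_mpoly V h"
  shows "(f \<otimes>\<^bsub>mpoly_ring R V\<^esub> g) \<otimes>\<^bsub>mpoly_ring R V\<^esub> h = f \<otimes>\<^bsub>mpoly_ring R V\<^esub> (g \<otimes>\<^bsub>mpoly_ring R V\<^esub> h)"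
  using f
proof (induction rule: is_mpoly_induct)
  case zero
  show ?case using g h by (simp add: mpoly_mult_zero is_mpoly_mult)
next
  case (monom c a)
  show ?case
    using g
  proof (induction rule: is_mpoly_induct)
    case zero
    show ?case using monom h by (simp add: mpoly_mult_zero is_mpoly_mult is_mpoly_term)
  next
    case inner: (monom d b)
    have split: "a + b \<subseteq># m \<longleftrightarrow> a \<subseteq># m \<and> b \<subseteq># m - a" for m
      by (metis add.commute subset_mset.le_diff_conv2 mset_subset_eq_add_left subset_mset.order_trans)
    have bh: "is_mpoly V (mpoly_term d b \<otimes>\<^bsub>mpoly_ring R V\<^esub> h)"
      using inner h by (simp add: is_mpoly_mult is_mpoly_term)
    have cd: "c \<otimes> d \<in> carrier R" using monom inner by simp
    show ?case
      by (simp only: term_mult_term[OF monom(1) inner(1)] term_mult_mpoly[OF monom(1) bh]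
          term_mult_mpoly[OF cd h])
        (use monom inner is_mpoly_coeff[OF h] in
          \<open>auto simp: term_mult_mpoly[OF inner(1) h] split m_assoc fun_eq_iff\<close>)
  next
    case (add k l)
    then show ?case
      using monom h by (simp add: mpoly_mult_distrib[where V = V] is_mpoly_mult is_mpoly_term)
  qed
next
  case (add k l)
  then show ?case
    using g h by (simp add: mpoly_mult_distrib[where V = V] is_mpoly_mult)
qed

end

context cring
begin

lemma mpoly_mult_comm:
  assumes f: "is_mpoly V f" and g: "is_mpoly V g"
  shows "f \<otimes>\<^bsub>mpoly_ring R V\<^esub> g = g \<otimes>\<^bsub>mpoly_ring R V\<^esub> f"
  using f
proof (induction rule: is_mpoly_induct)
  case zero
  show ?case using g by (simp add: mpoly_mult_zero)
next
  case (monom c a)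
  show ?case
    using g
  proof (induction rule: is_mpoly_induct)
    case zero
    show ?case using monom by (simp add: mpoly_mult_zero is_mpoly_term)
  next
    case inner: (monom d b)
    then show ?case using monom by (simp add: term_mult_term m_comm add.commute)
  next
    case (add k l)
    then show ?case
      using monom by (simp add: mpoly_mult_distrib[where V = V] is_mpoly_term)
  qed
next
  case (add k l)
  then show ?case
    using g by (simp add: mpoly_mult_distrib[where V = V])
qed

lemma cring_mpoly_ring: "cring (mpoly_ring R V)"
proof (rule cringI)
  have neg: "\<exists>g. is_mpoly V g \<and> (\<lambda>m. g m \<oplus> f m) = (\<lambda>_. \<zero>)" if "is_mpoly V f" for f
  proof (intro exI[of _ "\<lambda>m. \<ominus> f m"] conjI)
    show "is_mpoly V (\<lambda>m. \<ominus> f m)"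
      using that by (simp add: is_mpoly_def)
  qed (use is_mpoly_coeff[OF that] in \<open>simp add: l_neg\<close>)
  have coeff: "f m \<in> carrier R" if "f \<in> carrier (mpoly_ring R V)" for f m
    using that by (simp add: mem_mpoly_ring_iff is_mpoly_coeff)
  show "abelian_group (mpoly_ring R V)"
  proof (rule abelian_groupI)
    fix f g h
    assume f: "f \<in> carrier (mpoly_ring R V)" and g: "g \<in> carrier (mpoly_ring R V)"
      and h: "h \<in> carrier (mpoly_ring R V)"
    show "f \<oplus>\<^bsub>mpoly_ring R V\<^esub> g \<oplus>\<^bsub>mpoly_ring R V\<^esub> h =
        f \<oplus>\<^bsub>mpoly_ring R V\<^esub> (g \<oplus>\<^bsub>mpoly_ring R V\<^esub> h)"
      using coeff[OF f] coeff[OF g] coeff[OF h] by (simp add: add_mpoly_ring a_assoc)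
  next
    fix f g
    assume f: "f \<in> carrier (mpoly_ring R V)" and g: "g \<in> carrier (mpoly_ring R V)"
    show "f \<oplus>\<^bsub>mpoly_ring R V\<^esub> g = g \<oplus>\<^bsub>mpoly_ring R V\<^esub> f"
      using coeff[OF f] coeff[OF g] by (simp add: add_mpoly_ring a_comm)
    show "f \<oplus>\<^bsub>mpoly_ring R V\<^esub> g \<in> carrier (mpoly_ring R V)"
      using f g by (simp add: mem_mpoly_ring_iff add_mpoly_ring is_mpoly_add)
    show "\<zero>\<^bsub>mpoly_ring R V\<^esub> \<oplus>\<^bsub>mpoly_ring R V\<^esub> f = f"
      using coeff[OF f] by (simp add: add_mpoly_ring zero_mpoly_ring)
    show "\<exists>g \<in> carrier (mpoly_ring R V). g \<oplus>\<^bsub>mpoly_ring R V\<^esub> f = \<zero>\<^bsub>mpoly_ring R V\<^esub>"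
      using neg[of f] f unfolding Bex_def by (simp add: mem_mpoly_ring_iff add_mpoly_ring zero_mpoly_ring)
  qed (simp add: mem_mpoly_ring_iff zero_mpoly_ring is_mpoly_zero)
  show "comm_monoid (mpoly_ring R V)"
  proof (rule comm_monoidI)
    fix f assume f: "f \<in> carrier (mpoly_ring R V)"
    show "\<one>\<^bsub>mpoly_ring R V\<^esub> \<otimes>\<^bsub>mpoly_ring R V\<^esub> f = f"
      using coeff[OF f] f by (simp add: mem_mpoly_ring_iff one_mpoly_ring term_mult_mpoly)
  next
    fix f g h
    assume f: "f \<in> carrier (mpoly_ring R V)" and g: "g \<in> carrier (mpoly_ring R V)"
      and h: "h \<in> carrier (mpoly_ring R V)"
    show "f \<otimes>\<^bsub>mpoly_ring R V\<^esub> g \<otimes>\<^bsub>mpoly_ring R V\<^esub> h =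
        f \<otimes>\<^bsub>mpoly_ring R V\<^esub> (g \<otimes>\<^bsub>mpoly_ring R V\<^esub> h)"
      using f g h by (simp only: mem_mpoly_ring_iff mpoly_mult_assoc)
    show "f \<otimes>\<^bsub>mpoly_ring R V\<^esub> g = g \<otimes>\<^bsub>mpoly_ring R V\<^esub> f"
      using f g by (simp only: mem_mpoly_ring_iff mpoly_mult_comm)
  qed (simp_all add: mem_mpoly_ring_iff one_mpoly_ring is_mpoly_term is_mpoly_mult)
  show "(f \<oplus>\<^bsub>mpoly_ring R V\<^esub> g) \<otimes>\<^bsub>mpoly_ring R V\<^esub> h =
      f \<otimes>\<^bsub>mpoly_ring R V\<^esub> h \<oplus>\<^bsub>mpoly_ring R V\<^esub> g \<otimes>\<^bsub>mpoly_ring R V\<^esub> h"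
    if "f \<in> carrier (mpoly_ring R V)" "g \<in> carrier (mpoly_ring R V)"
      "h \<in> carrier (mpoly_ring R V)" for f g h
    using that by (simp add: mem_mpoly_ring_iff add_mpoly_ring mpoly_mult_distrib[where V = V])
qed

lemma minus_mpoly_ring:
  assumes "is_mpoly V f" "is_mpoly V g"
  shows "f \<ominus>\<^bsub>mpoly_ring R V\<^esub> g = (\<lambda>m. f m \<ominus> g m)"
proof -
  interpret P: cring "mpoly_ring R V" by (rule cring_mpoly_ring)
  have n: "is_mpoly V (\<lambda>m. \<ominus> g m)"
    using assms by (simp add: is_mpoly_def)
  have "\<ominus>\<^bsub>mpoly_ring R V\<^esub> g = (\<lambda>m. \<ominus> g m)"
    using assms n is_mpoly_coeff[OF assms(2)] by (intro P.minus_equality)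
      (simp_all add: mem_mpoly_ring_iff add_mpoly_ring zero_mpoly_ring l_neg)
  then show ?thesis
    by (simp add: P.minus_eq add_mpoly_ring minus_eq)
qed

lemma is_mpoly_minus:
  assumes f: "is_mpoly V f" and g: "is_mpoly V g"
  shows "is_mpoly V (\<lambda>m. f m \<ominus> g m)"
proof -
  interpret P: cring "mpoly_ring R V" by (rule cring_mpoly_ring)
  have "f \<ominus>\<^bsub>mpoly_ring R V\<^esub> g \<in> carrier (mpoly_ring R V)"
    by (rule P.minus_closed) (simp_all only: mem_mpoly_ring_iff f g)
  then show ?thesis by (simp only: mem_mpoly_ring_iff minus_mpoly_ring[OF f g])
qed

lemma is_mpoly_smult:
  assumes c: "c \<in> carrier R" and f: "is_mpoly V f"
  shows "is_mpoly V (\<lambda>m. c \<otimes> f m)"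
  using is_mpoly_mult[OF is_mpoly_term[OF c, of "{#}"] f] by (simp add: term_mult_mpoly[OF c f])

end

section \<open>Localization and residue fields\<close>

lemma (in ideal) I_zero: "\<zero> \<in> I"
  by (rule additive_subgroup.zero_closed[OF is_additive_subgroup])

lemma (in ideal) I_add: "a \<in> I \<Longrightarrow> b \<in> I \<Longrightarrow> a \<oplus> b \<in> I"
  by (rule additive_subgroup.a_closed[OF is_additive_subgroup])

lemma (in ideal) I_minus: "a \<in> I \<Longrightarrow> b \<in> I \<Longrightarrow> a \<ominus> b \<in> I"
  unfolding minus_eq by (intro I_add additive_subgroup.a_inv_closed is_additive_subgroup)

lemma (in primeideal) one_in_complement: "\<one> \<in> carrier R - I"
  using I_notcarr one_imp_carrier by auto

text \<open>The operations of a localization are unions over all pairs of representatives. Such a union is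
  evaluated by showing that all its members agree.\<close>

lemma UN_pairs_constant:
  assumes "(a, s) \<in> \<xi>" "(b, t) \<in> \<eta>"
    and "\<And>a s b t. (a, s) \<in> \<xi> \<Longrightarrow> (b, t) \<in> \<eta> \<Longrightarrow> F a s b t = C"
  shows "(\<Union>(a, s) \<in> \<xi>. \<Union>(b, t) \<in> \<eta>. F a s b t) = C"
proof -
  have "(\<Union>(a, s) \<in> \<xi>. \<Union>(b, t) \<in> \<eta>. F a s b t) = (\<Union>x \<in> \<xi>. \<Union>y \<in> \<eta>. C)"
    using assms(3) by (intro SUP_cong refl) auto
  also have "\<dots> = C" using assms(1,2) by auto
  finally show ?thesis .
qed

locale mult_subset = cring R for R (structure) +
  fixes T :: "'a set"
  assumes T_subset: "T \<subseteq> carrier R" and one_T: "\<one> \<in> T"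
    and T_mult: "\<And>s t. s \<in> T \<Longrightarrow> t \<in> T \<Longrightarrow> s \<otimes> t \<in> T"
begin

abbreviation frac :: "'a \<Rightarrow> 'a \<Rightarrow> ('a \<times> 'a) set" where
  "frac \<equiv> fraction_class R T"

abbreviation L :: "('a \<times> 'a) set ring" where
  "L \<equiv> localization R T"

lemma T_carrier: "s \<in> T \<Longrightarrow> s \<in> carrier R"
  using T_subset by blast

lemma mem_frac: "(b, t) \<in> frac a s \<longleftrightarrow>
    b \<in> carrier R \<and> t \<in> T \<and> (\<exists>u \<in> T. u \<otimes> (a \<otimes> t) = u \<otimes> (b \<otimes> s))"
  by (simp add: fraction_class_def)

lemma frac_self: "a \<in> carrier R \<Longrightarrow> s \<in> T \<Longrightarrow> (a, s) \<in> frac a s"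
  using one_T by (auto simp: mem_frac)

lemma frac_subset:
  assumes a: "a \<in> carrier R" and s: "s \<in> T" and b: "b \<in> carrier R" and t: "t \<in> T"
    and u: "u \<in> T" "u \<otimes> (a \<otimes> t) = u \<otimes> (b \<otimes> s)"
  shows "frac b t \<subseteq> frac a s"
proof clarify
  fix c r assume "(c, r) \<in> frac b t"
  then obtain v where c: "c \<in> carrier R" and r: "r \<in> T" and v: "v \<in> T"
      and eq: "v \<otimes> (b \<otimes> r) = v \<otimes> (c \<otimes> t)"
    by (auto simp: mem_frac)
  note carr = a b c s[THEN T_carrier] t[THEN T_carrier] r[THEN T_carrier] u(1)[THEN T_carrier]
    v[THEN T_carrier]
  have "(u \<otimes> v \<otimes> t) \<otimes> (a \<otimes> r) = (u \<otimes> (a \<otimes> t)) \<otimes> (v \<otimes> r)"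
    using carr by algebra
  also have "\<dots> = (v \<otimes> (b \<otimes> r)) \<otimes> (u \<otimes> s)"
    unfolding u(2) using carr by algebra
  also have "\<dots> = (u \<otimes> v \<otimes> t) \<otimes> (c \<otimes> s)"
    unfolding eq using carr by algebra
  finally show "(c, r) \<in> frac a s"
    using c r T_mult[OF T_mult[OF u(1) v] t] unfolding mem_frac by blast
qed

lemma frac_eq_iff:
  assumes "a \<in> carrier R" "s \<in> T" "b \<in> carrier R" "t \<in> T"
  shows "frac a s = frac b t \<longleftrightarrow> (\<exists>u \<in> T. u \<otimes> (a \<otimes> t) = u \<otimes> (b \<otimes> s))"
proof
  assume "frac a s = frac b t"
  then have "(b, t) \<in> frac a s" using frac_self assms by simp
  then show "\<exists>u \<in> T. u \<otimes> (a \<otimes> t) = u \<otimes> (b \<otimes> s)" by (simp add: mem_frac)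
next
  assume "\<exists>u \<in> T. u \<otimes> (a \<otimes> t) = u \<otimes> (b \<otimes> s)"
  then obtain u where u: "u \<in> T" "u \<otimes> (a \<otimes> t) = u \<otimes> (b \<otimes> s)" by blast
  then show "frac a s = frac b t"
    using frac_subset[of a s b t u] frac_subset[of b t a s u] assms by simp
qed

lemma frac_eqI:
  assumes "a \<in> carrier R" "s \<in> T" "b \<in> carrier R" "t \<in> T" "a \<otimes> t = b \<otimes> s"
  shows "frac a s = frac b t"
  using assms one_T by (subst frac_eq_iff) auto

lemma carrier_L: "carrier L = {frac a s | a s. a \<in> carrier R \<and> s \<in> T}"
  by (simp add: localization_def)

lemma frac_in_L: "a \<in> carrier R \<Longrightarrow> s \<in> T \<Longrightarrow> frac a s \<in> carrier L"
  by (auto simp: carrier_L)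

lemma one_L: "\<one>\<^bsub>L\<^esub> = frac \<one> \<one>"
  by (simp add: localization_def)

lemma zero_L: "\<zero>\<^bsub>L\<^esub> = frac \<zero> \<one>"
  by (simp add: localization_def)

lemma mult_frac:
  assumes a: "a \<in> carrier R" and s: "s \<in> T" and b: "b \<in> carrier R" and t: "t \<in> T"
  shows "frac a s \<otimes>\<^bsub>L\<^esub> frac b t = frac (a \<otimes> b) (s \<otimes> t)"
proof -
  have "(\<Union>(a', s') \<in> frac a s. \<Union>(b', t') \<in> frac b t. frac (a' \<otimes> b') (s' \<otimes> t')) =
      frac (a \<otimes> b) (s \<otimes> t)"
  proof (rule UN_pairs_constant[OF frac_self[OF a s] frac_self[OF b t]])
    fix a' s' b' t' assume "(a', s') \<in> frac a s" "(b', t') \<in> frac b t"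
    then obtain u v where 1: "a' \<in> carrier R" "s' \<in> T" "b' \<in> carrier R" "t' \<in> T" "u \<in> T" "v \<in> T"
      and u: "u \<otimes> (a \<otimes> s') = u \<otimes> (a' \<otimes> s)" and v: "v \<otimes> (b \<otimes> t') = v \<otimes> (b' \<otimes> t)"
      by (auto simp: mem_frac)
    note carr = a b 1(1,3) s[THEN T_carrier] t[THEN T_carrier] 1(2,4,5,6)[THEN T_carrier]
    have "(u \<otimes> v) \<otimes> (a \<otimes> b \<otimes> (s' \<otimes> t')) = (u \<otimes> (a \<otimes> s')) \<otimes> (v \<otimes> (b \<otimes> t'))"
      using carr by algebra
    also have "\<dots> = (u \<otimes> v) \<otimes> (a' \<otimes> b' \<otimes> (s \<otimes> t))"
      unfolding u v using carr by algebra
    finally show "frac (a' \<otimes> b') (s' \<otimes> t') = frac (a \<otimes> b) (s \<otimes> t)"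
      using 1 assms T_mult by (intro frac_eq_iff[THEN iffD2] bexI[of _ "u \<otimes> v"]) auto
  qed
  then show ?thesis by (simp add: localization_def)
qed

lemma add_frac:
  assumes a: "a \<in> carrier R" and s: "s \<in> T" and b: "b \<in> carrier R" and t: "t \<in> T"
  shows "frac a s \<oplus>\<^bsub>L\<^esub> frac b t = frac (a \<otimes> t \<oplus> b \<otimes> s) (s \<otimes> t)"
proof -
  have "(\<Union>(a', s') \<in> frac a s. \<Union>(b', t') \<in> frac b t. frac (a' \<otimes> t' \<oplus> b' \<otimes> s') (s' \<otimes> t')) =
      frac (a \<otimes> t \<oplus> b \<otimes> s) (s \<otimes> t)"
  proof (rule UN_pairs_constant[OF frac_self[OF a s] frac_self[OF b t]])
    fix a' s' b' t' assume "(a', s') \<in> frac a s" "(b', t') \<in> frac b t"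
    then obtain u v where 1: "a' \<in> carrier R" "s' \<in> T" "b' \<in> carrier R" "t' \<in> T" "u \<in> T" "v \<in> T"
      and u: "u \<otimes> (a \<otimes> s') = u \<otimes> (a' \<otimes> s)" and v: "v \<otimes> (b \<otimes> t') = v \<otimes> (b' \<otimes> t)"
      by (auto simp: mem_frac)
    note carr = a b 1(1,3) s[THEN T_carrier] t[THEN T_carrier] 1(2,4,5,6)[THEN T_carrier]
    have "(u \<otimes> v) \<otimes> ((a \<otimes> t \<oplus> b \<otimes> s) \<otimes> (s' \<otimes> t')) =
        (u \<otimes> (a \<otimes> s')) \<otimes> (v \<otimes> t \<otimes> t') \<oplus> (v \<otimes> (b \<otimes> t')) \<otimes> (u \<otimes> s \<otimes> s')"
      using carr by algebra
    also have "\<dots> = (u \<otimes> v) \<otimes> ((a' \<otimes> t' \<oplus> b' \<otimes> s') \<otimes> (s \<otimes> t))"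
      unfolding u v using carr by algebra
    finally show "frac (a' \<otimes> t' \<oplus> b' \<otimes> s') (s' \<otimes> t') = frac (a \<otimes> t \<oplus> b \<otimes> s) (s \<otimes> t)"
      using 1 assms T_mult T_carrier
      by (intro frac_eq_iff[THEN iffD2] bexI[of _ "u \<otimes> v"]) auto
  qed
  then show ?thesis by (simp add: localization_def)
qed

lemma cring_localization: "cring L"
proof (rule cringI)
  note frac_simps = mult_frac add_frac one_L zero_L one_T T_mult T_carrier frac_in_L
  show "abelian_group L"
  proof (rule abelian_groupI)
    fix x y z assume "x \<in> carrier L" "y \<in> carrier L" "z \<in> carrier L"
    then obtain a s b t c r where x: "x = frac a s" "a \<in> carrier R" "s \<in> T"
      and y: "y = frac b t" "b \<in> carrier R" "t \<in> T" and z: "z = frac c r" "c \<in> carrier R" "r \<in> T"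
      by (auto simp: carrier_L)
    note carr = x(2) y(2) z(2) x(3)[THEN T_carrier] y(3)[THEN T_carrier] z(3)[THEN T_carrier]
    have "(a \<otimes> t \<oplus> b \<otimes> s) \<otimes> r \<oplus> c \<otimes> (s \<otimes> t) =
        a \<otimes> (t \<otimes> r) \<oplus> (b \<otimes> r \<oplus> c \<otimes> t) \<otimes> s"
      using carr by (simp add: l_distr r_distr m_ac a_ac)
    then show "x \<oplus>\<^bsub>L\<^esub> y \<oplus>\<^bsub>L\<^esub> z = x \<oplus>\<^bsub>L\<^esub> (y \<oplus>\<^bsub>L\<^esub> z)"
      using x(2,3) y(2,3) z(2,3) unfolding x(1) y(1) z(1) by (simp add: frac_simps m_assoc)
  next
    fix x y assume "x \<in> carrier L" "y \<in> carrier L"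
    then obtain a s b t where x: "x = frac a s" "a \<in> carrier R" "s \<in> T"
      and y: "y = frac b t" "b \<in> carrier R" "t \<in> T"
      by (auto simp: carrier_L)
    note carr = x(2) y(2) x(3)[THEN T_carrier] y(3)[THEN T_carrier]
    show "x \<oplus>\<^bsub>L\<^esub> y \<in> carrier L"
      using x(2,3) y(2,3) unfolding x(1) y(1) by (simp add: frac_simps)
    show "x \<oplus>\<^bsub>L\<^esub> y = y \<oplus>\<^bsub>L\<^esub> x"
      using x(2,3) y(2,3) carr unfolding x(1) y(1) by (simp add: add_frac a_comm m_comm)
    show "\<zero>\<^bsub>L\<^esub> \<oplus>\<^bsub>L\<^esub> x = x"
      using x(2,3) unfolding x(1) by (simp add: frac_simps)
    have "frac (\<ominus> a) s \<oplus>\<^bsub>L\<^esub> x = frac (\<ominus> a \<otimes> s \<oplus> a \<otimes> s) (s \<otimes> s)"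
      using x(2,3) unfolding x(1) by (simp add: add_frac)
    also have "\<ominus> a \<otimes> s \<oplus> a \<otimes> s = \<zero>"
      using carr by (simp add: l_minus l_neg)
    also have "frac \<zero> (s \<otimes> s) = \<zero>\<^bsub>L\<^esub>"
      unfolding zero_L using x(3) carr by (intro frac_eqI) (simp_all add: T_mult one_T)
    finally have "frac (\<ominus> a) s \<oplus>\<^bsub>L\<^esub> x = \<zero>\<^bsub>L\<^esub>" .
    then show "\<exists>y \<in> carrier L. y \<oplus>\<^bsub>L\<^esub> x = \<zero>\<^bsub>L\<^esub>"
      using frac_in_L[of "\<ominus> a" s] x(2,3) by auto
  qed (simp add: zero_L frac_in_L one_T)
  show "comm_monoid L"
  proof (rule comm_monoidI)
    fix x y z assume "x \<in> carrier L" "y \<in> carrier L" "z \<in> carrier L"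
    then obtain a s b t c r where x: "x = frac a s" "a \<in> carrier R" "s \<in> T"
      and y: "y = frac b t" "b \<in> carrier R" "t \<in> T" and z: "z = frac c r" "c \<in> carrier R" "r \<in> T"
      by (auto simp: carrier_L)
    then show "x \<otimes>\<^bsub>L\<^esub> y \<otimes>\<^bsub>L\<^esub> z = x \<otimes>\<^bsub>L\<^esub> (y \<otimes>\<^bsub>L\<^esub> z)"
      by (simp add: frac_simps m_assoc)
  next
    fix x y assume "x \<in> carrier L" "y \<in> carrier L"
    then obtain a s b t where x: "x = frac a s" "a \<in> carrier R" "s \<in> T"
      and y: "y = frac b t" "b \<in> carrier R" "t \<in> T"
      by (auto simp: carrier_L)
    then show "x \<otimes>\<^bsub>L\<^esub> y \<in> carrier L" "x \<otimes>\<^bsub>L\<^esub> y = y \<otimes>\<^bsub>L\<^esub> x" "\<one>\<^bsub>L\<^esub> \<otimes>\<^bsub>L\<^esub> x = x"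
      by (simp_all add: frac_simps m_comm)
  qed (simp add: one_L frac_in_L one_T)
  show "(x \<oplus>\<^bsub>L\<^esub> y) \<otimes>\<^bsub>L\<^esub> z = x \<otimes>\<^bsub>L\<^esub> z \<oplus>\<^bsub>L\<^esub> y \<otimes>\<^bsub>L\<^esub> z"
    if xyz: "x \<in> carrier L" "y \<in> carrier L" "z \<in> carrier L" for x y z
  proof -
    from xyz obtain a s b t c r where x: "x = frac a s" "a \<in> carrier R" "s \<in> T"
      and y: "y = frac b t" "b \<in> carrier R" "t \<in> T" and z: "z = frac c r" "c \<in> carrier R" "r \<in> T"
      by (auto simp: carrier_L)
    note carr = x(2) y(2) z(2) x(3)[THEN T_carrier] y(3)[THEN T_carrier] z(3)[THEN T_carrier]
    have num: "a \<otimes> c \<otimes> (t \<otimes> r) \<oplus> b \<otimes> c \<otimes> (s \<otimes> r) = (a \<otimes> t \<oplus> b \<otimes> s) \<otimes> c \<otimes> r"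
      using carr by (simp add: l_distr r_distr m_ac)
    have den: "s \<otimes> r \<otimes> (t \<otimes> r) = s \<otimes> t \<otimes> r \<otimes> r"
      using carr by (simp add: m_ac)
    have "(x \<oplus>\<^bsub>L\<^esub> y) \<otimes>\<^bsub>L\<^esub> z = frac ((a \<otimes> t \<oplus> b \<otimes> s) \<otimes> c) (s \<otimes> t \<otimes> r)"
      using x(2,3) y(2,3) z(2,3) unfolding x(1) y(1) z(1) by (simp add: frac_simps)
    also have "\<dots> = frac ((a \<otimes> t \<oplus> b \<otimes> s) \<otimes> c \<otimes> r) (s \<otimes> t \<otimes> r \<otimes> r)"
      using x(2,3) y(2,3) z(2,3) carr by (intro frac_eqI) (simp_all add: T_mult m_ac)
    also have "\<dots> = x \<otimes>\<^bsub>L\<^esub> z \<oplus>\<^bsub>L\<^esub> y \<otimes>\<^bsub>L\<^esub> z"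
      using x(2,3) y(2,3) z(2,3) unfolding x(1) y(1) z(1) by (simp add: frac_simps num den)
    finally show ?thesis .
  qed
qed

lemma frac_ring_hom: "(\<lambda>a. frac a \<one>) \<in> ring_hom R L"
  using one_T by (intro ring_hom_memI) (auto simp: mult_frac add_frac one_L frac_in_L)

end

lemma (in primeideal) mult_subset_complement: "mult_subset R (carrier R - I)"
proof
  show "\<one> \<in> carrier R - I"
    by (rule one_in_complement)
  show "s \<otimes> t \<in> carrier R - I" if "s \<in> carrier R - I" "t \<in> carrier R - I" for s t
    using that I_prime by auto
qed auto

text \<open>The residue field enters the argument through this list of properties only: it is the target
  of a homomorphism with kernel \<open>p\<close>, and its elements are quotients of elements of the image.\<close>

locale residue_hom = ring_hom_cring R F \<phi> + primeideal p R for R (structure) and F and \<phi> and p +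
  assumes hom_eq_zero_iff: "a \<in> carrier R \<Longrightarrow> \<phi> a = \<zero>\<^bsub>F\<^esub> \<longleftrightarrow> a \<in> p"
    and ex_numerator: "x \<in> carrier F \<Longrightarrow>
      \<exists>s \<in> carrier R - p. \<exists>a \<in> carrier R. \<phi> s \<otimes>\<^bsub>F\<^esub> x = \<phi> a"
    and ex_inverse: "s \<in> carrier R - p \<Longrightarrow> \<exists>y \<in> carrier F. y \<otimes>\<^bsub>F\<^esub> \<phi> s = \<one>\<^bsub>F\<^esub>"

context primeideal
begin

interpretation mult_subset R "carrier R - I"
  by (rule mult_subset_complement)

lemma
  shows maximal_ideal_at_eq:
    "maximal_ideal_at R I = {frac a s | a s. a \<in> I \<and> s \<in> carrier R - I}" (is "_ = ?M")
  and ideal_maximal_ideal_at: "ideal (maximal_ideal_at R I) L"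
proof -
  interpret L: cring L by (rule cring_localization)
  let ?T = "carrier R - I"
  have M: "ideal ?M L"
  proof (rule idealI[OF L.ring_axioms])
    show "subgroup ?M (add_monoid L)"
    proof (rule L.add.subgroupI)
      show "?M \<subseteq> carrier L"
      proof clarify
        fix a s assume "a \<in> I" "s \<in> carrier R" "s \<notin> I"
        then show "frac a s \<in> carrier L" using frac_in_L[OF Icarr, of a s] by simp
      qed
      have "\<zero> \<in> I" by (rule I_zero)
      then have "frac \<zero> \<one> \<in> ?M" using one_T by blast
      then show "?M \<noteq> {}" by (metis empty_iff)
      fix x assume "x \<in> ?M"
      then obtain a s where x: "x = frac a s" "a \<in> I" "s \<in> ?T" by blast
      have a: "a \<in> carrier R" using x(2) by (rule Icarr)
      have "frac (\<ominus> a) s \<oplus>\<^bsub>L\<^esub> x = frac (\<ominus> a \<otimes> s \<oplus> a \<otimes> s) (s \<otimes> s)"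
        unfolding x(1) using x(3) a by (intro add_frac) auto
      also have "\<ominus> a \<otimes> s \<oplus> a \<otimes> s = \<zero>"
        using x(3) a by (simp add: l_minus l_neg)
      also have "frac \<zero> (s \<otimes> s) = frac \<zero> \<one>"
        using x(3) T_mult[OF x(3) x(3)] one_T by (intro frac_eqI) auto
      finally have "\<ominus>\<^bsub>L\<^esub> x = frac (\<ominus> a) s"
        using x a by (intro L.minus_equality) (auto simp: zero_L frac_in_L)
      then show "\<ominus>\<^bsub>L\<^esub> x \<in> ?M"
        using x(3) additive_subgroup.a_inv_closed[OF is_additive_subgroup x(2)] by blast
      fix y assume "y \<in> ?M"
      then obtain b t where y: "y = frac b t" "b \<in> I" "t \<in> ?T" by blast
      have b: "b \<in> carrier R" using y(2) by (rule Icarr)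
      have "x \<oplus>\<^bsub>L\<^esub> y = frac (a \<otimes> t \<oplus> b \<otimes> s) (s \<otimes> t)"
        using x y a b by (simp add: add_frac)
      moreover have "a \<otimes> t \<oplus> b \<otimes> s \<in> I"
        using x(2,3) y(2,3) by (intro I_add I_r_closed) auto
      ultimately show "x \<oplus>\<^bsub>L\<^esub> y \<in> ?M"
        using T_mult[OF x(3) y(3)] by force
    qed
    fix x y assume "x \<in> ?M" and "y \<in> carrier L"
    then obtain a s b t where x: "x = frac a s" "a \<in> I" "s \<in> ?T"
      and y: "y = frac b t" "b \<in> carrier R" "t \<in> ?T" unfolding carrier_L by blast
    have a: "a \<in> carrier R" using x(2) by (rule Icarr)
    have "y \<otimes>\<^bsub>L\<^esub> x = frac (b \<otimes> a) (t \<otimes> s)" "x \<otimes>\<^bsub>L\<^esub> y = frac (a \<otimes> b) (s \<otimes> t)"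
      using x y a by (simp_all add: mult_frac)
    then show "y \<otimes>\<^bsub>L\<^esub> x \<in> ?M" "x \<otimes>\<^bsub>L\<^esub> y \<in> ?M"
      using T_mult[OF x(3) y(3)] T_mult[OF y(3) x(3)] I_l_closed[OF x(2) y(2)] I_r_closed[OF x(2) y(2)]
      by blast+
  qed
  let ?G = "(\<lambda>a. frac a \<one>) ` I"
  have G: "?G \<subseteq> carrier L" using frac_in_L[OF Icarr one_T] by (rule image_subsetI)
  have "?M \<subseteq> Idl\<^bsub>L\<^esub> ?G"
  proof clarify
    fix a s assume as: "a \<in> I" "s \<in> carrier R" "s \<notin> I"
    have a: "a \<in> carrier R" using as(1) by (rule Icarr)
    have "frac \<one> s \<otimes>\<^bsub>L\<^esub> frac a \<one> \<in> Idl\<^bsub>L\<^esub> ?G"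
      using as L.genideal_self[OF G] one_T by (intro ideal.I_l_closed[OF L.genideal_ideal[OF G]])
        (auto simp: frac_in_L)
    then show "frac a s \<in> Idl\<^bsub>L\<^esub> ?G"
      using as one_T a by (simp add: mult_frac)
  qed
  moreover have "Idl\<^bsub>L\<^esub> ?G \<subseteq> ?M"
    using one_T by (intro L.genideal_minimal[OF M]) blast
  ultimately show "maximal_ideal_at R I = ?M"
    by (simp add: maximal_ideal_at_def local_ring_at_def)
  then show "ideal (maximal_ideal_at R I) L" using M by simp
qed

lemma residue_hom_residue_map: "residue_hom R (residue_field R I) (residue_map R I) I"
proof -
  interpret L: cring L by (rule cring_localization)
  interpret m: ideal "maximal_ideal_at R I" L by (rule ideal_maximal_ideal_at)
  let ?q = "\<lambda>x. maximal_ideal_at R I +>\<^bsub>L\<^esub> x"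
  have F: "residue_field R I = L Quot maximal_ideal_at R I"
    by (simp add: residue_field_def local_ring_at_def)
  have \<phi>: "residue_map R I = (\<lambda>a. ?q (frac a \<one>))"
    by (simp add: residue_map_def local_ring_at_def fun_eq_iff)
  interpret F: cring "residue_field R I"
    unfolding F by (rule m.quotient_is_cring[OF L.is_cring])
  have q: "?q \<in> ring_hom L (residue_field R I)"
    unfolding F by (rule m.rcos_ring_hom)
  have hom: "residue_map R I \<in> ring_hom R (residue_field R I)"
    using ring_hom_trans[OF frac_ring_hom q] unfolding \<phi> by (simp add: comp_def)
  have zero: "\<zero>\<^bsub>residue_field R I\<^esub> = maximal_ideal_at R I"
    by (simp add: F FactRing_def)
  show ?thesis
  proof (intro residue_hom.intro residue_hom_axioms.intro)
    show "primeideal I R" by (rule primeideal_axioms)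
    show "ring_hom_cring R (residue_field R I) (residue_map R I)"
      using hom by (intro ring_hom_cring.intro ring_hom_cring_axioms.intro) (auto intro: is_cring F.is_cring)
    fix a assume a: "a \<in> carrier R"
    have "residue_map R I a = \<zero>\<^bsub>residue_field R I\<^esub> \<longleftrightarrow> frac a \<one> \<in> maximal_ideal_at R I"
      unfolding \<phi> zero
      using L.a_rcos_zero[OF m.is_ideal] m.rcos_const_imp_mem frac_in_L[OF a one_T] by blast
    also have "\<dots> \<longleftrightarrow> a \<in> I"
    proof
      assume "frac a \<one> \<in> maximal_ideal_at R I"
      then obtain b s where b: "frac a \<one> = frac b s" "b \<in> I" "s \<in> carrier R - I"
        unfolding maximal_ideal_at_eq by blast
      have bc: "b \<in> carrier R" using b(2) by (rule Icarr)
      obtain u where u: "u \<in> carrier R - I" "u \<otimes> (a \<otimes> s) = u \<otimes> (b \<otimes> \<one>)"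
        using frac_eq_iff[of a \<one> b s] a one_T b bc by auto
      have "u \<otimes> (a \<otimes> s) \<in> I"
        using u(1) b(2) bc unfolding u(2) by (simp add: I_l_closed)
      then show "a \<in> I"
        using u(1) b(3) a I_prime[of u "a \<otimes> s"] I_prime[of a s] by blast
    next
      assume "a \<in> I"
      then show "frac a \<one> \<in> maximal_ideal_at R I"
        using one_T unfolding maximal_ideal_at_eq by blast
    qed
    finally show "residue_map R I a = \<zero>\<^bsub>residue_field R I\<^esub> \<longleftrightarrow> a \<in> I" .
  next
    fix x assume "x \<in> carrier (residue_field R I)"
    then obtain y where "y \<in> carrier L" "x = ?q y"
      unfolding F by (auto simp: FactRing_def A_RCOSETS_def')
    then obtain a s where a: "a \<in> carrier R" and s: "s \<in> carrier R - I" and x: "x = ?q (frac a s)"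
      by (auto simp: carrier_L)
    have "residue_map R I s \<otimes>\<^bsub>residue_field R I\<^esub> x = ?q (frac s \<one> \<otimes>\<^bsub>L\<^esub> frac a s)"
      unfolding \<phi> x using ring_hom_mult[OF q, of "frac s \<one>" "frac a s"] a s one_T by (simp add: frac_in_L)
    also have "frac s \<one> \<otimes>\<^bsub>L\<^esub> frac a s = frac a \<one>"
      unfolding mult_frac[OF T_carrier[OF s] one_T a s]
      using a s one_T by (intro frac_eqI) (simp_all add: m_comm)
    finally show "\<exists>s \<in> carrier R - I. \<exists>a \<in> carrier R.
        residue_map R I s \<otimes>\<^bsub>residue_field R I\<^esub> x = residue_map R I a"
      using a s unfolding \<phi> by blast
  next
    fix s assume s: "s \<in> carrier R - I"
    have "?q (frac \<one> s) \<otimes>\<^bsub>residue_field R I\<^esub> residue_map R I s = ?q (frac \<one> s \<otimes>\<^bsub>L\<^esub> frac s \<one>)"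
      unfolding \<phi> using ring_hom_mult[OF q, of "frac \<one> s" "frac s \<one>"] s one_T by (simp add: frac_in_L)
    also have "frac \<one> s \<otimes>\<^bsub>L\<^esub> frac s \<one> = \<one>\<^bsub>L\<^esub>"
      unfolding one_L mult_frac[OF one_closed s T_carrier[OF s] one_T]
      using s one_T by (intro frac_eqI) simp_all
    finally show "\<exists>y \<in> carrier (residue_field R I).
        y \<otimes>\<^bsub>residue_field R I\<^esub> residue_map R I s = \<one>\<^bsub>residue_field R I\<^esub>"
      using ring_hom_closed[OF q, of "frac \<one> s"] ring_hom_one[OF q] s by (auto simp: frac_in_L)
  qed
qed

end

section \<open>Extension of ideals to the fibres\<close>

context ring_hom_cring
begin

lemma is_mpoly_map: "R.is_mpoly V f \<Longrightarrow> S.is_mpoly V (\<lambda>m. h (f m))"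
proof -
  assume f: "R.is_mpoly V f"
  have nz: "f m \<noteq> \<zero>" if "h (f m) \<noteq> \<zero>\<^bsub>S\<^esub>" for m
    using that by auto
  then have "{m. h (f m) \<noteq> \<zero>\<^bsub>S\<^esub>} \<subseteq> {m. f m \<noteq> \<zero>}" by blast
  then have "finite {m. h (f m) \<noteq> \<zero>\<^bsub>S\<^esub>}"
    using f unfolding R.is_mpoly_def by (meson finite_subset)
  then show ?thesis
    using f nz unfolding R.is_mpoly_def S.is_mpoly_def by simp
qed

lemma map_mpoly_term: "c \<in> carrier R \<Longrightarrow> (\<lambda>m. h (R.mpoly_term c a m)) = S.mpoly_term (h c) a"
  by (auto simp: R.mpoly_term_def S.mpoly_term_def fun_eq_iff)

lemma mpoly_map_ring_hom: "(\<lambda>f m. h (f m)) \<in> ring_hom (mpoly_ring R V) (mpoly_ring S V)"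
proof (rule ring_hom_memI)
  fix f assume f: "f \<in> carrier (mpoly_ring R V)"
  then show "(\<lambda>m. h (f m)) \<in> carrier (mpoly_ring S V)"
    by (simp add: R.mem_mpoly_ring_iff S.mem_mpoly_ring_iff is_mpoly_map)
  fix g assume g: "g \<in> carrier (mpoly_ring R V)"
  have coeff: "f m \<in> carrier R" "g m \<in> carrier R" for m
    using f g by (simp_all add: R.mem_mpoly_ring_iff R.is_mpoly_coeff)
  show "(\<lambda>m. h ((f \<oplus>\<^bsub>mpoly_ring R V\<^esub> g) m)) = (\<lambda>m. h (f m)) \<oplus>\<^bsub>mpoly_ring S V\<^esub> (\<lambda>m. h (g m))"
    using coeff by (simp add: R.add_mpoly_ring S.add_mpoly_ring)
  show "(\<lambda>m. h ((f \<otimes>\<^bsub>mpoly_ring R V\<^esub> g) m)) = (\<lambda>m. h (f m)) \<otimes>\<^bsub>mpoly_ring S V\<^esub> (\<lambda>m. h (g m))"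
  proof
    fix m
    have "h (\<Oplus>a \<in> {a. a \<subseteq># m}. f a \<otimes> g (m - a)) =
        (\<Oplus>\<^bsub>S\<^esub>a \<in> {a. a \<subseteq># m}. h (f a \<otimes> g (m - a)))"
      using coeff by (subst hom_finsum) (auto simp: comp_def)
    then show "h ((f \<otimes>\<^bsub>mpoly_ring R V\<^esub> g) m) = ((\<lambda>m. h (f m)) \<otimes>\<^bsub>mpoly_ring S V\<^esub> (\<lambda>m. h (g m))) m"
      using coeff by (simp add: R.mult_mpoly_ring S.mult_mpoly_ring)
  qed
next
  show "(\<lambda>m. h (\<one>\<^bsub>mpoly_ring R V\<^esub> m)) = \<one>\<^bsub>mpoly_ring S V\<^esub>"
    by (simp add: R.one_mpoly_ring S.one_mpoly_ring map_mpoly_term)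
qed

end

text \<open>The condition \<open>s f \<in> J + pR[x]\<close> for some \<open>s \<notin> p\<close>, which is membership of \<open>f\<close> in the extension of
  \<open>J\<close> to the fibre over \<open>p\<close> with denominators cleared. Unlike the extension itself, it can be
  compared for different primes.\<close>

definition fibre_member ::
  "('a, 'r) ring_scheme \<Rightarrow> ('v multiset \<Rightarrow> 'a) set \<Rightarrow> 'a set \<Rightarrow> ('v multiset \<Rightarrow> 'a) \<Rightarrow> bool" where
  "fibre_member R J p f \<longleftrightarrow>
     (\<exists>s \<in> carrier R - p. \<exists>j \<in> J. \<forall>m. s \<otimes>\<^bsub>R\<^esub> f m \<ominus>\<^bsub>R\<^esub> j m \<in> p)"

context residue_hom
begin

lemma hom_eq_iff:
  assumes "a \<in> carrier R" "b \<in> carrier R"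
  shows "\<phi> a = \<phi> b \<longleftrightarrow> a \<ominus> b \<in> p"
proof -
  have "\<phi> (a \<ominus> b) = \<phi> a \<ominus>\<^bsub>F\<^esub> \<phi> b"
    using assms by (simp add: R.minus_eq S.minus_eq)
  then have "\<phi> a = \<phi> b \<longleftrightarrow> \<phi> (a \<ominus> b) = \<zero>\<^bsub>F\<^esub>"
    using assms by simp
  also have "\<dots> \<longleftrightarrow> a \<ominus> b \<in> p"
    using assms by (intro hom_eq_zero_iff R.minus_closed)
  finally show ?thesis .
qed

text \<open>A polynomial has finitely many coefficients, so the product of their denominators serves all.\<close>

lemma ex_common_denominator:
  assumes "S.is_mpoly V g"
  shows "\<exists>s \<in> carrier R - p. \<exists>g0. R.is_mpoly V g0 \<and> (\<forall>m. \<phi> s \<otimes>\<^bsub>F\<^esub> g m = \<phi> (g0 m))"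
  using assms
proof (induction rule: S.is_mpoly_induct)
  case zero
  have "\<one> \<in> carrier R - p" by (rule one_in_complement)
  moreover have "\<forall>m. \<phi> \<one> \<otimes>\<^bsub>F\<^esub> \<zero>\<^bsub>F\<^esub> = \<phi> ((\<lambda>_. \<zero>) m)" by simp
  ultimately show ?case using R.is_mpoly_zero[of V] by blast
next
  case (monom c a)
  from ex_numerator[OF monom(1)] obtain s d
    where s: "s \<in> carrier R - p" and d: "d \<in> carrier R" and eq: "\<phi> s \<otimes>\<^bsub>F\<^esub> c = \<phi> d" by blast
  have "\<forall>m. \<phi> s \<otimes>\<^bsub>F\<^esub> S.mpoly_term c a m = \<phi> (R.mpoly_term d a m)"
    using s eq by (simp add: S.mpoly_term_def R.mpoly_term_def)
  then show ?case using R.is_mpoly_term[OF d monom(2)] s by blast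
next
  case (add f g)
  from add(3) obtain s f0 where s: "s \<in> carrier R" "s \<notin> p" and f0: "R.is_mpoly V f0"
    and sf: "\<And>m. \<phi> s \<otimes>\<^bsub>F\<^esub> f m = \<phi> (f0 m)" by blast
  from add(4) obtain t g0 where t: "t \<in> carrier R" "t \<notin> p" and g0: "R.is_mpoly V g0"
    and tg: "\<And>m. \<phi> t \<otimes>\<^bsub>F\<^esub> g m = \<phi> (g0 m)" by blast
  note coeff = R.is_mpoly_coeff[OF f0] R.is_mpoly_coeff[OF g0] S.is_mpoly_coeff[OF add(1)]
    S.is_mpoly_coeff[OF add(2)]
  define k where "k = (\<lambda>m. t \<otimes> f0 m \<oplus> s \<otimes> g0 m)"
  have "\<phi> (s \<otimes> t) \<otimes>\<^bsub>F\<^esub> (f m \<oplus>\<^bsub>F\<^esub> g m) = \<phi> (k m)" for m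
  proof -
    have "\<phi> (s \<otimes> t) \<otimes>\<^bsub>F\<^esub> (f m \<oplus>\<^bsub>F\<^esub> g m) =
        \<phi> t \<otimes>\<^bsub>F\<^esub> (\<phi> s \<otimes>\<^bsub>F\<^esub> f m) \<oplus>\<^bsub>F\<^esub> \<phi> s \<otimes>\<^bsub>F\<^esub> (\<phi> t \<otimes>\<^bsub>F\<^esub> g m)"
      using s(1) t(1) coeff by (simp add: S.r_distr S.m_ac)
    then show ?thesis
      unfolding sf tg k_def using s(1) t(1) coeff by simp
  qed
  moreover have "R.is_mpoly V k"
  proof -
    have "R.is_mpoly V (R.mpoly_term t {#} \<otimes>\<^bsub>mpoly_ring R V\<^esub> f0)"
      "R.is_mpoly V (R.mpoly_term s {#} \<otimes>\<^bsub>mpoly_ring R V\<^esub> g0)"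
      using s t f0 g0 by (simp_all add: R.is_mpoly_mult R.is_mpoly_term)
    then show ?thesis
      using s t f0 g0 R.is_mpoly_add unfolding k_def by (simp add: R.term_mult_mpoly)
  qed
  moreover have "s \<otimes> t \<in> carrier R - p" using s t I_prime[of s t] by blast
  ultimately show ?case by blast
qed

text \<open>The polynomials that a scalar outside \<open>p\<close> carries into the image of \<open>J\<close> already form an
  ideal, because multipliers can be moved into \<open>R[x]\<close> by clearing denominators. That scalar is
  invertible in the residue field, so this ideal is the whole extension.\<close>

lemma mem_extension_iff:
  fixes V :: "'v set"
  assumes J: "ideal J (mpoly_ring R V)" and f: "R.is_mpoly V f"
  shows "(\<lambda>m. \<phi> (f m)) \<in> Idl\<^bsub>mpoly_ring F V\<^esub> ((\<lambda>f m. \<phi> (f m)) ` J) \<longleftrightarrow> fibre_member R J p f"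
proof -
  let ?P = "mpoly_ring R V" and ?P' = "mpoly_ring F V" and ?\<Phi> = "\<lambda>f m. \<phi> (f m)"
  interpret P: cring ?P by (rule R.cring_mpoly_ring)
  interpret P': cring ?P' by (rule S.cring_mpoly_ring)
  interpret J: ideal J ?P by (rule J)
  note hom = mpoly_map_ring_hom[of V]
  define c where "c = (\<lambda>s. R.mpoly_term s {#} :: 'v multiset \<Rightarrow> 'a)"
  define c' where "c' = (\<lambda>s. S.mpoly_term s {#} :: 'v multiset \<Rightarrow> 'c)"
  have cP: "c s \<in> carrier ?P" if "s \<in> carrier R" for s
    using that by (simp add: c_def R.mem_mpoly_ring_iff R.is_mpoly_term)
  have c'P: "c' s \<in> carrier ?P'" if "s \<in> carrier F" for s
    using that by (simp add: c'_def S.mem_mpoly_ring_iff S.is_mpoly_term)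
  have \<Phi>c: "?\<Phi> (c s) = c' (\<phi> s)" if "s \<in> carrier R" for s
    using that by (simp add: c_def c'_def map_mpoly_term)
  have \<Phi>P: "?\<Phi> g \<in> carrier ?P'" if "g \<in> carrier ?P" for g
    using ring_hom_closed[OF hom that] .
  have \<Phi>J: "?\<Phi> ` J \<subseteq> carrier ?P'" using J.Icarr \<Phi>P by (intro image_subsetI) simp
  have c'c': "c' s \<otimes>\<^bsub>?P'\<^esub> c' t = c' (s \<otimes>\<^bsub>F\<^esub> t)" if "s \<in> carrier F" "t \<in> carrier F" for s t
    using that by (simp add: c'_def S.term_mult_term)
  define Q where "Q = {g \<in> carrier ?P'. \<exists>s \<in> carrier R - p. \<exists>j \<in> J. c' (\<phi> s) \<otimes>\<^bsub>?P'\<^esub> g = ?\<Phi> j}"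
  have QI: "g \<in> Q" if "g \<in> carrier ?P'" "s \<in> carrier R" "s \<notin> p" "j \<in> J" "c' (\<phi> s) \<otimes>\<^bsub>?P'\<^esub> g = ?\<Phi> j" for g s j
    using that unfolding Q_def by blast
  have JQ: "?\<Phi> ` J \<subseteq> Q"
  proof (rule image_subsetI)
    fix j assume j: "j \<in> J"
    have "c' (\<phi> \<one>) = \<one>\<^bsub>?P'\<^esub>" by (simp add: c'_def S.one_mpoly_ring)
    then show "?\<Phi> j \<in> Q"
      using j \<Phi>P[OF J.Icarr[OF j]] one_in_complement by (intro QI[of _ \<one> j]) auto
  qed
  have "ideal Q ?P'"
  proof (rule idealI[OF P'.ring_axioms])
    have closed: "x \<otimes>\<^bsub>?P'\<^esub> g \<in> Q" if g: "g \<in> Q" and x: "x \<in> carrier ?P'" for g x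
    proof -
      from g obtain s j where s: "s \<in> carrier R" "s \<notin> p" and j: "j \<in> J"
        and sj: "c' (\<phi> s) \<otimes>\<^bsub>?P'\<^esub> g = ?\<Phi> j" and gP: "g \<in> carrier ?P'" unfolding Q_def by blast
      from ex_common_denominator[of V x] x obtain t x0 where t: "t \<in> carrier R" "t \<notin> p"
        and x0: "R.is_mpoly V x0" and tx: "\<forall>m. \<phi> t \<otimes>\<^bsub>F\<^esub> x m = \<phi> (x0 m)"
        unfolding S.mem_mpoly_ring_iff by blast
      have tx': "c' (\<phi> t) \<otimes>\<^bsub>?P'\<^esub> x = ?\<Phi> x0"
        using tx t x by (simp add: c'_def S.term_mult_mpoly S.mem_mpoly_ring_iff)
      have x0P: "x0 \<in> carrier ?P" using x0 by (simp add: R.mem_mpoly_ring_iff)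
      have "c' (\<phi> (t \<otimes> s)) \<otimes>\<^bsub>?P'\<^esub> (x \<otimes>\<^bsub>?P'\<^esub> g) =
          (c' (\<phi> t) \<otimes>\<^bsub>?P'\<^esub> x) \<otimes>\<^bsub>?P'\<^esub> (c' (\<phi> s) \<otimes>\<^bsub>?P'\<^esub> g)"
        using s t x gP by (simp add: c'c'[symmetric] c'P P'.m_ac)
      also have "\<dots> = ?\<Phi> (x0 \<otimes>\<^bsub>?P\<^esub> j)"
        unfolding tx' sj using ring_hom_mult[OF hom x0P J.Icarr[OF j]] by simp
      finally have "c' (\<phi> (t \<otimes> s)) \<otimes>\<^bsub>?P'\<^esub> (x \<otimes>\<^bsub>?P'\<^esub> g) = ?\<Phi> (x0 \<otimes>\<^bsub>?P\<^esub> j)" .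
      moreover have "t \<otimes> s \<in> carrier R" "t \<otimes> s \<notin> p" using s t I_prime[of t s] by auto
      ultimately show ?thesis
        using x gP J.I_l_closed[OF j x0P] by (intro QI[of _ "t \<otimes> s" "x0 \<otimes>\<^bsub>?P\<^esub> j"]) simp_all
    qed
    have QP: "Q \<subseteq> carrier ?P'" unfolding Q_def by blast
    show "subgroup Q (add_monoid ?P')"
    proof (rule P'.add.subgroupI)
      show "Q \<subseteq> carrier ?P'" by (rule QP)
      show "Q \<noteq> {}" using JQ J.a_subset J.I_zero by blast
      fix g assume g: "g \<in> Q"
      have "\<ominus>\<^bsub>?P'\<^esub> \<one>\<^bsub>?P'\<^esub> \<otimes>\<^bsub>?P'\<^esub> g = \<ominus>\<^bsub>?P'\<^esub> g"
        using g QP P'.l_minus[of "\<one>\<^bsub>?P'\<^esub>" g] by auto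
      then show "\<ominus>\<^bsub>?P'\<^esub> g \<in> Q" using closed[OF g, of "\<ominus>\<^bsub>?P'\<^esub> \<one>\<^bsub>?P'\<^esub>"] by simp
      fix k assume k: "k \<in> Q"
      from g obtain s j where s: "s \<in> carrier R" "s \<notin> p" and j: "j \<in> J"
        and sj: "c' (\<phi> s) \<otimes>\<^bsub>?P'\<^esub> g = ?\<Phi> j" and gP: "g \<in> carrier ?P'" unfolding Q_def by blast
      from k obtain t i where t: "t \<in> carrier R" "t \<notin> p" and i: "i \<in> J"
        and ti: "c' (\<phi> t) \<otimes>\<^bsub>?P'\<^esub> k = ?\<Phi> i" and kP: "k \<in> carrier ?P'" unfolding Q_def by blast
      let ?l = "c t \<otimes>\<^bsub>?P\<^esub> j \<oplus>\<^bsub>?P\<^esub> c s \<otimes>\<^bsub>?P\<^esub> i"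
      have l: "?l \<in> J"
        using s t i j by (intro J.I_add J.I_l_closed cP)
      have jP: "j \<in> carrier ?P" and iP: "i \<in> carrier ?P" using i j J.Icarr by simp_all
      have "c' (\<phi> (t \<otimes> s)) \<otimes>\<^bsub>?P'\<^esub> (g \<oplus>\<^bsub>?P'\<^esub> k) =
          c' (\<phi> t) \<otimes>\<^bsub>?P'\<^esub> (c' (\<phi> s) \<otimes>\<^bsub>?P'\<^esub> g) \<oplus>\<^bsub>?P'\<^esub> c' (\<phi> s) \<otimes>\<^bsub>?P'\<^esub> (c' (\<phi> t) \<otimes>\<^bsub>?P'\<^esub> k)"
        using s t gP kP by (simp add: c'c'[symmetric] c'P P'.r_distr P'.m_ac)
      also have "\<dots> = ?\<Phi> (c t) \<otimes>\<^bsub>?P'\<^esub> ?\<Phi> j \<oplus>\<^bsub>?P'\<^esub> ?\<Phi> (c s) \<otimes>\<^bsub>?P'\<^esub> ?\<Phi> i"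
        unfolding sj ti \<Phi>c[OF s(1)] \<Phi>c[OF t(1)] ..
      also have "\<dots> = ?\<Phi> (c t \<otimes>\<^bsub>?P\<^esub> j) \<oplus>\<^bsub>?P'\<^esub> ?\<Phi> (c s \<otimes>\<^bsub>?P\<^esub> i)"
        using ring_hom_mult[OF hom cP[OF t(1)] jP] ring_hom_mult[OF hom cP[OF s(1)] iP] by simp
      also have "\<dots> = ?\<Phi> ?l"
        using ring_hom_add[OF hom, of "c t \<otimes>\<^bsub>?P\<^esub> j" "c s \<otimes>\<^bsub>?P\<^esub> i"] s t jP iP cP by simp
      finally have "c' (\<phi> (t \<otimes> s)) \<otimes>\<^bsub>?P'\<^esub> (g \<oplus>\<^bsub>?P'\<^esub> k) = ?\<Phi> ?l" .
      moreover have "t \<otimes> s \<in> carrier R" "t \<otimes> s \<notin> p" using s t I_prime[of t s] by auto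
      ultimately show "g \<oplus>\<^bsub>?P'\<^esub> k \<in> Q"
        using gP kP l by (intro QI[of _ "t \<otimes> s" ?l]) simp_all
    qed
    fix g x assume g: "g \<in> Q" and x: "x \<in> carrier ?P'"
    show "x \<otimes>\<^bsub>?P'\<^esub> g \<in> Q" by (rule closed[OF g x])
    then show "g \<otimes>\<^bsub>?P'\<^esub> x \<in> Q" using P'.m_comm[OF x] g QP by auto
  qed
  then have "Idl\<^bsub>?P'\<^esub> (?\<Phi> ` J) \<subseteq> Q" using JQ by (rule P'.genideal_minimal)
  moreover have "Q \<subseteq> Idl\<^bsub>?P'\<^esub> (?\<Phi> ` J)"
  proof
    fix g assume "g \<in> Q"
    then obtain s j where s: "s \<in> carrier R - p" and j: "j \<in> J"
        and sj: "c' (\<phi> s) \<otimes>\<^bsub>?P'\<^esub> g = ?\<Phi> j" and gP: "g \<in> carrier ?P'" unfolding Q_def by blast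
    from ex_inverse[OF s] obtain y where y: "y \<in> carrier F" "y \<otimes>\<^bsub>F\<^esub> \<phi> s = \<one>\<^bsub>F\<^esub>" by blast
    have "c' y \<otimes>\<^bsub>?P'\<^esub> ?\<Phi> j = (c' y \<otimes>\<^bsub>?P'\<^esub> c' (\<phi> s)) \<otimes>\<^bsub>?P'\<^esub> g"
      unfolding sj[symmetric] using s y gP by (simp add: c'P P'.m_assoc)
    also have "c' y \<otimes>\<^bsub>?P'\<^esub> c' (\<phi> s) = \<one>\<^bsub>?P'\<^esub>"
      using s y by (simp add: c'c' c'_def S.one_mpoly_ring S.term_mult_term)
    finally have "g = c' y \<otimes>\<^bsub>?P'\<^esub> ?\<Phi> j" using gP by simp
    moreover have "?\<Phi> j \<in> Idl\<^bsub>?P'\<^esub> (?\<Phi> ` J)" using P'.genideal_self[OF \<Phi>J] j by blast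
    ultimately show "g \<in> Idl\<^bsub>?P'\<^esub> (?\<Phi> ` J)"
      using ideal.I_l_closed[OF P'.genideal_ideal[OF \<Phi>J] _ c'P[OF y(1)]] by simp
  qed
  ultimately have "Idl\<^bsub>?P'\<^esub> (?\<Phi> ` J) = Q" by blast
  moreover have "?\<Phi> f \<in> Q \<longleftrightarrow> fibre_member R J p f"
  proof -
    have fP: "f \<in> carrier ?P" using f by (simp add: R.mem_mpoly_ring_iff)
    have "c' (\<phi> s) \<otimes>\<^bsub>?P'\<^esub> ?\<Phi> f = ?\<Phi> j \<longleftrightarrow> (\<forall>m. s \<otimes> f m \<ominus> j m \<in> p)"
      if s: "s \<in> carrier R - p" and j: "j \<in> J" for s j
    proof -
      have jm: "j m \<in> carrier R" for m
        using J.Icarr[OF j] by (simp add: R.mem_mpoly_ring_iff R.is_mpoly_coeff)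
      have "c' (\<phi> s) \<otimes>\<^bsub>?P'\<^esub> ?\<Phi> f = (\<lambda>m. \<phi> s \<otimes>\<^bsub>F\<^esub> \<phi> (f m))"
        using s is_mpoly_map[OF f] by (simp add: c'_def S.term_mult_mpoly)
      also have "\<dots> = (\<lambda>m. \<phi> (s \<otimes> f m))"
        using s R.is_mpoly_coeff[OF f] by simp
      finally have "c' (\<phi> s) \<otimes>\<^bsub>?P'\<^esub> ?\<Phi> f = ?\<Phi> j \<longleftrightarrow> (\<forall>m. \<phi> (s \<otimes> f m) = \<phi> (j m))"
        by (simp only: fun_eq_iff)
      moreover have "\<phi> (s \<otimes> f m) = \<phi> (j m) \<longleftrightarrow> s \<otimes> f m \<ominus> j m \<in> p" for m
        using s R.is_mpoly_coeff[OF f] jm by (intro hom_eq_iff) auto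
      ultimately show ?thesis by simp
    qed
    then show ?thesis using \<Phi>P[OF fP] unfolding Q_def fibre_member_def by auto
  qed
  ultimately show ?thesis by simp
qed

end

text \<open>The polynomials over \<open>R\<close> whose images lie in the extension of \<open>J\<close> form an ideal, so the test on
  generators of \<open>I\<close> suffices. For finite \<open>A\<close> it consists of finitely many membership conditions.\<close>

lemma residue_extension_subset_iff:
  assumes R: "cring R" and p: "p \<in> Spec R" and I: "ideal I (mpoly_ring R V)"
    and J: "ideal J (mpoly_ring R V)" and A: "A \<subseteq> carrier (mpoly_ring R V)" "I = Idl\<^bsub>mpoly_ring R V\<^esub> A"
  shows "residue_extension R V p I \<subseteq> residue_extension R V p J \<longleftrightarrow> (\<forall>f \<in> A. fibre_member R J p f)"
proof -
  interpret residue_hom R "residue_field R p" "residue_map R p" p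
    using p by (intro primeideal.residue_hom_residue_map) (simp add: Spec_def)
  let ?P = "mpoly_ring R V" and ?P' = "mpoly_ring (residue_field R p) V"
  let ?\<Phi> = "\<lambda>f m. residue_map R p (f m)"
  interpret P: cring ?P by (rule R.cring_mpoly_ring)
  interpret P': cring ?P' by (rule S.cring_mpoly_ring)
  interpret \<Phi>: ring_hom_ring ?P ?P' ?\<Phi>
    by (rule ring_hom_ringI2[OF P.ring_axioms P'.ring_axioms mpoly_map_ring_hom])
  have sub: "?\<Phi> ` K \<subseteq> carrier ?P'" if "K \<subseteq> carrier ?P" for K
    using that by (intro image_subsetI \<Phi>.hom_closed) blast
  have carr: "I \<subseteq> carrier ?P" "J \<subseteq> carrier ?P"
    using ideal.Icarr[OF I] ideal.Icarr[OF J] by (auto intro!: subsetI)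
  let ?E = "residue_extension R V p J"
  have E: "ideal ?E ?P'"
    unfolding residue_extension_def by (rule P'.genideal_ideal[OF sub[OF carr(2)]])
  have vim: "ideal {f \<in> carrier ?P. ?\<Phi> f \<in> ?E} ?P"
    using \<Phi>.ideal_vimage[OF E] .
  have "residue_extension R V p I \<subseteq> ?E \<longleftrightarrow> ?\<Phi> ` I \<subseteq> ?E"
    unfolding residue_extension_def[of R V p I] by (rule P'.Idl_subset_ideal[OF E sub[OF carr(1)]])
  also have "\<dots> \<longleftrightarrow> I \<subseteq> {f \<in> carrier ?P. ?\<Phi> f \<in> ?E}" using carr(1) by blast
  also have "\<dots> \<longleftrightarrow> A \<subseteq> {f \<in> carrier ?P. ?\<Phi> f \<in> ?E}"
    unfolding A(2) by (rule P.Idl_subset_ideal[OF vim A(1)])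
  also have "\<dots> \<longleftrightarrow> (\<forall>f \<in> A. fibre_member R J p f)"
    using A(1) mem_extension_iff[OF J] unfolding residue_extension_def R.mem_mpoly_ring_iff[symmetric] by blast
  finally show ?thesis .
qed

section \<open>Dickson's lemma and Hilbert's basis theorem\<close>

text \<open>A sequence in a well-order has a nondecreasing subsequence: restrict it to these indices.\<close>

lemma infinite_tail_minima:
  fixes f :: "nat \<Rightarrow> 'b :: wellorder"
  shows "infinite {m. \<forall>k \<ge> m. f m \<le> f k}"
  unfolding infinite_nat_iff_unbounded_le
proof
  fix N
  let ?Q = "\<lambda>x. \<exists>m \<ge> N. f m = x"
  have "?Q (LEAST x. ?Q x)" by (rule LeastI[of ?Q "f N"]) auto
  then obtain m where m: "m \<ge> N" "f m = (LEAST x. ?Q x)" by blast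
  have "f m \<le> f k" if "k \<ge> m" for k
    unfolding m(2) using that m(1) by (intro Least_le exI[of _ k]) simp
  then show "\<exists>n \<ge> N. n \<in> {m. \<forall>k \<ge> m. f m \<le> f k}" using m(1) by blast
qed

text \<open>Passing to subsequences for one variable after the other; monotonicity achieved earlier is kept.\<close>

lemma ex_countwise_increasing_subsequence:
  fixes \<sigma> :: "nat \<Rightarrow> 'v multiset"
  assumes "finite V"
  shows "\<exists>r :: nat \<Rightarrow> nat. strict_mono r \<and> (\<forall>v \<in> V. \<forall>i j. i \<le> j \<longrightarrow> count (\<sigma> (r i)) v \<le> count (\<sigma> (r j)) v)"
  using assms
proof induction
  case empty
  show ?case by (intro exI[of _ id]) (simp add: strict_mono_def)
next
  case (insert v V)
  then obtain r :: "nat \<Rightarrow> nat" where r: "strict_mono r"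
    "\<And>u i j. u \<in> V \<Longrightarrow> i \<le> j \<Longrightarrow> count (\<sigma> (r i)) u \<le> count (\<sigma> (r j)) u" by blast
  let ?M = "{m. \<forall>k \<ge> m. count (\<sigma> (r m)) v \<le> count (\<sigma> (r k)) v}"
  have inf: "infinite ?M" using infinite_tail_minima[of "\<lambda>m. count (\<sigma> (r m)) v"] .
  obtain e :: "nat \<Rightarrow> nat" where e: "strict_mono e" "\<And>i. e i \<in> ?M"
    using infinite_enumerate[OF inf] by blast
  have "count (\<sigma> (r (e i))) u \<le> count (\<sigma> (r (e j))) u" if "u \<in> insert v V" "i \<le> j" for u i j
  proof -
    have ij: "e i \<le> e j" using e(1) that(2) by (simp add: strict_mono_less_eq)
    show ?thesis
    proof (cases "u = v")
      case True
      then show ?thesis using e(2)[of i] ij by simp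
    next
      case False
      then show ?thesis using that(1) r(2) ij by blast
    qed
  qed
  moreover have "strict_mono (r \<circ> e)" using r(1) e(1) by (rule strict_mono_o)
  ultimately show ?case unfolding comp_def by blast
qed

lemma ex_increasing_subsequence:
  fixes \<sigma> :: "nat \<Rightarrow> 'v multiset"
  assumes "finite V" and "\<And>i. set_mset (\<sigma> i) \<subseteq> V"
  obtains r :: "nat \<Rightarrow> nat" where "strict_mono r" "\<And>i j. i \<le> j \<Longrightarrow> \<sigma> (r i) \<subseteq># \<sigma> (r j)"
proof -
  obtain r :: "nat \<Rightarrow> nat" where r: "strict_mono r"
    "\<And>u i j. u \<in> V \<Longrightarrow> i \<le> j \<Longrightarrow> count (\<sigma> (r i)) u \<le> count (\<sigma> (r j)) u"
    using ex_countwise_increasing_subsequence[OF assms(1), of \<sigma>] by blast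
  have "\<sigma> (r i) \<subseteq># \<sigma> (r j)" if "i \<le> j" for i j
  proof (rule mset_subset_eqI)
    fix u
    show "count (\<sigma> (r i)) u \<le> count (\<sigma> (r j)) u"
    proof (cases "u \<in> V")
      case True
      then show ?thesis using r(2) that by blast
    next
      case False
      then have "u \<notin># \<sigma> (r i)" using assms(2)[of "r i"] by blast
      then show ?thesis by (simp add: not_in_iff)
    qed
  qed
  then show ?thesis using that r(1) by blast
qed

lemma ex_increasing_sequence_in_infinite:
  assumes V: "finite V" and B: "infinite B" "\<And>m. m \<in> B \<Longrightarrow> set_mset m \<subseteq> V"
  obtains \<tau> :: "nat \<Rightarrow> 'v multiset" where "\<And>i. \<tau> i \<in> B" "\<And>i j. i < j \<Longrightarrow> \<tau> i \<subset># \<tau> j"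
proof -
  obtain \<sigma> :: "nat \<Rightarrow> 'v multiset" where \<sigma>: "inj \<sigma>" "range \<sigma> \<subseteq> B"
    using infinite_countable_subset[OF B(1)] by blast
  have "set_mset (\<sigma> i) \<subseteq> V" for i using B(2) \<sigma>(2) by blast
  then obtain r :: "nat \<Rightarrow> nat" where r: "strict_mono r" "\<And>i j. i \<le> j \<Longrightarrow> \<sigma> (r i) \<subseteq># \<sigma> (r j)"
    using ex_increasing_subsequence[OF V] by blast
  have "\<sigma> (r i) \<subset># \<sigma> (r j)" if "i < j" for i j
  proof -
    have "\<sigma> (r i) \<noteq> \<sigma> (r j)"
      using that \<sigma>(1) strict_mono_less[OF r(1), of i j] by (auto dest: injD)
    then show ?thesis using r(2)[of i j] that by (simp add: subset_mset.less_le)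
  qed
  moreover have "\<sigma> (r i) \<in> B" for i using \<sigma>(2) by blast
  ultimately show ?thesis using that[of "\<lambda>i. \<sigma> (r i)"] by blast
qed

lemma ex_minimal_submultiset:
  assumes "m \<in> B"
  shows "\<exists>a \<in> B. a \<subseteq># m \<and> (\<forall>b \<in> B. \<not> b \<subset># a)"
  using assms
proof (induction "size m" arbitrary: m rule: less_induct)
  case less
  show ?case
  proof (cases "\<forall>b \<in> B. \<not> b \<subset># m")
    case False
    then obtain b where b: "b \<in> B" "b \<subset># m" by blast
    with less.hyps[of b] obtain a where "a \<in> B" "a \<subseteq># b" "\<forall>c \<in> B. \<not> c \<subset># a"
      using mset_subset_size by blast
    then show ?thesis using b(2) by (meson subset_mset.less_imp_le subset_mset.order_trans)
  qed (use less.prems in blast)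
qed

text \<open>Minimal monomials are pairwise incomparable, so an infinite set of them would contradict the
  existence of increasing sequences.\<close>

lemma dickson:
  assumes V: "finite V" and B: "\<And>m. m \<in> B \<Longrightarrow> set_mset m \<subseteq> V"
  obtains F where "finite F" "F \<subseteq> B" "\<And>m. m \<in> B \<Longrightarrow> \<exists>a \<in> F. a \<subseteq># m"
proof
  let ?F = "{m \<in> B. \<forall>a \<in> B. \<not> a \<subset># m}"
  show "finite ?F"
  proof (rule ccontr)
    assume "infinite ?F"
    from ex_increasing_sequence_in_infinite[OF V this] B
    obtain \<tau> :: "nat \<Rightarrow> 'a multiset" where "\<And>i. \<tau> i \<in> ?F" "\<And>i j. i < j \<Longrightarrow> \<tau> i \<subset># \<tau> j" by auto
    from this(1)[of 0] this(1)[of 1] this(2)[of 0 1] show False by simp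
  qed
  show "\<exists>a \<in> ?F. a \<subseteq># m" if "m \<in> B" for m
    using ex_minimal_submultiset[OF that] by blast
qed auto

text \<open>Induction along leading monomials in the well-order of multisets. Coefficients in \<open>Z\<close> count as
  zero, which covers leading monomials modulo a prime ideal. The hypothesis is available for every
  polynomial \<open>g\<close> that vanishes from some monomial of \<open>f\<close> onwards.\<close>

lemma (in ring) mpoly_lead_induct [consumes 2, case_names step]:
  fixes f :: "'v :: wellorder multiset \<Rightarrow> 'a"
  assumes f: "is_mpoly V f" and Z: "\<zero> \<in> Z"
    and step: "\<And>f. is_mpoly V f \<Longrightarrow>
      (\<And>g m. is_mpoly V g \<Longrightarrow> f m \<notin> Z \<Longrightarrow> (\<And>m'. m' \<ge> m \<Longrightarrow> g m' \<in> Z) \<Longrightarrow> Q g) \<Longrightarrow> Q f"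
  shows "Q f"
proof -
  have bounded: "Q f" if "is_mpoly V f" "\<And>m. m \<ge> M \<Longrightarrow> f m \<in> Z" for M and f :: "'v multiset \<Rightarrow> 'a"
    using that
  proof (induction M arbitrary: f rule: less_induct)
    case (less M)
    show ?case
    proof (rule step[OF less.prems(1)])
      fix g m assume g: "is_mpoly V g" "\<And>m'. m' \<ge> m \<Longrightarrow> g m' \<in> Z" and m: "f m \<notin> Z"
      have "m < M" using less.prems(2)[of m] m by (meson not_le)
      from less.IH[OF this g] show "Q g" by blast
    qed
  qed
  let ?M = "Max (insert {#} {m. f m \<noteq> \<zero>})"
  \<comment> \<open>Adding any variable to the largest monomial of the support gives a strictly larger monomial.\<close>
  have "f m \<in> Z" if "m \<ge> add_mset undefined ?M" for m
  proof (rule ccontr)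
    assume "f m \<notin> Z"
    then have "m \<le> ?M" using Z f by (intro Max_ge) (auto simp: is_mpoly_def)
    also have "?M < add_mset undefined ?M" by simp
    finally show False using that by simp
  qed
  with f show ?thesis by (rule bounded)
qed

lemma (in ring) ex_leading_monomial:
  fixes f :: "'v :: wellorder multiset \<Rightarrow> 'a"
  assumes f: "is_mpoly V f" and Z: "\<zero> \<in> Z" and "f m0 \<notin> Z"
  shows "\<exists>m. f m \<notin> Z \<and> set_mset m \<subseteq> V \<and> (\<forall>m' > m. f m' \<in> Z)"
proof -
  let ?A = "{m. f m \<notin> Z}"
  have "?A \<subseteq> {m. f m \<noteq> \<zero>}" using Z by auto
  then have fin: "finite ?A" using f by (auto simp: is_mpoly_def intro: finite_subset)
  have "Max ?A \<in> ?A" using fin assms(3) by (intro Max_in) auto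
  then have nz: "f (Max ?A) \<notin> Z" by simp
  then have "f (Max ?A) \<noteq> \<zero>" using Z by metis
  then have V: "set_mset (Max ?A) \<subseteq> V" using f by (simp add: is_mpoly_def)
  have "f m' \<in> Z" if "m' > Max ?A" for m'
    using that Max_ge[OF fin, of m'] by (auto simp: not_le[symmetric])
  then have "\<forall>m' > Max ?A. f m' \<in> Z" by blast
  with nz V show ?thesis by (intro exI[of _ "Max ?A"] conjI)
qed

lemma (in ring) term_mult_shift:
  fixes g :: "'v :: wellorder multiset \<Rightarrow> 'a"
  assumes c: "c \<in> carrier R" and g: "is_mpoly V g"
  shows "(mpoly_term c d \<otimes>\<^bsub>mpoly_ring R V\<^esub> g) (m + d) = c \<otimes> g m"
    and "m' > m + d \<Longrightarrow> (mpoly_term c d \<otimes>\<^bsub>mpoly_ring R V\<^esub> g) m' = \<zero> \<or>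
      (\<exists>k > m. (mpoly_term c d \<otimes>\<^bsub>mpoly_ring R V\<^esub> g) m' = c \<otimes> g k)"
proof -
  show "(mpoly_term c d \<otimes>\<^bsub>mpoly_ring R V\<^esub> g) (m + d) = c \<otimes> g m"
    by (simp add: term_mult_mpoly[OF c g])
  assume "m' > m + d"
  \<comment> \<open>The order of monomials is compatible with multiplication.\<close>
  then have "m' - d > m" if "d \<subseteq># m'"
    using that by (metis add_less_cancel_right subset_mset.diff_add)
  then show "(mpoly_term c d \<otimes>\<^bsub>mpoly_ring R V\<^esub> g) m' = \<zero> \<or>
      (\<exists>k > m. (mpoly_term c d \<otimes>\<^bsub>mpoly_ring R V\<^esub> g) m' = c \<otimes> g k)"
    by (auto simp: term_mult_mpoly[OF c g])
qed

definition (in ring) leading_coeffs :: "('v :: wellorder multiset \<Rightarrow> 'a) set \<Rightarrow> 'v multiset \<Rightarrow> 'a set" where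
  "leading_coeffs J m = {g m | g. g \<in> J \<and> (\<forall>m' > m. g m' = \<zero>)}"

context cring
begin

lemma mem_mpoly_ideal:
  assumes "ideal J (mpoly_ring R V)" "g \<in> J"
  shows "is_mpoly V g"
  using ideal.Icarr[OF assms] by (simp add: mem_mpoly_ring_iff)

lemma term_mult_mem_ideal:
  assumes J: "ideal J (mpoly_ring R V)" and g: "g \<in> J" and c: "c \<in> carrier R" and d: "set_mset d \<subseteq> V"
  shows "mpoly_term c d \<otimes>\<^bsub>mpoly_ring R V\<^esub> g \<in> J"
  using g by (rule ideal.I_l_closed[OF J]) (simp add: mem_mpoly_ring_iff is_mpoly_term c d)

lemma add_mem_mpoly_ideal:
  assumes J: "ideal J (mpoly_ring R V)" and "f \<in> J" "g \<in> J"
  shows "(\<lambda>m. f m \<oplus> g m) \<in> J"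
  using ideal.I_add[OF J assms(2,3)] by (simp add: add_mpoly_ring)

lemma smult_mem_mpoly_ideal:
  assumes J: "ideal J (mpoly_ring R V)" and g: "g \<in> J" and c: "c \<in> carrier R"
  shows "(\<lambda>m. c \<otimes> g m) \<in> J"
  using term_mult_mem_ideal[OF J g c, of "{#}"] by (simp add: term_mult_mpoly[OF c mem_mpoly_ideal[OF J g]])

lemma minus_mem_mpoly_ideal:
  assumes J: "ideal J (mpoly_ring R V)" and f: "f \<in> J" and g: "g \<in> J"
  shows "(\<lambda>m. f m \<ominus> g m) \<in> J"
proof -
  note coeff = is_mpoly_coeff[OF mem_mpoly_ideal[OF J f]] is_mpoly_coeff[OF mem_mpoly_ideal[OF J g]]
  have "(\<lambda>m. f m \<oplus> \<ominus> \<one> \<otimes> g m) \<in> J"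
    by (intro add_mem_mpoly_ideal[OF J f] smult_mem_mpoly_ideal[OF J g]) simp
  then show ?thesis using coeff by (simp add: l_minus minus_eq)
qed

lemma zero_mem_mpoly_ideal:
  assumes J: "ideal J (mpoly_ring R V)"
  shows "(\<lambda>_. \<zero>) \<in> J"
  using ideal.I_zero[OF J] by (simp add: zero_mpoly_ring)

lemma ideal_leading_coeffs:
  assumes J: "ideal J (mpoly_ring R V)"
  shows "ideal (leading_coeffs J m) R"
proof (rule idealI[OF ring_axioms])
  have mem: "g m \<in> leading_coeffs J m" if "g \<in> J" "\<And>m'. m' > m \<Longrightarrow> g m' = \<zero>" for g
    using that unfolding leading_coeffs_def by blast
  have closed: "c \<otimes> x \<in> leading_coeffs J m" if x: "x \<in> leading_coeffs J m" and c: "c \<in> carrier R" for x c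
  proof -
    from x obtain g where g: "g \<in> J" "x = g m" "\<And>m'. m' > m \<Longrightarrow> g m' = \<zero>"
      unfolding leading_coeffs_def by blast
    show ?thesis
      unfolding g(2) using mem[OF smult_mem_mpoly_ideal[OF J g(1) c]] g(3) c by simp
  qed
  have carr: "x \<in> carrier R" if "x \<in> leading_coeffs J m" for x
    using that is_mpoly_coeff[OF mem_mpoly_ideal[OF J]] unfolding leading_coeffs_def by auto
  show "subgroup (leading_coeffs J m) (add_monoid R)"
  proof (rule add.subgroupI)
    show "leading_coeffs J m \<subseteq> carrier R" using carr by blast
    show "leading_coeffs J m \<noteq> {}" using mem[OF zero_mem_mpoly_ideal[OF J]] by auto
    fix x assume x: "x \<in> leading_coeffs J m"
    show "\<ominus> x \<in> leading_coeffs J m" using closed[OF x, of "\<ominus> \<one>"] carr[OF x] by (simp add: l_minus)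
    fix y assume y: "y \<in> leading_coeffs J m"
    from x obtain f where f: "f \<in> J" "x = f m" "\<And>m'. m' > m \<Longrightarrow> f m' = \<zero>"
      unfolding leading_coeffs_def by blast
    from y obtain g where g: "g \<in> J" "y = g m" "\<And>m'. m' > m \<Longrightarrow> g m' = \<zero>"
      unfolding leading_coeffs_def by blast
    show "x \<oplus> y \<in> leading_coeffs J m"
      unfolding f(2) g(2) using mem[OF add_mem_mpoly_ideal[OF J f(1) g(1)]] f(3) g(3) by simp
  qed
  fix x c assume x: "x \<in> leading_coeffs J m" and c: "c \<in> carrier R"
  show "c \<otimes> x \<in> leading_coeffs J m" by (rule closed[OF x c])
  then show "x \<otimes> c \<in> leading_coeffs J m" using m_comm[OF carr[OF x] c] by simp
qed

lemma leading_coeffs_mono: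
  assumes J: "ideal J (mpoly_ring R V)" and d: "a \<subseteq># m" "set_mset m \<subseteq> V"
  shows "leading_coeffs J a \<subseteq> leading_coeffs J m"
proof
  fix x assume "x \<in> leading_coeffs J a"
  then obtain g where g: "g \<in> J" "x = g a" "\<And>m'. m' > a \<Longrightarrow> g m' = \<zero>"
    unfolding leading_coeffs_def by blast
  let ?d = "m - a"
  have m: "a + ?d = m" using d(1) by simp
  have dV: "set_mset ?d \<subseteq> V" using d(2) by (meson in_diffD subset_iff)
  let ?g = "mpoly_term \<one> ?d \<otimes>\<^bsub>mpoly_ring R V\<^esub> g"
  note shift = term_mult_shift[OF one_closed mem_mpoly_ideal[OF J g(1)], where d = ?d and m = a]
  have "?g m = x"
    using shift(1) is_mpoly_coeff[OF mem_mpoly_ideal[OF J g(1)]] unfolding m g(2) by simp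
  moreover have "?g m' = \<zero>" if "m' > m" for m'
    using shift(2)[of m'] that g(3) unfolding m by auto
  moreover have "?g \<in> J" by (rule term_mult_mem_ideal[OF J g(1) one_closed dV])
  ultimately show "x \<in> leading_coeffs J m" unfolding leading_coeffs_def by blast
qed

text \<open>Subtracting elements of \<open>K\<close> with the same leading term reduces an element of \<open>J\<close> to zero.\<close>

lemma mpoly_ideal_subset_if_leading_coeffs:
  assumes J: "ideal J (mpoly_ring R V)" and K: "ideal K (mpoly_ring R V)" and KJ: "K \<subseteq> J"
    and lead: "\<And>m. set_mset m \<subseteq> V \<Longrightarrow> leading_coeffs J m \<subseteq> leading_coeffs K m"
  shows "J \<subseteq> K"
proof
  fix f assume f: "f \<in> J"
  have "is_mpoly V f" by (rule mem_mpoly_ideal[OF J f])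
  moreover have "\<zero> \<in> {\<zero>}" by simp
  ultimately show "f \<in> K" using f
  proof (induction rule: mpoly_lead_induct)
    case (step f)
    show ?case
    proof (cases "\<forall>m. f m = \<zero>")
      case True
      then have "f = (\<lambda>_. \<zero>)" by auto
      then show ?thesis using zero_mem_mpoly_ideal[OF K] by simp
    next
      case False
      then obtain m0 where "f m0 \<notin> {\<zero>}" by auto
      then obtain m where m: "f m \<notin> {\<zero>}" "set_mset m \<subseteq> V" "\<And>m'. m' > m \<Longrightarrow> f m' \<in> {\<zero>}"
        using ex_leading_monomial[OF step.hyps, of "{\<zero>}" m0] by auto
      have "f m \<in> leading_coeffs J m" using step.prems m(3) unfolding leading_coeffs_def by auto
      then have "f m \<in> leading_coeffs K m" using lead[OF m(2)] by blast
      then obtain g where g: "g \<in> K" "g m = f m" "\<And>m'. m' > m \<Longrightarrow> g m' = \<zero>"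
        unfolding leading_coeffs_def by auto
      let ?h = "\<lambda>m. f m \<ominus> g m"
      have hJ: "?h \<in> J" using minus_mem_mpoly_ideal[OF J step.prems] g(1) KJ by blast
      note fcoeff = is_mpoly_coeff[OF step.hyps]
      have "?h m' \<in> {\<zero>}" if "m' \<ge> m" for m'
        using that g(2,3) m(3) fcoeff by (cases "m' = m") (auto simp: minus_eq r_neg)
      then have "?h \<in> K" using step.IH[OF mem_mpoly_ideal[OF J hJ] m(1) _ hJ] by blast
      from add_mem_mpoly_ideal[OF K g(1) this] show ?thesis
        using fcoeff is_mpoly_coeff[OF mem_mpoly_ideal[OF K g(1)]]
        by (simp add: minus_eq a_lcomm[of "g _" "f _"] r_neg)
    qed
  qed
qed

text \<open>The ideals of leading coefficients grow along divisibility of monomials. By Dickson's lemma and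
  the ascending chain condition in \<open>R\<close>, finitely many monomials \<open>a\<close> realize all of them, and
  polynomials whose leading coefficients generate these finitely many ideals generate \<open>J\<close>.\<close>

theorem noetherian_mpoly_ring:
  assumes R: "noetherian_ring R" and V: "finite (V :: 'v :: wellorder set)"
  shows "noetherian_ring (mpoly_ring R V)"
proof -
  interpret noetherian_ring R by (rule R)
  interpret P: cring "mpoly_ring R V" by (rule cring_mpoly_ring)
  show ?thesis
  proof (rule P.noetherian_ringI)
    fix J assume J: "ideal J (mpoly_ring R V)"
    let ?A = "leading_coeffs J"
    define F where "F = {m. set_mset m \<subseteq> V \<and> (\<forall>a. a \<subset># m \<longrightarrow> ?A a \<noteq> ?A m)}"
    \<comment> \<open>Along an infinite ascending sequence in \<open>F\<close> the ideals of leading coefficients would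
      increase strictly.\<close>
    have fin: "finite F"
    proof (rule ccontr)
      assume inf: "infinite F"
      have "set_mset m \<subseteq> V" if "m \<in> F" for m using that by (simp add: F_def)
      from ex_increasing_sequence_in_infinite[OF V inf this]
      obtain \<tau> :: "nat \<Rightarrow> 'v multiset" where \<tau>: "\<And>i. \<tau> i \<in> F" "\<And>i j. i < j \<Longrightarrow> \<tau> i \<subset># \<tau> j" by blast
      have mono: "?A (\<tau> i) \<subseteq> ?A (\<tau> j)" if "i \<le> j" for i j
        using that \<tau>(1)[of j] \<tau>(2)[of i j] leading_coeffs_mono[OF J, of "\<tau> i" "\<tau> j"]
        by (cases "i = j") (auto simp: F_def subset_mset.less_imp_le)
      let ?C = "range (\<lambda>i. ?A (\<tau> i))"
      have "subset.chain {I. ideal I R} ?C"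
        unfolding subset.chain_def
      proof (intro conjI ballI)
        show "?C \<subseteq> {I. ideal I R}" using ideal_leading_coeffs[OF J] by auto
        fix I K assume "I \<in> ?C" "K \<in> ?C"
        then obtain i j where "I = ?A (\<tau> i)" "K = ?A (\<tau> j)" by blast
        then have "I \<subseteq> K \<or> K \<subseteq> I" using mono linear[of i j] by metis
        then show "(\<subset>)\<^sup>=\<^sup>= I K \<or> (\<subset>)\<^sup>=\<^sup>= K I" by blast
      qed
      from ideal_chain_is_trivial[OF _ this] obtain N where N: "\<Union>?C = ?A (\<tau> N)" by auto
      then have "?A (\<tau> (Suc N)) \<subseteq> ?A (\<tau> N)" by blast
      with mono[of N "Suc N"] have "?A (\<tau> N) = ?A (\<tau> (Suc N))" by simp
      then show False using \<tau>(1)[of "Suc N"] \<tau>(2)[of N "Suc N"] by (auto simp: F_def)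
    qed
    have below: "\<exists>a \<in> F. a \<subseteq># m \<and> ?A a = ?A m" if m: "set_mset m \<subseteq> V" for m
    proof -
      from ex_minimal_submultiset[of m "{a. ?A a = ?A m}"]
      obtain a where a: "?A a = ?A m" "a \<subseteq># m" "\<And>b. ?A b = ?A m \<Longrightarrow> \<not> b \<subset># a" by auto
      have "set_mset a \<subseteq> V" using set_mset_mono[OF a(2)] m by blast
      then have "a \<in> F" using a(1,3) unfolding F_def by auto
      then show ?thesis using a(1,2) by blast
    qed
    have "\<exists>B. finite B \<and> B \<subseteq> J \<and> ?A m \<subseteq> Idl {g m | g. g \<in> B} \<and> (\<forall>g \<in> B. \<forall>m' > m. g m' = \<zero>)" for m
    proof -
      obtain C where C: "C \<subseteq> carrier R" "finite C" "?A m = Idl C"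
        using finetely_gen[OF ideal_leading_coeffs[OF J]] by blast
      have "C \<subseteq> (\<lambda>g. g m) ` {g \<in> J. \<forall>m' > m. g m' = \<zero>}"
        using genideal_self[OF C(1)] unfolding C(3)[symmetric] leading_coeffs_def by blast
      from finite_subset_image[OF C(2) this] obtain B
        where B: "B \<subseteq> {g \<in> J. \<forall>m' > m. g m' = \<zero>}" "finite B" "C = (\<lambda>g. g m) ` B" by blast
      then have "{g m | g. g \<in> B} = C" by blast
      then show ?thesis using B C(3) by (intro exI[of _ B]) auto
    qed
    then have "\<forall>m. \<exists>B. finite B \<and> B \<subseteq> J \<and> ?A m \<subseteq> Idl {g m | g. g \<in> B} \<and>
        (\<forall>g \<in> B. \<forall>m' > m. g m' = \<zero>)" ..
    from choice[OF this] obtain B where *: "\<forall>m. finite (B m) \<and> B m \<subseteq> J \<and>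
        ?A m \<subseteq> Idl {g m | g. g \<in> B m} \<and> (\<forall>g \<in> B m. \<forall>m' > m. g m' = \<zero>)" ..
    then have B: "finite (B m)" "B m \<subseteq> J" "?A m \<subseteq> Idl {g m | g. g \<in> B m}"
        "\<And>g m'. g \<in> B m \<Longrightarrow> m' > m \<Longrightarrow> g m' = \<zero>" for m by simp_all
    let ?G = "\<Union>m \<in> F. B m"
    have GJ: "?G \<subseteq> J" using B(2) by blast
    then have GP: "?G \<subseteq> carrier (mpoly_ring R V)" using ideal.Icarr[OF J] by blast
    let ?K = "Idl\<^bsub>mpoly_ring R V\<^esub> ?G"
    have K: "ideal ?K (mpoly_ring R V)" using P.genideal_ideal[OF GP] .
    have KJ: "?K \<subseteq> J" using P.genideal_minimal[OF J GJ] .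
    have "J \<subseteq> ?K"
    proof (rule mpoly_ideal_subset_if_leading_coeffs[OF J K KJ])
      fix m :: "'v multiset" assume m: "set_mset m \<subseteq> V"
      then obtain a where a: "a \<in> F" "a \<subseteq># m" "?A a = ?A m" using below by blast
      have "{g a | g. g \<in> B a} \<subseteq> leading_coeffs ?K a"
        using P.genideal_self[OF GP] a(1) B(4)[of _ a] unfolding leading_coeffs_def by blast
      then have "Idl {g a | g. g \<in> B a} \<subseteq> leading_coeffs ?K a"
        by (rule genideal_minimal[OF ideal_leading_coeffs[OF K]])
      then show "?A m \<subseteq> leading_coeffs ?K m"
        using B(3)[of a] leading_coeffs_mono[OF K a(2) m] unfolding a(3) by blast
    qed
    then show "\<exists>A \<subseteq> carrier (mpoly_ring R V). finite A \<and> J = Idl\<^bsub>mpoly_ring R V\<^esub> A"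
      using KJ GP fin B(1) by (intro exI[of _ ?G]) auto
  qed
qed

end

section \<open>Generic behaviour of membership in a fibre\<close>

context cring
begin

text \<open>The leading monomials of \<open>J\<close> modulo \<open>p\<close> are multiples of finitely many, so one scalar outside
  \<open>p\<close>, the product of finitely many leading coefficients, can be the leading coefficient at all
  of them.\<close>

lemma ex_common_lead:
  fixes V :: "'v :: wellorder set"
  assumes V: "finite V" and J: "ideal J (mpoly_ring R V)" and p: "primeideal p R"
    and L: "L = {m. \<exists>g \<in> J. g m \<notin> p \<and> (\<forall>m' > m. g m' \<in> p)}"
  shows "\<exists>c \<in> carrier R - p. \<forall>m \<in> L. \<exists>b \<in> J. b m = c \<and> (\<forall>m' > m. b m' \<in> p)"
proof -
  interpret p: primeideal p R by (rule p)
  have pz: "\<zero> \<in> p" by (rule p.I_zero)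
  have LV: "set_mset m \<subseteq> V" if m: "m \<in> L" for m
  proof -
    from m obtain g where g: "g \<in> J" "g m \<notin> p" unfolding L by blast
    then have "g m \<noteq> \<zero>" using pz by metis
    then show ?thesis using mem_mpoly_ideal[OF J g(1)] by (simp add: is_mpoly_def)
  qed
  obtain F where F: "finite F" "F \<subseteq> L" "\<And>m. m \<in> L \<Longrightarrow> \<exists>a \<in> F. a \<subseteq># m"
    using dickson[OF V LV, of L] by blast
  let ?ok = "\<lambda>c m. \<exists>d \<in> carrier R. \<exists>g \<in> J. d \<otimes> g m = c \<and> (\<forall>m' > m. g m' \<in> p)"
  have "\<exists>c \<in> carrier R - p. \<forall>m \<in> F. ?ok c m"
    using F(1,2)
  proof induction
    case empty
    show ?case using p.one_in_complement by auto
  next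
    case (insert a F)
    then obtain c where c: "c \<in> carrier R" "c \<notin> p" "\<And>m. m \<in> F \<Longrightarrow> ?ok c m" by blast
    obtain g where g: "g \<in> J" "g a \<notin> p" "\<forall>m' > a. g m' \<in> p" using insert.prems unfolding L by blast
    have ga: "g a \<in> carrier R" by (rule is_mpoly_coeff[OF mem_mpoly_ideal[OF J g(1)]])
    have "?ok (g a \<otimes> c) m" if m: "m \<in> insert a F" for m
    proof (cases "m = a")
      case True
      then show ?thesis using g c(1) ga m_comm[of c "g a"] by blast
    next
      case False
      then obtain d k where d: "d \<in> carrier R" "k \<in> J" "d \<otimes> k m = c" "\<forall>m' > m. k m' \<in> p"
        using m c(3) by blast
      then have "(g a \<otimes> d) \<otimes> k m = g a \<otimes> c"
        using ga is_mpoly_coeff[OF mem_mpoly_ideal[OF J d(2)]] by (simp add: m_assoc)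
      then show ?thesis using d ga by (meson m_closed)
    qed
    moreover have "g a \<otimes> c \<in> carrier R - p" using c(1,2) g(2) ga p.I_prime[of "g a" c] by blast
    ultimately show ?case by blast
  qed
  then obtain c where c: "c \<in> carrier R - p" "\<And>m. m \<in> F \<Longrightarrow> ?ok c m" by blast
  have "\<exists>b \<in> J. b m = c \<and> (\<forall>m' > m. b m' \<in> p)" if m: "m \<in> L" for m
  proof -
    obtain a where a: "a \<in> F" "a \<subseteq># m" using F(3)[OF m] by blast
    obtain d g where d: "d \<in> carrier R" and g: "g \<in> J" "d \<otimes> g a = c" "\<And>m'. m' > a \<Longrightarrow> g m' \<in> p"
      using c(2)[OF a(1)] by blast
    let ?b = "mpoly_term d (m - a) \<otimes>\<^bsub>mpoly_ring R V\<^esub> g"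
    have eq: "a + (m - a) = m" using a(2) by simp
    note shift = term_mult_shift[OF d mem_mpoly_ideal[OF J g(1)], where d = "m - a" and m = a, unfolded eq]
    have "?b m' \<in> p" if m': "m' > m" for m'
    proof -
      consider "?b m' = \<zero>" | k where "k > a" "?b m' = d \<otimes> g k" using shift(2)[OF m'] by blast
      then show ?thesis
      proof cases
        case 2
        then show ?thesis using p.I_l_closed[OF g(3) d] by simp
      qed (simp add: pz)
    qed
    moreover have "set_mset (m - a) \<subseteq> V" using LV[OF m] by (meson in_diffD subset_iff)
    ultimately show ?thesis
      using term_mult_mem_ideal[OF J g(1) d] shift(1) g(2) by blast
  qed
  with c(1) show ?thesis by (intro bexI[of _ c] ballI)
qed

text \<open>Non-membership spreads from \<open>p\<close> to an open part of its closure. As in the theory of Groebner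
  bases, \<open>f\<close> is reduced to a remainder \<open>r\<close> without monomials from the set \<open>L\<close> of leading monomials of
  \<open>J\<close> modulo \<open>p\<close>. At primes where the common leading coefficient \<open>c\<close> is nonzero, an element of \<open>J\<close> is
  zero if its coefficients at \<open>L\<close> are, so a nonzero coefficient of \<open>r\<close> keeps \<open>f\<close> outside.\<close>

lemma fibre_nonmember_generic:
  fixes V :: "'v :: wellorder set"
  assumes V: "finite V" and J: "ideal J (mpoly_ring R V)" and p: "primeideal p R"
    and f: "is_mpoly V f" and nf: "\<not> fibre_member R J p f"
  obtains a where "a \<in> carrier R - p"
    "\<And>q. primeideal q R \<Longrightarrow> p \<subseteq> q \<Longrightarrow> a \<notin> q \<Longrightarrow> \<not> fibre_member R J q f"
proof -
  interpret p: primeideal p R by (rule p)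
  have pz: "\<zero> \<in> p" by (rule p.I_zero)
  note Jcoeff = is_mpoly_coeff[OF mem_mpoly_ideal[OF J]]
  define L where "L = {m. \<exists>g \<in> J. g m \<notin> p \<and> (\<forall>m' > m. g m' \<in> p)}"
  from ex_common_lead[OF V J p L_def]
  obtain c where c_mem: "c \<in> carrier R - p"
    and b_all: "\<forall>m \<in> L. \<exists>b \<in> J. b m = c \<and> (\<forall>m' > m. b m' \<in> p)" ..
  have c: "c \<in> carrier R" "c \<notin> p" using c_mem by simp_all
  note b = bspec[OF b_all]
  \<comment> \<open>One division step: it removes the leading monomial of \<open>g\<close> modulo \<open>p\<close>.\<close>
  have cancel: "c \<otimes> g m' \<ominus> g m \<otimes> b m' \<in> p"
    if g: "is_mpoly V g" "\<And>m'. m' > m \<Longrightarrow> g m' \<in> p"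
      and b: "b \<in> J" "b m = c" "\<And>m'. m' > m \<Longrightarrow> b m' \<in> p" and m': "m' \<ge> m" for g b m m'
  proof (cases "m' = m")
    case True
    have "c \<otimes> g m \<ominus> g m \<otimes> c = \<zero>"
      using c(1) is_mpoly_coeff[OF g(1), of m] by algebra
    then show ?thesis unfolding True b(2) using pz by simp
  next
    case False
    then have lt: "m' > m" using m' by simp
    show ?thesis
      by (rule p.I_minus[OF p.I_l_closed[OF g(2)[OF lt] c(1)]
            p.I_l_closed[OF b(3)[OF lt] is_mpoly_coeff[OF g(1)]]])
  qed

  \<comment> \<open>The leading monomial of \<open>h\<close> modulo \<open>p\<close> lies in \<open>L\<close>, where \<open>h\<close> vanishes modulo \<open>q\<close>. So a division
      step changes \<open>h\<close> modulo \<open>q\<close> by the factor \<open>c\<close> only.\<close>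
  have vanish: "\<forall>m. h m \<in> q"
    if q: "primeideal q R" "p \<subseteq> q" "c \<notin> q" and h: "h \<in> J" "\<forall>m \<in> L. h m \<in> q" for q h
  proof -
    interpret q: primeideal q R by (rule q(1))
    have "h \<in> J \<longrightarrow> (\<forall>m \<in> L. h m \<in> q) \<longrightarrow> (\<forall>m. h m \<in> q)"
      using mem_mpoly_ideal[OF J h(1)] pz
    proof (induction rule: mpoly_lead_induct)
      case (step h)
      show ?case
      proof (intro impI allI)
        fix k assume hJ: "h \<in> J" and hL: "\<forall>m \<in> L. h m \<in> q"
        show "h k \<in> q"
        proof (cases "h k \<in> p")
          case False
          from ex_leading_monomial[OF step.hyps pz this]
          obtain m where m: "h m \<notin> p" "\<And>m'. m' > m \<Longrightarrow> h m' \<in> p" by auto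
          then have mL: "m \<in> L" unfolding L_def using hJ by (intro CollectI bexI[of _ h]) auto
          from b[OF mL] obtain b where b: "b \<in> J" "b m = c" "\<And>m'. m' > m \<Longrightarrow> b m' \<in> p" by auto
          note carr = c(1) Jcoeff[OF hJ] Jcoeff[OF b(1)]
          let ?h = "\<lambda>k. c \<otimes> h k \<ominus> h m \<otimes> b k"
          have hm: "h m \<otimes> b k \<in> q" for k
            by (rule q.I_r_closed[OF bspec[OF hL mL] carr(3)])
          have h'J: "?h \<in> J"
            by (rule minus_mem_mpoly_ideal[OF J smult_mem_mpoly_ideal[OF J hJ carr(1)]
                  smult_mem_mpoly_ideal[OF J b(1) carr(2)]])
          have "\<forall>m \<in> L. ?h m \<in> q"
            by (intro ballI q.I_minus[OF q.I_l_closed hm] bspec[OF hL] carr(1))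
          with step.IH[OF mem_mpoly_ideal[OF J h'J] m(1) cancel[OF step.hyps m(2) b]] h'J
          have "?h k \<in> q" by simp
          then have "?h k \<oplus> h m \<otimes> b k \<in> q"
            by (rule q.I_add[OF _ hm])
          moreover have "?h k \<oplus> h m \<otimes> b k = c \<otimes> h k"
            using carr(1) carr(2)[of k] carr(2)[of m] carr(3)[of k] by algebra
          ultimately show ?thesis using q.I_prime[OF carr(1) carr(2)[of k]] q(3) by simp
        next
          case True
          then show ?thesis using q(2) by (rule subsetD[rotated])
        qed
      qed
    qed
    then show ?thesis using h by blast
  qed

  \<comment> \<open>Division with remainder. The multiplier \<open>u\<close> is a power of \<open>c\<close>, so it avoids all primes that
      avoid \<open>c\<close>.\<close>
  have "\<exists>u \<in> carrier R. (\<forall>q. primeideal q R \<longrightarrow> c \<notin> q \<longrightarrow> u \<notin> q) \<and>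
      (\<exists>r. is_mpoly V r \<and> (\<lambda>m. u \<otimes> f m \<ominus> r m) \<in> J \<and> (\<forall>m \<in> L. r m \<in> p))"
    using f pz
  proof (induction rule: mpoly_lead_induct)
    case (step f)
    note fcoeff = is_mpoly_coeff[OF step.hyps]
    show ?case
    proof (cases "\<forall>m. f m \<in> p")
      case True
      have "(\<lambda>m. \<one> \<otimes> f m \<ominus> f m) \<in> J"
        using fcoeff zero_mem_mpoly_ideal[OF J] by (simp add: minus_eq r_neg)
      moreover have "\<one> \<notin> q" if "primeideal q R" for q
        using that by (metis ideal.one_imp_carrier primeideal.I_notcarr primeideal.axioms(1))
      ultimately show ?thesis using step.hyps True one_closed by blast
    next
      case False
      then obtain m0 where "f m0 \<notin> p" by blast
      from ex_leading_monomial[OF step.hyps pz this] obtain m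
        where m: "f m \<notin> p" "set_mset m \<subseteq> V" "\<And>m'. m' > m \<Longrightarrow> f m' \<in> p" by auto
      show ?thesis
      proof (cases "m \<in> L")
        case True
        from b[OF this] obtain b where b: "b \<in> J" "b m = c" "\<And>m'. m' > m \<Longrightarrow> b m' \<in> p" by auto
        let ?f = "\<lambda>k. c \<otimes> f k \<ominus> f m \<otimes> b k"
        have f': "is_mpoly V ?f"
          by (intro is_mpoly_minus is_mpoly_smult step.hyps c(1) fcoeff mem_mpoly_ideal[OF J b(1)])
        from step.IH[OF f' m(1) cancel[OF step.hyps m(3) b]] obtain u r
          where u: "u \<in> carrier R" "\<forall>q. primeideal q R \<longrightarrow> c \<notin> q \<longrightarrow> u \<notin> q" and r: "is_mpoly V r"
            "(\<lambda>k. u \<otimes> ?f k \<ominus> r k) \<in> J" "\<forall>m \<in> L. r m \<in> p" by blast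
        have "(\<lambda>k. (u \<otimes> ?f k \<ominus> r k) \<oplus> (u \<otimes> f m) \<otimes> b k) \<in> J"
          using u(1) fcoeff by (intro add_mem_mpoly_ideal[OF J r(2)] smult_mem_mpoly_ideal[OF J b(1)]) auto
        moreover have "(u \<otimes> ?f k \<ominus> r k) \<oplus> (u \<otimes> f m) \<otimes> b k = (u \<otimes> c) \<otimes> f k \<ominus> r k" for k
          using u(1) c(1) fcoeff[of k] fcoeff[of m] is_mpoly_coeff[OF r(1), of k] Jcoeff[OF b(1), of k]
          by algebra
        ultimately have "(\<lambda>k. (u \<otimes> c) \<otimes> f k \<ominus> r k) \<in> J" by simp
        moreover have "u \<otimes> c \<notin> q" if "primeideal q R" "c \<notin> q" for q
          using primeideal.I_prime[OF that(1) u(1) c(1)] u(2) that by blast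
        moreover have "u \<otimes> c \<in> carrier R" using u(1) c(1) by simp
        ultimately show ?thesis using r(1,3) by blast
      next
        case False
        have f': "is_mpoly V (f(m := \<zero>))"
        proof -
          have "{k. (f(m := \<zero>)) k \<noteq> \<zero>} \<subseteq> {k. f k \<noteq> \<zero>}" by auto
          then show ?thesis using step.hyps unfolding is_mpoly_def by (auto intro: finite_subset)
        qed
        have "(f(m := \<zero>)) m' \<in> p" if "m' \<ge> m" for m'
          using that m(3)[of m'] pz by (cases "m' = m") auto
        from step.IH[OF f' m(1) this] obtain u r
          where u: "u \<in> carrier R" "\<forall>q. primeideal q R \<longrightarrow> c \<notin> q \<longrightarrow> u \<notin> q" and r: "is_mpoly V r"
            "(\<lambda>k. u \<otimes> (f(m := \<zero>)) k \<ominus> r k) \<in> J" "\<forall>m \<in> L. r m \<in> p" by blast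
        note rcoeff = is_mpoly_coeff[OF r(1)]
        let ?r = "\<lambda>k. mpoly_term (u \<otimes> f m) m k \<oplus> r k"
        have "is_mpoly V ?r"
          using u(1) fcoeff m(2) by (intro is_mpoly_add is_mpoly_term r(1)) auto
        moreover have "u \<otimes> f k \<ominus> ?r k = u \<otimes> (f(m := \<zero>)) k \<ominus> r k" for k
        proof (cases "k = m")
          case True
          have "u \<otimes> f m \<ominus> (u \<otimes> f m \<oplus> r m) = \<zero> \<ominus> r m"
            using u(1) fcoeff[of m] rcoeff[of m] by algebra
          then show ?thesis using True u(1) by (simp add: mpoly_term_def)
        next
          case False
          then show ?thesis using rcoeff by (simp add: mpoly_term_def)
        qed
        moreover have "?r k \<in> p" if "k \<in> L" for k
          using that False r(3) rcoeff by (auto simp: mpoly_term_def)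
        ultimately have "is_mpoly V ?r \<and> (\<lambda>k. u \<otimes> f k \<ominus> ?r k) \<in> J \<and> (\<forall>m \<in> L. ?r m \<in> p)"
          using r(2) by simp
        then show ?thesis using u by blast
      qed
    qed
  qed
  then obtain u r where u: "u \<in> carrier R" "\<And>q. primeideal q R \<Longrightarrow> c \<notin> q \<Longrightarrow> u \<notin> q"
    and r: "is_mpoly V r" "(\<lambda>m. u \<otimes> f m \<ominus> r m) \<in> J" "\<And>m. m \<in> L \<Longrightarrow> r m \<in> p" by blast
  note fcoeff = is_mpoly_coeff[OF f] and rcoeff = is_mpoly_coeff[OF r(1)]

  \<comment> \<open>Otherwise \<open>u f \<in> J + pR[x]\<close>.\<close>
  have "\<exists>m. r m \<notin> p"
  proof (rule ccontr)
    assume "\<not> ?thesis"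
    moreover have "u \<otimes> f m \<ominus> (u \<otimes> f m \<ominus> r m) = r m" for m
      using u(1) fcoeff[of m] rcoeff[of m] by algebra
    ultimately have "\<forall>m. u \<otimes> f m \<ominus> (u \<otimes> f m \<ominus> r m) \<in> p" by simp
    moreover have "u \<in> carrier R - p" using u(1) u(2)[OF p c(2)] by blast
    ultimately have "fibre_member R J p f"
      unfolding fibre_member_def by (intro bexI[of _ u] bexI[OF _ r(2)])
    with nf show False by contradiction
  qed
  then obtain m0 where m0: "r m0 \<notin> p" by blast
  show ?thesis
  proof (rule that[of "c \<otimes> r m0"])
    show "c \<otimes> r m0 \<in> carrier R - p" using p.I_prime[OF c(1) rcoeff[of m0]] c m0 rcoeff by auto
    fix q assume q: "primeideal q R" and pq: "p \<subseteq> q" and cr: "c \<otimes> r m0 \<notin> q"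
    interpret q: primeideal q R by (rule q)
    have cq: "c \<notin> q" using cr q.I_r_closed[OF _ rcoeff] by blast
    have rq: "r m0 \<notin> q" using cr q.I_l_closed[OF _ c(1)] by blast
    show "\<not> fibre_member R J q f"
    proof
      assume "fibre_member R J q f"
      then obtain t j where t: "t \<in> carrier R" "t \<notin> q" and j: "j \<in> J"
        and tj: "\<And>m. t \<otimes> f m \<ominus> j m \<in> q" unfolding fibre_member_def by blast
      \<comment> \<open>An element of \<open>J\<close> that agrees with \<open>t r\<close> modulo \<open>q\<close> and hence vanishes at \<open>L\<close>.\<close>
      let ?h = "\<lambda>m. u \<otimes> j m \<ominus> t \<otimes> (u \<otimes> f m \<ominus> r m)"
      have hJ: "?h \<in> J"
        using minus_mem_mpoly_ideal[OF J smult_mem_mpoly_ideal[OF J j u(1)] smult_mem_mpoly_ideal[OF J r(2) t(1)]] .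
      have utj: "u \<otimes> (t \<otimes> f m \<ominus> j m) \<in> q" for m using q.I_l_closed[OF tj u(1)] .
      have eq: "?h m = t \<otimes> r m \<ominus> u \<otimes> (t \<otimes> f m \<ominus> j m)" "?h m \<oplus> u \<otimes> (t \<otimes> f m \<ominus> j m) = t \<otimes> r m" for m
        using t(1) u(1) fcoeff[of m] rcoeff[of m] Jcoeff[OF j, of m] by algebra+
      have "?h m \<in> q" if "m \<in> L" for m
        unfolding eq(1) using r(3)[OF that] pq t(1) by (intro q.I_minus[OF _ utj] q.I_l_closed) auto
      then have "?h m0 \<in> q" using vanish[OF q pq cq hJ] by blast
      then have "?h m0 \<oplus> u \<otimes> (t \<otimes> f m0 \<ominus> j m0) \<in> q"
        using utj by (rule q.I_add)
      then show False unfolding eq(2) using q.I_prime[OF t(1) rcoeff] t(2) rq by blast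
    qed
  qed
qed

end

section \<open>Constructible and closed sets in Noetherian spectra\<close>

definition vanishing_set :: "('a, 'r) ring_scheme \<Rightarrow> 'a set \<Rightarrow> 'a set set" where
  "vanishing_set R I = {p \<in> Spec R. I \<subseteq> p}"

lemma constructible_in_empty: "constructible_in T {}"
  unfolding constructible_in_def by (intro exI[of _ "0::nat"]) simp

lemma constructible_in_open_closed:
  assumes "openin T U" "closedin T Z"
  shows "constructible_in T (U \<inter> Z)"
  unfolding constructible_in_def using assms
  by (intro exI[of _ "1::nat"] exI[of _ "\<lambda>_. U"] exI[of _ "\<lambda>_. Z"]) simp

lemma constructible_in_Un:
  assumes A: "constructible_in T A" and B: "constructible_in T B"
  shows "constructible_in T (A \<union> B)"
proof -
  obtain s :: nat and U Z where 1: "\<And>i. i \<in> {1..s} \<Longrightarrow> openin T (U i) \<and> closedin T (Z i)"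
    and A: "A = (\<Union>i \<in> {1..s}. U i \<inter> Z i)" using A unfolding constructible_in_def by blast
  obtain t :: nat and U' Z' where 2: "\<And>i. i \<in> {1..t} \<Longrightarrow> openin T (U' i) \<and> closedin T (Z' i)"
    and B: "B = (\<Union>i \<in> {1..t}. U' i \<inter> Z' i)" using B unfolding constructible_in_def by blast
  define U'' where "U'' i = (if i \<le> s then U i else U' (i - s))" for i
  define Z'' where "Z'' i = (if i \<le> s then Z i else Z' (i - s))" for i
  have cond: "openin T (U'' i) \<and> closedin T (Z'' i)" if "i \<in> {1..s + t}" for i
  proof (cases "i \<le> s")
    case True
    then show ?thesis using 1[of i] that by (simp add: U''_def Z''_def)
  next
    case False
    then have "i - s \<in> {1..t}" using that by auto
    from 2[OF this] show ?thesis using False by (simp add: U''_def Z''_def)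
  qed
  have eq: "A \<union> B = (\<Union>i \<in> {1..s + t}. U'' i \<inter> Z'' i)"
  proof -
    have "{1..s + t} = {1..s} \<union> (\<lambda>i. i + s) ` {1..t}"
    proof (intro equalityI subsetI)
      fix i assume "i \<in> {1..s + t}"
      then show "i \<in> {1..s} \<union> (\<lambda>i. i + s) ` {1..t}"
        by (cases "i \<le> s") (auto intro: image_eqI[of _ _ "i - s"])
    qed auto
    moreover have "(\<Union>i \<in> {1..s}. U'' i \<inter> Z'' i) = A"
      unfolding A by (simp add: U''_def Z''_def)
    moreover have "(\<Union>i \<in> (\<lambda>i. i + s) ` {1..t}. U'' i \<inter> Z'' i) = B"
      unfolding B image_image by (intro SUP_cong refl) (simp add: U''_def Z''_def)
    ultimately show ?thesis by simp
  qed
  have "(\<forall>i \<in> {1..s + t}. openin T (U'' i) \<and> closedin T (Z'' i)) \<and>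
      A \<union> B = (\<Union>i \<in> {1..s + t}. U'' i \<inter> Z'' i)"
    by (intro conjI[OF ballI eq] cond)
  then show ?thesis unfolding constructible_in_def by (intro exI)
qed

context cring
begin

lemma openin_zariski: "openin (zariski R) U \<longleftrightarrow> zariski_open R U"
  unfolding zariski_def by (simp add: topology_inverse' istopology_zariski_open[OF is_cring])

lemma Spec_proper: "p \<in> Spec R \<Longrightarrow> \<not> carrier R \<subseteq> p"
  using primeideal.one_in_complement[of p R] unfolding Spec_def by blast

lemma topspace_zariski: "topspace (zariski R) = Spec R"
proof
  show "topspace (zariski R) \<subseteq> Spec R"
    unfolding topspace_def openin_zariski zariski_open_def by auto
  have "zariski_open R (Spec R)"
    using Spec_proper
    unfolding zariski_open_def by (intro exI[of _ "carrier R"]) (auto simp: oneideal)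
  then show "Spec R \<subseteq> topspace (zariski R)"
    by (intro openin_subset) (simp add: openin_zariski)
qed

lemma openin_nonvanishing:
  assumes "ideal I R"
  shows "openin (zariski R) (Spec R - vanishing_set R I)"
  unfolding openin_zariski zariski_open_def vanishing_set_def using assms by (intro exI[of _ I]) auto

lemma closedin_vanishing_set:
  assumes "ideal I R"
  shows "closedin (zariski R) (vanishing_set R I)"
  unfolding closedin_def topspace_zariski using openin_nonvanishing[OF assms]
  by (auto simp: vanishing_set_def)

lemma vanishing_set_insert:
  assumes "ideal I R" "a \<in> carrier R"
  shows "vanishing_set R (Idl (insert a I)) = {p \<in> vanishing_set R I. a \<in> p}"
proof -
  have sub: "insert a I \<subseteq> carrier R" using assms ideal.Icarr by fastforce
  have "Idl (insert a I) \<subseteq> p \<longleftrightarrow> insert a I \<subseteq> p" if "p \<in> Spec R" for p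
    using Idl_subset_ideal[OF _ sub] that primeideal.axioms(1) unfolding Spec_def by blast
  then show ?thesis unfolding vanishing_set_def by auto
qed

lemma ideal_insert:
  assumes I: "ideal I R" and a: "a \<in> carrier R" "a \<notin> I"
  shows "ideal (Idl (insert a I)) R" "I \<subset> Idl (insert a I)"
proof -
  have sub: "insert a I \<subseteq> carrier R" using assms ideal.Icarr by fastforce
  show "ideal (Idl (insert a I)) R" by (rule genideal_ideal[OF sub])
  show "I \<subset> Idl (insert a I)" using genideal_self[OF sub] a(2) by auto
qed

end

lemma (in noetherian_ring) noetherian_ideal_induct [consumes 1, case_names step]:
  assumes I: "ideal I R"
    and step: "\<And>I. ideal I R \<Longrightarrow> (\<And>K. ideal K R \<Longrightarrow> I \<subset> K \<Longrightarrow> Q K) \<Longrightarrow> Q I"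
  shows "Q I"
proof (rule ccontr)
  assume nQ: "\<not> Q I"
  let ?A = "{I. ideal I R \<and> \<not> Q I}"
  have "\<exists>M \<in> ?A. \<forall>K \<in> ?A. M \<subseteq> K \<longrightarrow> K = M"
  proof (rule subset_Zorn_nonempty)
    show "?A \<noteq> {}" using I nQ by blast
    fix \<C> assume C: "\<C> \<noteq> {}" "subset.chain ?A \<C>"
    then have "subset.chain {I. ideal I R} \<C>" unfolding subset.chain_def by blast
    from ideal_chain_is_trivial[OF C(1) this] show "\<Union>\<C> \<in> ?A"
      using C(2) unfolding subset.chain_def by blast
  qed
  then obtain M where "ideal M R" "\<not> Q M" "\<And>K. ideal K R \<Longrightarrow> M \<subset> K \<Longrightarrow> Q K" by blast
  with step show False by blast
qed

text \<open>A closed set is the union of two smaller ones unless it is irreducible. In the irreducible case,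
  the property is available for closed subsets that miss the generic point \<open>p\<close>.\<close>

lemma noetherian_spectrum_induct [consumes 3, case_names empty Un prime]:
  fixes R (structure)
  assumes "cring R" and "noetherian_ring R" and I: "ideal I R"
    and empty: "Q {}"
    and Un: "\<And>A B. Q A \<Longrightarrow> Q B \<Longrightarrow> Q (A \<union> B)"
    and prime: "\<And>p. primeideal p R \<Longrightarrow>
      (\<And>a. a \<in> carrier R \<Longrightarrow> a \<notin> p \<Longrightarrow> Q {q \<in> vanishing_set R p. a \<in> q}) \<Longrightarrow> Q (vanishing_set R p)"
  shows "Q (vanishing_set R I)"
proof -
  interpret cring R by fact
  interpret noetherian_ring R by fact
  show ?thesis
    using I
  proof (induction rule: noetherian_ideal_induct)
    case (step I)
    have smaller: "Q {q \<in> vanishing_set R I. a \<in> q}" if "a \<in> carrier R" "a \<notin> I" for a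
      using step.IH[OF ideal_insert[OF step.hyps that]] vanishing_set_insert[OF step.hyps that(1)] by simp
    consider "I = carrier R" | "primeideal I R"
      | "I \<noteq> carrier R" "\<not> primeideal I R" by blast
    then show ?case
    proof cases
      case 1
      have "vanishing_set R I = {}" using Spec_proper unfolding vanishing_set_def 1 by blast
      then show ?thesis using empty by simp
    next
      case 2
      then show ?thesis using prime smaller by blast
    next
      case 3
      then have "\<exists>a b. a \<in> carrier R \<and> b \<in> carrier R \<and> a \<otimes> b \<in> I \<and> a \<notin> I \<and> b \<notin> I"
        using primeidealI[OF step.hyps is_cring] by blast
      then obtain a b where ab: "a \<in> carrier R" "b \<in> carrier R" "a \<otimes> b \<in> I" "a \<notin> I" "b \<notin> I" by blast
      have "a \<in> q \<or> b \<in> q" if "q \<in> vanishing_set R I" for q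
        using that ab(1-3) primeideal.I_prime[of q R a b] unfolding vanishing_set_def Spec_def by blast
      then have "vanishing_set R I = {q \<in> vanishing_set R I. a \<in> q} \<union> {q \<in> vanishing_set R I. b \<in> q}" by blast
      then show ?thesis using Un[OF smaller[OF ab(1,4)] smaller[OF ab(2,5)]] by simp
    qed
  qed
qed

text \<open>Membership in \<open>E\<close> is the same at the generic point of an irreducible closed set and on a
  nonempty open part of that set.\<close>

definition generically_constant :: "('a, 'r) ring_scheme \<Rightarrow> 'a set set \<Rightarrow> bool" where
  "generically_constant R E \<longleftrightarrow> E \<subseteq> Spec R \<and>
     (\<forall>p \<in> Spec R. \<exists>a \<in> carrier R - p. \<forall>q \<in> Spec R. p \<subseteq> q \<longrightarrow> a \<notin> q \<longrightarrow> (q \<in> E \<longleftrightarrow> p \<in> E))"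

lemma generically_constantD:
  assumes "generically_constant R E" "p \<in> Spec R"
  shows "\<exists>a \<in> carrier R - p. \<forall>q \<in> Spec R. p \<subseteq> q \<longrightarrow> a \<notin> q \<longrightarrow> (q \<in> E \<longleftrightarrow> p \<in> E)"
  by (rule bspec[OF conjunct2[OF assms(1)[unfolded generically_constant_def]] assms(2)])

lemma vanishing_set_zero:
  assumes "ring R"
  shows "vanishing_set R {\<zero>\<^bsub>R\<^esub>} = Spec R"
  using ideal.I_zero[OF primeideal.axioms(1)]
  unfolding vanishing_set_def Spec_def by blast

text \<open>On \<open>V(p)\<close>, the set \<open>E\<close> consists of its part in a smaller closed set together with all or nothing of
  the remaining locally closed part.\<close>

lemma constructible_if_generically_constant:
  fixes R (structure)
  assumes R: "cring R" "noetherian_ring R" and E: "generically_constant R E"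
  shows "constructible_in (zariski R) E"
proof -
  interpret cring R by fact
  have "constructible_in (zariski R) (E \<inter> vanishing_set R {\<zero>})"
    using R zeroideal
  proof (induction rule: noetherian_spectrum_induct[where Q = "\<lambda>A. constructible_in (zariski R) (E \<inter> A)"])
    case empty
    show ?case by (simp add: constructible_in_empty)
  next
    case (Un A B)
    then show ?case by (simp add: constructible_in_Un Int_Un_distrib)
  next
    case (prime p)
    then have p: "p \<in> Spec R" and pI: "ideal p R" by (simp_all add: Spec_def primeideal.axioms(1))
    from generically_constantD[OF E p] obtain a where a_mem: "a \<in> carrier R - p"
      and E': "\<forall>q \<in> Spec R. p \<subseteq> q \<longrightarrow> a \<notin> q \<longrightarrow> (q \<in> E \<longleftrightarrow> p \<in> E)" ..
    have a: "a \<in> carrier R" "a \<notin> p" using a_mem by simp_all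
    let ?small = "E \<inter> {q \<in> vanishing_set R p. a \<in> q}"
    have small: "constructible_in (zariski R) ?small" by (rule prime(2)[OF a])
    show ?case
    proof (cases "p \<in> E")
      case True
      let ?U = "Spec R - vanishing_set R (Idl (insert a p))"
      have "E \<inter> vanishing_set R p = ?small \<union> (?U \<inter> vanishing_set R p)"
        using E' True unfolding vanishing_set_insert[OF pI a(1)] unfolding vanishing_set_def by blast
      moreover have "constructible_in (zariski R) (?U \<inter> vanishing_set R p)"
        by (intro constructible_in_open_closed openin_nonvanishing closedin_vanishing_set
            ideal_insert(1) pI a)
      ultimately show ?thesis using constructible_in_Un[OF small] by simp
    next
      case False
      then have "E \<inter> vanishing_set R p = ?small" using E' unfolding vanishing_set_def by blast
      then show ?thesis using small by simp
    qed
  qed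
  moreover have "E \<inter> vanishing_set R {\<zero>} = E"
    using E vanishing_set_zero[OF ring_axioms] unfolding generically_constant_def by blast
  ultimately show ?thesis by simp
qed

text \<open>If \<open>E\<close> contains the generic point of \<open>V(p)\<close>, it contains \<open>V(p)\<close> by specialization. Otherwise, near the
  generic point it contains nothing.\<close>

lemma closed_if_generically_constant:
  fixes R (structure)
  assumes R: "cring R" "noetherian_ring R" and E: "generically_constant R E"
    and special: "\<And>p q. p \<in> E \<Longrightarrow> q \<in> Spec R \<Longrightarrow> p \<subseteq> q \<Longrightarrow> q \<in> E"
  shows "closedin (zariski R) E"
proof -
  interpret cring R by fact
  have "closedin (zariski R) (E \<inter> vanishing_set R {\<zero>})"
    using R zeroideal
  proof (induction rule: noetherian_spectrum_induct[where Q = "\<lambda>A. closedin (zariski R) (E \<inter> A)"])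
    case empty
    show ?case by simp
  next
    case (Un A B)
    then show ?case by (simp add: closedin_Un Int_Un_distrib)
  next
    case (prime p)
    then have p: "p \<in> Spec R" and pI: "ideal p R" by (simp_all add: Spec_def primeideal.axioms(1))
    show ?case
    proof (cases "p \<in> E")
      case True
      then have "E \<inter> vanishing_set R p = vanishing_set R p"
        using special unfolding vanishing_set_def by blast
      then show ?thesis using closedin_vanishing_set[OF pI] by simp
    next
      case False
      from generically_constantD[OF E p] obtain a where a_mem: "a \<in> carrier R - p"
        and E': "\<forall>q \<in> Spec R. p \<subseteq> q \<longrightarrow> a \<notin> q \<longrightarrow> (q \<in> E \<longleftrightarrow> p \<in> E)" ..
      have a: "a \<in> carrier R" "a \<notin> p" using a_mem by simp_all
      have "E \<inter> vanishing_set R p = E \<inter> {q \<in> vanishing_set R p. a \<in> q}"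
        using E' False unfolding vanishing_set_def by blast
      then show ?thesis using prime(2)[OF a] by simp
    qed
  qed
  moreover have "E \<inter> vanishing_set R {\<zero>} = E"
    using E vanishing_set_zero[OF ring_axioms] unfolding generically_constant_def by blast
  ultimately show ?thesis by simp
qed

section \<open>Flat modules are torsion-free modulo a prime ideal\<close>

text \<open>A copy of \<open>R/I\<close> among the test modules of flatness: a coset is represented by the set of
  constant functions with values in it.\<close>

lemma (in ideal) ex_quotient_module:
  assumes "cring R"
  shows "\<exists>(N :: ('a, (nat \<Rightarrow> 'a) set) module) \<phi>. module R N \<and> carrier N = \<phi> ` carrier R \<and>
    (\<forall>a \<in> carrier R. \<forall>b \<in> carrier R. \<phi> a = \<phi> b \<longleftrightarrow> a \<ominus> b \<in> I) \<and>
    (\<forall>a \<in> carrier R. \<forall>b \<in> carrier R. \<phi> (a \<oplus> b) = \<phi> a \<oplus>\<^bsub>N\<^esub> \<phi> b) \<and>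
    (\<forall>a \<in> carrier R. \<forall>b \<in> carrier R. \<phi> (a \<otimes> b) = a \<odot>\<^bsub>N\<^esub> \<phi> b) \<and> \<phi> \<zero> = \<zero>\<^bsub>N\<^esub>"
proof -
  interpret cring R by fact
  define \<phi> where "\<phi> a = (\<lambda>r (_ :: nat). r) ` (I +> a)" for a
  define rep where "rep A = (SOME a. a \<in> carrier R \<and> \<phi> a = A)" for A
  have "inj (\<lambda>r (_ :: nat). r :: 'a)" by (auto simp: inj_def fun_eq_iff)
  then have \<phi>_eq: "\<phi> a = \<phi> b \<longleftrightarrow> a \<ominus> b \<in> I" if "a \<in> carrier R" "b \<in> carrier R" for a b
    unfolding \<phi>_def using that quotient_eq_iff_same_a_r_cos[OF is_ideal that] by (simp add: inj_image_eq_iff)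
  have rep: "rep (\<phi> a) \<in> carrier R" "\<phi> (rep (\<phi> a)) = \<phi> a" if "a \<in> carrier R" for a
    using someI[of "\<lambda>b. b \<in> carrier R \<and> \<phi> b = \<phi> a" a] that unfolding rep_def by auto
  have rep_diff: "rep (\<phi> a) \<ominus> a \<in> I" if "a \<in> carrier R" for a
    using \<phi>_eq[OF rep(1)[OF that] that] rep(2)[OF that] by simp
  define N :: "('a, (nat \<Rightarrow> 'a) set) module" where
    "N = \<lparr>carrier = \<phi> ` carrier R, monoid.mult = (\<lambda>A B. A), monoid.one = \<phi> \<zero>, ring.zero = \<phi> \<zero>,
      ring.add = (\<lambda>A B. \<phi> (rep A \<oplus> rep B)), smult = (\<lambda>a A. \<phi> (a \<otimes> rep A))\<rparr>"
  have N_add: "\<phi> a \<oplus>\<^bsub>N\<^esub> \<phi> b = \<phi> (a \<oplus> b)" if a: "a \<in> carrier R" and b: "b \<in> carrier R" for a b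
  proof -
    have "(rep (\<phi> a) \<oplus> rep (\<phi> b)) \<ominus> (a \<oplus> b) = (rep (\<phi> a) \<ominus> a) \<oplus> (rep (\<phi> b) \<ominus> b)"
      using rep(1)[OF a] rep(1)[OF b] a b by algebra
    also have "\<dots> \<in> I"
      by (rule I_add[OF rep_diff[OF a] rep_diff[OF b]])
    finally have "\<phi> (rep (\<phi> a) \<oplus> rep (\<phi> b)) = \<phi> (a \<oplus> b)"
      using rep(1)[OF a] rep(1)[OF b] a b by (intro \<phi>_eq[THEN iffD2]) simp_all
    then show ?thesis by (simp add: N_def)
  qed
  have N_smult: "a \<odot>\<^bsub>N\<^esub> \<phi> b = \<phi> (a \<otimes> b)" if a: "a \<in> carrier R" and b: "b \<in> carrier R" for a b
  proof -
    have "a \<otimes> rep (\<phi> b) \<ominus> a \<otimes> b = a \<otimes> (rep (\<phi> b) \<ominus> b)"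
      using rep(1)[OF b] a b by algebra
    also have "\<dots> \<in> I" by (rule I_l_closed[OF rep_diff[OF b] a])
    finally have "\<phi> (a \<otimes> rep (\<phi> b)) = \<phi> (a \<otimes> b)"
      using rep(1)[OF b] a b by (intro \<phi>_eq[THEN iffD2]) simp_all
    then show ?thesis by (simp add: N_def)
  qed
  have N_carrier: "carrier N = \<phi> ` carrier R" and N_zero: "\<zero>\<^bsub>N\<^esub> = \<phi> \<zero>"
    by (simp_all add: N_def)
  have "module R N"
  proof (rule moduleI)
    show "abelian_group N"
    proof (rule abelian_groupI)
      fix x assume "x \<in> carrier N"
      then obtain a where a: "x = \<phi> a" "a \<in> carrier R" unfolding N_carrier by blast
      have "\<phi> (\<ominus> a) \<oplus>\<^bsub>N\<^esub> x = \<zero>\<^bsub>N\<^esub>" using a by (simp add: N_add N_zero l_neg)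
      then show "\<exists>y \<in> carrier N. y \<oplus>\<^bsub>N\<^esub> x = \<zero>\<^bsub>N\<^esub>"
        using a(2) unfolding N_carrier by (intro bexI[of _ "\<phi> (\<ominus> a)"]) auto
    qed (auto simp: N_carrier N_zero N_add a_ac)
  qed (auto simp: N_carrier N_add N_smult l_distr r_distr m_assoc is_cring)
  then show ?thesis
    using \<phi>_eq N_add N_smult N_zero N_carrier by (intro exI[of _ N] exI[of _ \<phi>] conjI ballI) simp_all
qed

lemma keys_diff_subset:
  "Poly_Mapping.keys u \<subseteq> A \<Longrightarrow> Poly_Mapping.keys v \<subseteq> A \<Longrightarrow>
    Poly_Mapping.keys (u - v :: 'x \<Rightarrow>\<^sub>0 int) \<subseteq> A"
  using keys_diff[of u v] by blast

text \<open>The generators of \<open>tensor_relations\<close>, named for case distinctions.\<close>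

definition tensor_generators ::
  "('a, 'r) ring_scheme \<Rightarrow> ('a, 'b, 'm) module_scheme \<Rightarrow> ('a, 'c, 'n) module_scheme
     \<Rightarrow> ('b \<times> 'c \<Rightarrow>\<^sub>0 int) set" where
  "tensor_generators R M N =
      {frag_of (x \<oplus>\<^bsub>M\<^esub> x', y) - frag_of (x, y) - frag_of (x', y) | x x' y.
         x \<in> carrier M \<and> x' \<in> carrier M \<and> y \<in> carrier N} \<union>
      {frag_of (x, y \<oplus>\<^bsub>N\<^esub> y') - frag_of (x, y) - frag_of (x, y') | x y y'.
         x \<in> carrier M \<and> y \<in> carrier N \<and> y' \<in> carrier N} \<union>
      {frag_of (a \<odot>\<^bsub>M\<^esub> x, y) - frag_of (x, a \<odot>\<^bsub>N\<^esub> y) | a x y.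
         a \<in> carrier R \<and> x \<in> carrier M \<and> y \<in> carrier N}"

lemma tensor_relations_eq_generate:
  "tensor_relations R M N =
    generate (free_Abelian_group (carrier M \<times> carrier N)) (tensor_generators R M N)"
  unfolding tensor_relations_def tensor_generators_def ..

lemma tensor_generators_cases [consumes 1, case_names left right scalar]:
  assumes "z \<in> tensor_generators R M N"
  obtains x x' y where "z = frag_of (x \<oplus>\<^bsub>M\<^esub> x', y) - frag_of (x, y) - frag_of (x', y)"
      "x \<in> carrier M" "x' \<in> carrier M" "y \<in> carrier N"
    | x y y' where "z = frag_of (x, y \<oplus>\<^bsub>N\<^esub> y') - frag_of (x, y) - frag_of (x, y')"
      "x \<in> carrier M" "y \<in> carrier N" "y' \<in> carrier N"
    | a x y where "z = frag_of (a \<odot>\<^bsub>M\<^esub> x, y) - frag_of (x, a \<odot>\<^bsub>N\<^esub> y)"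
      "a \<in> carrier R" "x \<in> carrier M" "y \<in> carrier N"
  using assms unfolding tensor_generators_def by blast

lemma keys_tensor_generators:
  assumes "module R M" "module R N" and "z \<in> tensor_generators R M N"
  shows "Poly_Mapping.keys z \<subseteq> carrier M \<times> carrier N"
proof -
  interpret M: module R M by fact
  interpret N: module R N by fact
  show ?thesis
    using assms(3) by (cases rule: tensor_generators_cases) (simp_all add: keys_diff_subset)
qed

lemma subgroup_tensor_relations:
  assumes "module R M" "module R N"
  shows "subgroup (tensor_relations R M N) (free_Abelian_group (carrier M \<times> carrier N))"
  unfolding tensor_relations_eq_generate
  by (rule group.generate_is_subgroup[OF group_free_Abelian_group])
    (intro subsetI, simp add: keys_tensor_generators[OF assms])

context
  fixes R (structure) and M and N
  assumes M: "module R M" and N: "module R N"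
begin

abbreviation (input) T where "T \<equiv> tensor_relations R M N"
abbreviation (input) FG where "FG \<equiv> free_Abelian_group (carrier M \<times> carrier N)"

lemma tensor_relations_zero: "0 \<in> T"
  using subgroup.one_closed[OF subgroup_tensor_relations[OF M N]] by simp

lemma tensor_relations_add: "z \<in> T \<Longrightarrow> w \<in> T \<Longrightarrow> z + w \<in> T"
  using subgroup.m_closed[OF subgroup_tensor_relations[OF M N], of z w] by simp

lemma tensor_relations_minus: "z \<in> T \<Longrightarrow> - z \<in> T"
  using subgroup.m_inv_closed[OF subgroup_tensor_relations[OF M N], of z]
    subgroup.mem_carrier[OF subgroup_tensor_relations[OF M N], of z] by simp

lemma tensor_relations_diff: "z \<in> T \<Longrightarrow> w \<in> T \<Longrightarrow> z - w \<in> T"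
  using tensor_relations_add[OF _ tensor_relations_minus, of z w] by simp

lemma tensor_relations_I:
  assumes "x \<in> carrier M" "y \<in> carrier N"
  shows "x' \<in> carrier M \<Longrightarrow> frag_of (x \<oplus>\<^bsub>M\<^esub> x', y) - frag_of (x, y) - frag_of (x', y) \<in> T"
    and "y' \<in> carrier N \<Longrightarrow> frag_of (x, y \<oplus>\<^bsub>N\<^esub> y') - frag_of (x, y) - frag_of (x, y') \<in> T"
    and "a \<in> carrier R \<Longrightarrow> frag_of (a \<odot>\<^bsub>M\<^esub> x, y) - frag_of (x, a \<odot>\<^bsub>N\<^esub> y) \<in> T"
  using assms unfolding tensor_relations_eq_generate tensor_generators_def
  by (blast intro: generate.incl)+

lemma frag_of_zero_right: "x \<in> carrier M \<Longrightarrow> frag_of (x, \<zero>\<^bsub>N\<^esub>) \<in> T"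
proof -
  assume x: "x \<in> carrier M"
  interpret N: module R N by (rule N)
  show ?thesis
    using tensor_relations_minus[OF tensor_relations_I(2)[OF x N.zero_closed N.zero_closed]] by simp
qed

lemma frag_of_zero_left: "y \<in> carrier N \<Longrightarrow> frag_of (\<zero>\<^bsub>M\<^esub>, y) \<in> T"
proof -
  assume y: "y \<in> carrier N"
  interpret M: module R M by (rule M)
  show ?thesis
    using tensor_relations_minus[OF tensor_relations_I(1)[OF M.zero_closed y M.zero_closed]] by simp
qed

lemma coset_tensor_relations: "z \<in> T \<Longrightarrow> T #>\<^bsub>FG\<^esub> z = T"
  using subgroup.rcos_const[OF subgroup_tensor_relations[OF M N] group_free_Abelian_group] .

lemma mem_coset_self: "z \<in> T #>\<^bsub>FG\<^esub> z"
  using tensor_relations_zero by (auto simp: r_coset_def intro: bexI[of _ 0])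

end

text \<open>A homomorphism in the second factor respects the relations, so \<open>tensor_map\<close> is independent of
  representatives.\<close>

lemma frag_extend_tensor_relations:
  assumes M: "module R M" and N: "module R N" and N': "module R N'" and g: "g \<in> module_homs R N N'"
    and z: "z \<in> tensor_relations R M N"
  shows "frag_extend (\<lambda>(x, y). frag_of (x, g y)) z \<in> tensor_relations R M N'"
proof -
  let ?G = "frag_extend (\<lambda>(x, y). frag_of (x, g y))"
  note tI = tensor_relations_I[OF M N'] 
  interpret M: module R M by (rule M)
  interpret N: module R N by (rule N)
  have gc: "g y \<in> carrier N'" and ga: "y' \<in> carrier N \<Longrightarrow> g (y \<oplus>\<^bsub>N\<^esub> y') = g y \<oplus>\<^bsub>N'\<^esub> g y'"
    and gs: "a \<in> carrier R \<Longrightarrow> g (a \<odot>\<^bsub>N\<^esub> y) = a \<odot>\<^bsub>N'\<^esub> g y" if "y \<in> carrier N" for y y' a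
    using g that unfolding module_homs_def by auto
  have gens: "?G h \<in> tensor_relations R M N'" if "h \<in> tensor_generators R M N" for h
    using that by (cases rule: tensor_generators_cases) (simp_all add: frag_extend_diff gc ga gs tI)
  have "Poly_Mapping.keys z \<subseteq> carrier M \<times> carrier N \<and> ?G z \<in> tensor_relations R M N'"
    using z unfolding tensor_relations_eq_generate[of R M N]
  proof induction
    case one
    show ?case by (simp add: tensor_relations_zero[OF M N'])
  next
    case (incl h)
    then show ?case using keys_tensor_generators[OF M N] gens by blast
  next
    case (inv h)
    then show ?case
      using keys_tensor_generators[OF M N inv] gens tensor_relations_minus[OF M N']
      by (simp add: frag_extend_minus)
  next
    case (eng h1 h2)
    then show ?case
      using tensor_relations_add[OF M N'] keys_add[of h1 h2] by (auto simp: frag_extend_add)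
  qed
  then show ?thesis by simp
qed

text \<open>The universal property of the tensor product, in the form needed here: it detects that \<open>x \<otimes> y\<close> is
  not zero.\<close>

lemma biadditive_vanishes_on_tensor_relations:
  assumes M: "module R M" and N: "module R N" and A: "comm_group A"
    and \<beta>: "\<And>x y. x \<in> carrier M \<Longrightarrow> y \<in> carrier N \<Longrightarrow> \<beta> (x, y) \<in> carrier A"
    and add_left: "\<And>x x' y. x \<in> carrier M \<Longrightarrow> x' \<in> carrier M \<Longrightarrow> y \<in> carrier N \<Longrightarrow>
      \<beta> (x \<oplus>\<^bsub>M\<^esub> x', y) = \<beta> (x, y) \<otimes>\<^bsub>A\<^esub> \<beta> (x', y)"
    and add_right: "\<And>x y y'. x \<in> carrier M \<Longrightarrow> y \<in> carrier N \<Longrightarrow> y' \<in> carrier N \<Longrightarrow>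
      \<beta> (x, y \<oplus>\<^bsub>N\<^esub> y') = \<beta> (x, y) \<otimes>\<^bsub>A\<^esub> \<beta> (x, y')"
    and balanced: "\<And>a x y. a \<in> carrier R \<Longrightarrow> x \<in> carrier M \<Longrightarrow> y \<in> carrier N \<Longrightarrow>
      \<beta> (a \<odot>\<^bsub>M\<^esub> x, y) = \<beta> (x, a \<odot>\<^bsub>N\<^esub> y)"
    and xy: "x \<in> carrier M" "y \<in> carrier N" "frag_of (x, y) \<in> tensor_relations R M N"
  shows "\<beta> (x, y) = \<one>\<^bsub>A\<^esub>"
proof -
  interpret M: module R M by (rule M)
  interpret N: module R N by (rule N)
  interpret A: comm_group A by (rule A)
  let ?FG = "free_Abelian_group (carrier M \<times> carrier N)"
  have "\<beta> ` (carrier M \<times> carrier N) \<subseteq> carrier A" using \<beta> by auto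
  then obtain h where h: "h \<in> hom ?FG A"
    and h_of: "\<And>z. z \<in> carrier M \<times> carrier N \<Longrightarrow> h (frag_of z) = \<beta> z"
    using A.free_Abelian_group_universal by blast
  interpret h: group_hom ?FG A h
    using h by (simp add: group_hom_def group_hom_axioms_def)
  have h_diff: "h (u - v) = h u \<otimes>\<^bsub>A\<^esub> inv\<^bsub>A\<^esub> h v"
    if "Poly_Mapping.keys u \<subseteq> carrier M \<times> carrier N" "Poly_Mapping.keys v \<subseteq> carrier M \<times> carrier N" for u v
    using h.hom_mult[of u "- v"] h.hom_inv[of v] that by (simp add: keys_minus)
  have "h z = \<one>\<^bsub>A\<^esub>" if "z \<in> tensor_generators R M N" for z
    using that
  proof (cases rule: tensor_generators_cases)
    case (left x x' y)
    then have "h z = \<beta> (x, y) \<otimes>\<^bsub>A\<^esub> \<beta> (x', y) \<otimes>\<^bsub>A\<^esub> inv\<^bsub>A\<^esub> \<beta> (x, y) \<otimes>\<^bsub>A\<^esub> inv\<^bsub>A\<^esub> \<beta> (x', y)"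
      by (simp add: h_diff keys_diff_subset h_of add_left)
    then show ?thesis
      using \<beta>[of x y] \<beta>[of x' y] left by (simp add: A.m_assoc A.m_lcomm[of "\<beta> (x', y)"])
  next
    case (right x y y')
    then have "h z = \<beta> (x, y) \<otimes>\<^bsub>A\<^esub> \<beta> (x, y') \<otimes>\<^bsub>A\<^esub> inv\<^bsub>A\<^esub> \<beta> (x, y) \<otimes>\<^bsub>A\<^esub> inv\<^bsub>A\<^esub> \<beta> (x, y')"
      by (simp add: h_diff keys_diff_subset h_of add_right)
    then show ?thesis
      using \<beta>[of x y] \<beta>[of x y'] right by (simp add: A.m_assoc A.m_lcomm[of "\<beta> (x, y')"])
  next
    case (scalar a x y)
    then have "h z = \<beta> (x, a \<odot>\<^bsub>N\<^esub> y) \<otimes>\<^bsub>A\<^esub> inv\<^bsub>A\<^esub> \<beta> (x, a \<odot>\<^bsub>N\<^esub> y)"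
      by (simp add: h_diff h_of balanced)
    then show ?thesis using \<beta>[of x "a \<odot>\<^bsub>N\<^esub> y"] scalar by simp
  qed
  then have "tensor_generators R M N \<subseteq> kernel ?FG A h"
    by (intro subsetI) (simp add: kernel_def keys_tensor_generators[OF M N])
  then have "tensor_relations R M N \<subseteq> kernel ?FG A h"
    unfolding tensor_relations_eq_generate
    by (rule group.generate_subgroup_incl[OF group_free_Abelian_group _ h.subgroup_kernel])
  then have "h (frag_of (x, y)) = \<one>\<^bsub>A\<^esub>" using xy(3) by (auto simp: kernel_def)
  then show ?thesis using h_of xy by simp
qed

text \<open>Multiplication by \<open>s\<close> on the domain \<open>R/p\<close> is injective, so \<open>0 \<rightarrow> R/p \<rightarrow> R/p\<close> is exact and remains exact
  after tensoring with \<open>M\<close>. The element \<open>x \<otimes> 1\<close> goes to \<open>s x \<otimes> 1 = 0\<close>, hence it is zero in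
  \<open>M \<otimes> R/p = M/pM\<close>.\<close>

lemma flat_torsion_free_mod_prime:
  fixes R (structure)
  assumes flat: "flat R M" and p: "primeideal p R" and s: "s \<in> carrier R" "s \<notin> p"
    and x: "x \<in> carrier M"
  defines "pM \<equiv> generate (add_monoid M) {a \<odot>\<^bsub>M\<^esub> y | a y. a \<in> p \<and> y \<in> carrier M}"
  assumes sx: "s \<odot>\<^bsub>M\<^esub> x \<in> pM"
  shows "x \<in> pM"
proof -
  interpret p: primeideal p R by (rule p)
  have M: "module R M" using flat by (simp add: flat_def)
  interpret M: module R M by (rule M)
  have ap: "a \<in> carrier R" if "a \<in> p" for a using that by (rule p.Icarr)
  have pM: "subgroup pM (add_monoid M)"
    unfolding pM_def by (rule M.add.generate_is_subgroup) (use ap in auto)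
  have pMI: "a \<odot>\<^bsub>M\<^esub> y \<in> pM" if "a \<in> p" "y \<in> carrier M" for a y
    unfolding pM_def using that by (intro generate.incl) blast
  from p.ex_quotient_module[OF p.is_cring] obtain N :: "('a, (nat \<Rightarrow> 'a) set) module" and \<phi>
    where N: "module R N" and carrN: "carrier N = \<phi> ` carrier R"
    and \<phi>_eq: "\<forall>a \<in> carrier R. \<forall>b \<in> carrier R. \<phi> a = \<phi> b \<longleftrightarrow> a \<ominus> b \<in> p"
    and \<phi>_add: "\<forall>a \<in> carrier R. \<forall>b \<in> carrier R. \<phi> (a \<oplus> b) = \<phi> a \<oplus>\<^bsub>N\<^esub> \<phi> b"
    and \<phi>_smult: "\<forall>a \<in> carrier R. \<forall>b \<in> carrier R. \<phi> (a \<otimes> b) = a \<odot>\<^bsub>N\<^esub> \<phi> b"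
    and \<phi>_zero: "\<phi> \<zero> = \<zero>\<^bsub>N\<^esub>" by (elim exE conjE)
  interpret N: module R N by (rule N)
  have \<phi>c: "\<phi> a \<in> carrier N" if "a \<in> carrier R" for a using that carrN by blast
  have \<phi>0: "\<phi> a = \<zero>\<^bsub>N\<^esub> \<longleftrightarrow> a \<in> p" if "a \<in> carrier R" for a
    using bspec[OF bspec[OF \<phi>_eq that] p.zero_closed] that unfolding \<phi>_zero by (simp add: a_minus_def)
  let ?T = "tensor_relations R M N"
  let ?FG = "free_Abelian_group (carrier M \<times> carrier N)"
  note T_zero = tensor_relations_zero[OF M N] and T_add = tensor_relations_add[OF M N]
    and T_diff = tensor_relations_diff[OF M N] and T_I = tensor_relations_I[OF M N]
    and T_coset = coset_tensor_relations[OF M N]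
  define N0 where "N0 = N\<lparr>carrier := {\<zero>\<^bsub>N\<^esub>}\<rparr>"
  have N0: "module R N0"
  proof (rule moduleI)
    show "abelian_group N0"
      by (rule abelian_groupI) (auto simp: N0_def)
  qed (auto simp: N0_def p.is_cring)
  let ?f = "\<lambda>y. y" and ?g = "\<lambda>y. s \<odot>\<^bsub>N\<^esub> y"
  have f: "?f \<in> module_homs R N0 N" by (auto simp: module_homs_def N0_def)
  have g: "?g \<in> module_homs R N N"
    using s(1) by (auto simp: module_homs_def N.smult_r_distr N.smult_assoc1[symmetric] p.m_comm)
  have "?f ` carrier N0 = {y \<in> carrier N. ?g y = \<zero>\<^bsub>N\<^esub>}"
  proof (intro equalityI subsetI)
    fix y assume "y \<in> {y \<in> carrier N. ?g y = \<zero>\<^bsub>N\<^esub>}"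
    then obtain b where b: "y = \<phi> b" "b \<in> carrier R" "s \<odot>\<^bsub>N\<^esub> \<phi> b = \<zero>\<^bsub>N\<^esub>" unfolding carrN by blast
    then have "s \<otimes> b \<in> p" using \<phi>0[of "s \<otimes> b"] \<phi>_smult s(1) by simp
    then have "b \<in> p" using p.I_prime[OF s(1) b(2)] s(2) by blast
    then show "y \<in> ?f ` carrier N0" using b \<phi>0[of b] by (simp add: N0_def)
  qed (auto simp: N0_def s(1))
  then have exact: "tensor_map R M N ?f ` carrier (tensor R M N0) =
      kernel (tensor R M N) (tensor R M N) (tensor_map R M N ?g)"
    using flat N N0 f g unfolding flat_def by blast

  \<comment> \<open>The class of \<open>x \<otimes> 1\<close> is killed by \<open>s\<close>.\<close>
  let ?U = "{y \<in> carrier M. frag_of (y, \<phi> \<one>) \<in> ?T}"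
  have U: "subgroup ?U (add_monoid M)"
  proof (rule M.add.subgroupI)
    show "?U \<subseteq> carrier M" by blast
    show "?U \<noteq> {}" using frag_of_zero_left[OF M N \<phi>c[OF p.one_closed]] M.M.zero_closed by blast
    have sum: "y \<oplus>\<^bsub>M\<^esub> z \<in> ?U" if y: "y \<in> ?U" and z: "z \<in> ?U" for y z
    proof -
      have "frag_of (y \<oplus>\<^bsub>M\<^esub> z, \<phi> \<one>) - frag_of (y, \<phi> \<one>) - frag_of (z, \<phi> \<one>) \<in> ?T"
        using y z by (intro T_I(1) \<phi>c p.one_closed) auto
      from T_add[OF T_add[OF this, of "frag_of (z, \<phi> \<one>)"], of "frag_of (y, \<phi> \<one>)"]
      show ?thesis using y z by simp
    qed
    fix y assume y: "y \<in> ?U"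
    have diff: "frag_of (\<ominus>\<^bsub>M\<^esub> y \<oplus>\<^bsub>M\<^esub> y, \<phi> \<one>) - frag_of (\<ominus>\<^bsub>M\<^esub> y, \<phi> \<one>) - frag_of (y, \<phi> \<one>) \<in> ?T"
      using y by (intro T_I(1) \<phi>c p.one_closed) auto
    have "frag_of (\<ominus>\<^bsub>M\<^esub> y \<oplus>\<^bsub>M\<^esub> y, \<phi> \<one>) \<in> ?T"
      using y frag_of_zero_left[OF M N \<phi>c[OF p.one_closed]] by (simp add: M.M.l_neg)
    from T_diff[OF T_diff[OF this diff], of "frag_of (y, \<phi> \<one>)"]
    have "frag_of (\<ominus>\<^bsub>M\<^esub> y, \<phi> \<one>) \<in> ?T" using y by simp
    then show "\<ominus>\<^bsub>M\<^esub> y \<in> ?U" using y by simp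
    fix z assume "z \<in> ?U"
    with y show "y \<oplus>\<^bsub>M\<^esub> z \<in> ?U" by (rule sum)
  qed
  have "pM \<subseteq> ?U"
    unfolding pM_def
  proof (rule M.add.generate_subgroup_incl[OF _ U], clarify, intro conjI)
    fix a y assume a: "a \<in> p" and y: "y \<in> carrier M"
    show "a \<odot>\<^bsub>M\<^esub> y \<in> carrier M" using ap[OF a] y by simp
    have "a \<odot>\<^bsub>N\<^esub> \<phi> \<one> = \<zero>\<^bsub>N\<^esub>"
      using \<phi>_smult \<phi>0[of a] ap[OF a] a by (metis p.one_closed p.r_one)
    then have "frag_of (a \<odot>\<^bsub>M\<^esub> y, \<phi> \<one>) - frag_of (y, \<zero>\<^bsub>N\<^esub>) \<in> ?T"
      using T_I(3)[OF y \<phi>c[OF p.one_closed] ap[OF a]] by simp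
    from T_add[OF this frag_of_zero_right[OF M N y]]
    show "frag_of (a \<odot>\<^bsub>M\<^esub> y, \<phi> \<one>) \<in> ?T" by simp
  qed
  then have "frag_of (s \<odot>\<^bsub>M\<^esub> x, \<phi> \<one>) \<in> ?T" using sx by blast
  from T_diff[OF this T_I(3)[OF x \<phi>c[OF p.one_closed] s(1)]]
  have killed: "frag_of (x, s \<odot>\<^bsub>N\<^esub> \<phi> \<one>) \<in> ?T" by simp

  let ?\<xi> = "?T #>\<^bsub>?FG\<^esub> frag_of (x, \<phi> \<one>)"
  have ne: "?\<xi> \<noteq> {}" using mem_coset_self[OF M N] by blast
  have \<xi>: "?\<xi> \<in> carrier (tensor R M N)"
    using x \<phi>c by (auto simp: tensor_def FactGroup_def RCOSETS_def)
  have "?T #>\<^bsub>?FG\<^esub> frag_extend (\<lambda>(x, y). frag_of (x, ?g y)) z = ?T" if "z \<in> ?\<xi>" for z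
  proof (rule T_coset)
    from that obtain t where "t \<in> ?T" "z = t + frag_of (x, \<phi> \<one>)" unfolding r_coset_def by auto
    then show "frag_extend (\<lambda>(x, y). frag_of (x, ?g y)) z \<in> ?T"
      using T_add[OF frag_extend_tensor_relations[OF M N N g] killed] by (simp add: frag_extend_add)
  qed
  then have "tensor_map R M N ?g ?\<xi> = ?T"
    unfolding tensor_map_def using ne by simp
  then have "?\<xi> \<in> kernel (tensor R M N) (tensor R M N) (tensor_map R M N ?g)"
    using \<xi> by (simp add: kernel_def tensor_def FactGroup_def)
  then obtain \<eta> where \<eta>: "\<eta> \<in> carrier (tensor R M N0)" "?\<xi> = tensor_map R M N ?f \<eta>"
    unfolding exact[symmetric] by blast

  \<comment> \<open>By exactness \<open>x \<otimes> 1\<close> comes from \<open>M \<otimes> 0\<close>, whose image is zero.\<close>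
  have vanish: "frag_extend (\<lambda>(x, y). frag_of (x, ?f y)) z \<in> ?T"
    if "Poly_Mapping.keys z \<subseteq> carrier M \<times> carrier N0" for z
    using that
  proof (rule free_Abelian_group_induct)
    fix w assume "w \<in> carrier M \<times> carrier N0"
    then obtain y where "w = (y, \<zero>\<^bsub>N\<^esub>)" "y \<in> carrier M" by (auto simp: N0_def)
    then show "frag_extend (\<lambda>(x, y). frag_of (x, ?f y)) (frag_of w) \<in> ?T"
      using frag_of_zero_right[OF M N] by simp
  qed (simp_all add: T_zero T_diff frag_extend_diff)
  obtain z where z: "Poly_Mapping.keys z \<subseteq> carrier M \<times> carrier N0"
    "\<eta> = tensor_relations R M N0 #>\<^bsub>free_Abelian_group (carrier M \<times> carrier N0)\<^esub> z"
    using \<eta>(1) by (auto simp: tensor_def FactGroup_def RCOSETS_def)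
  have keys: "Poly_Mapping.keys w \<subseteq> carrier M \<times> carrier N0" if "w \<in> \<eta>" for w
  proof -
    from that obtain t where "t \<in> tensor_relations R M N0" "w = t + z" unfolding z(2) r_coset_def by auto
    then show ?thesis
      using z(1) subgroup.mem_carrier[OF subgroup_tensor_relations[OF M N0], of t] keys_add[of t z] by auto
  qed
  have "\<eta> \<noteq> {}" using mem_coset_self[OF M N0] unfolding z(2) by blast
  moreover have "?T #>\<^bsub>?FG\<^esub> frag_extend (\<lambda>(x, y). frag_of (x, ?f y)) w = ?T" if "w \<in> \<eta>" for w
    by (rule T_coset[OF vanish[OF keys[OF that]]])
  ultimately have "?\<xi> = ?T" unfolding \<eta>(2) tensor_map_def by simp
  then have zero: "frag_of (x, \<phi> \<one>) \<in> ?T" using mem_coset_self[OF M N, of "frag_of (x, \<phi> \<one>)"] by simp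

  \<comment> \<open>The product \<open>M \<times> R/p \<rightarrow> M/pM\<close> sends \<open>(x, 1)\<close> to the class of \<open>x\<close>.\<close>
  let ?A = "add_monoid M Mod pM" and ?q = "\<lambda>y. pM #>\<^bsub>add_monoid M\<^esub> y"
  have AM: "comm_group (add_monoid M)" by (rule M.a_comm_group)
  then have AMg: "group (add_monoid M)" by (simp add: comm_group_def)
  have normal: "pM \<lhd> add_monoid M" by (rule comm_group.subgroup_imp_normal[OF AM pM])
  have A: "comm_group ?A" by (rule comm_group.abelian_FactGroup[OF AM pM])
  have q: "?q \<in> hom (add_monoid M) ?A" by (rule normal.r_coset_hom_Mod[OF normal])
  have q_add: "?q (y \<oplus>\<^bsub>M\<^esub> z) = ?q y \<otimes>\<^bsub>?A\<^esub> ?q z" if "y \<in> carrier M" "z \<in> carrier M" for y z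
    using hom_mult[OF q, of y z] that by simp
  have q_closed: "?q y \<in> carrier ?A" if "y \<in> carrier M" for y
    using hom_in_carrier[OF q, of y] that by simp
  have q_one: "?q y = \<one>\<^bsub>?A\<^esub> \<longleftrightarrow> y \<in> pM" if "y \<in> carrier M" for y
    using that group.coset_join1[OF AMg _ _ pM, of y] group.coset_join2[OF AMg _ pM, of y]
      subgroup.subset[OF pM] by (auto simp: FactGroup_def)
  have q_eq: "?q (a \<odot>\<^bsub>M\<^esub> y) = ?q (b \<odot>\<^bsub>M\<^esub> y)"
    if ab: "a \<in> carrier R" "b \<in> carrier R" "a \<ominus> b \<in> p" and y: "y \<in> carrier M" for a b y
  proof -
    interpret A: comm_group ?A by (rule A)
    have "a = (a \<ominus> b) \<oplus> b" using ab by (simp add: a_minus_def p.a_assoc p.l_neg)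
    then have "?q (a \<odot>\<^bsub>M\<^esub> y) = ?q ((a \<ominus> b) \<odot>\<^bsub>M\<^esub> y \<oplus>\<^bsub>M\<^esub> b \<odot>\<^bsub>M\<^esub> y)"
      using ab y M.smult_l_distr[of "a \<ominus> b" b y] by simp
    also have "\<dots> = ?q ((a \<ominus> b) \<odot>\<^bsub>M\<^esub> y) \<otimes>\<^bsub>?A\<^esub> ?q (b \<odot>\<^bsub>M\<^esub> y)"
      using ab y by (intro q_add) simp_all
    also have "?q ((a \<ominus> b) \<odot>\<^bsub>M\<^esub> y) = \<one>\<^bsub>?A\<^esub>"
      using q_one[of "(a \<ominus> b) \<odot>\<^bsub>M\<^esub> y"] pMI[OF ab(3) y] ab y by simp
    also have "\<one>\<^bsub>?A\<^esub> \<otimes>\<^bsub>?A\<^esub> ?q (b \<odot>\<^bsub>M\<^esub> y) = ?q (b \<odot>\<^bsub>M\<^esub> y)"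
      using ab y by (intro A.l_one q_closed) simp
    finally show ?thesis .
  qed
  define rep where "rep Y = (SOME a. a \<in> carrier R \<and> \<phi> a = Y)" for Y
  have rep: "rep (\<phi> a) \<in> carrier R" "rep (\<phi> a) \<ominus> a \<in> p" if a: "a \<in> carrier R" for a
  proof -
    have "rep (\<phi> a) \<in> carrier R \<and> \<phi> (rep (\<phi> a)) = \<phi> a"
      using someI[of "\<lambda>b. b \<in> carrier R \<and> \<phi> b = \<phi> a" a] a unfolding rep_def by auto
    then show "rep (\<phi> a) \<in> carrier R" "rep (\<phi> a) \<ominus> a \<in> p" using \<phi>_eq a by auto
  qed
  define \<beta> where "\<beta> = (\<lambda>(y, Y). ?q (rep Y \<odot>\<^bsub>M\<^esub> y))"
  have \<beta>: "\<beta> (y, \<phi> a) = ?q (a \<odot>\<^bsub>M\<^esub> y)" if "a \<in> carrier R" "y \<in> carrier M" for a y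
    using q_eq[OF rep(1)[OF that(1)] that(1) rep(2)[OF that(1)] that(2)] by (simp add: \<beta>_def)
  have "\<beta> (x, \<phi> \<one>) = \<one>\<^bsub>?A\<^esub>"
  proof (rule biadditive_vanishes_on_tensor_relations[OF M N A _ _ _ _ x \<phi>c[OF p.one_closed] zero])
    fix y Y assume y: "y \<in> carrier M" and "Y \<in> carrier N"
    then obtain b where b: "Y = \<phi> b" "b \<in> carrier R" unfolding carrN by blast
    show "\<beta> (y, Y) \<in> carrier ?A" unfolding b(1) \<beta>[OF b(2) y] using q_closed b(2) y by simp
    show "\<beta> (y \<oplus>\<^bsub>M\<^esub> y', Y) = \<beta> (y, Y) \<otimes>\<^bsub>?A\<^esub> \<beta> (y', Y)" if y': "y' \<in> carrier M" for y'
      unfolding b(1) using b(2) y y' by (simp add: \<beta> M.smult_r_distr q_add)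
    show "\<beta> (y, Y \<oplus>\<^bsub>N\<^esub> Y') = \<beta> (y, Y) \<otimes>\<^bsub>?A\<^esub> \<beta> (y, Y')" if "Y' \<in> carrier N" for Y'
    proof -
      from that obtain c where c: "Y' = \<phi> c" "c \<in> carrier R" unfolding carrN by blast
      have "Y \<oplus>\<^bsub>N\<^esub> Y' = \<phi> (b \<oplus> c)" using \<phi>_add b c by simp
      then show ?thesis using b c y by (simp add: \<beta> M.smult_l_distr q_add)
    qed
    show "\<beta> (a \<odot>\<^bsub>M\<^esub> y, Y) = \<beta> (y, a \<odot>\<^bsub>N\<^esub> Y)" if a: "a \<in> carrier R" for a
    proof -
      have "a \<odot>\<^bsub>N\<^esub> Y = \<phi> (b \<otimes> a)" using \<phi>_smult a b by (simp add: p.m_comm[of b a])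
      then show ?thesis using a b y by (simp add: \<beta> M.smult_assoc1)
    qed
  qed
  then show ?thesis using \<beta>[OF p.one_closed x] q_one[OF x] x by simp
qed

section \<open>Flat quotients of polynomial rings\<close>

text \<open>For \<open>M = R[x]/J\<close>, the submodule \<open>pM\<close> consists of the classes of polynomials with coefficients in
  \<open>p\<close>. So absence of torsion allows to cancel \<open>s\<close> in \<open>s g \<in> J + pR[x]\<close>.\<close>

lemma (in cring) mem_ideal_plus_prime_if_flat:
  assumes J: "ideal J (mpoly_ring R V)" and flat: "flat R (mpoly_quotient R V J)"
    and p: "primeideal p R" and s: "s \<in> carrier R" "s \<notin> p"
    and g: "is_mpoly V g" and j: "j \<in> J" and sg: "\<And>m. s \<otimes> g m \<ominus> j m \<in> p"
  shows "\<exists>j' \<in> J. \<forall>m. g m \<ominus> j' m \<in> p"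
proof -
  let ?P = "mpoly_ring R V" and ?M = "mpoly_quotient R V J"
  let ?\<pi> = "\<lambda>f. J +>\<^bsub>mpoly_ring R V\<^esub> f"
  interpret P: cring ?P by (rule cring_mpoly_ring)
  interpret J: ideal J ?P by (rule J)
  interpret p: primeideal p R by (rule p)
  have M: "module R ?M" using flat by (simp add: flat_def)
  interpret M: module R ?M by (rule M)
  have pz: "\<zero> \<in> p" by (rule p.I_zero)
  have \<pi>: "?\<pi> \<in> ring_hom ?P (?P Quot J)" by (rule J.rcos_ring_hom)
  have carrM: "carrier ?M = ?\<pi> ` carrier ?P"
    by (auto simp: mpoly_quotient_def restrict_scalars_def FactRing_def A_RCOSETS_def')
  have addM: "?\<pi> f \<oplus>\<^bsub>?M\<^esub> ?\<pi> h = ?\<pi> (\<lambda>m. f m \<oplus> h m)" if "is_mpoly V f" "is_mpoly V h" for f h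
    using ring_hom_add[OF \<pi>, of f h] that
    by (simp add: mpoly_quotient_def restrict_scalars_def add_mpoly_ring mem_mpoly_ring_iff)
  have smultM: "a \<odot>\<^bsub>?M\<^esub> ?\<pi> f = ?\<pi> (\<lambda>m. a \<otimes> f m)" if a: "a \<in> carrier R" and f: "is_mpoly V f" for a f
  proof -
    have "a \<odot>\<^bsub>?M\<^esub> ?\<pi> f = ?\<pi> (mpoly_term a {#}) \<otimes>\<^bsub>?P Quot J\<^esub> ?\<pi> f"
      by (simp add: mpoly_quotient_def restrict_scalars_def indexed_const_eq_term)
    also have "\<dots> = ?\<pi> (mpoly_term a {#} \<otimes>\<^bsub>?P\<^esub> f)"
      using ring_hom_mult[OF \<pi>, of "mpoly_term a {#}" f] a f by (simp add: mem_mpoly_ring_iff is_mpoly_term)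
    finally show ?thesis by (simp add: term_mult_mpoly[OF a f])
  qed
  have zeroM: "?\<pi> (\<lambda>_. \<zero>) = \<zero>\<^bsub>?M\<^esub>"
    using P.a_rcos_zero[OF J zero_mem_mpoly_ideal[OF J]]
    by (simp add: mpoly_quotient_def restrict_scalars_def FactRing_def)
  have \<pi>M: "?\<pi> f \<in> carrier ?M" if "is_mpoly V f" for f
    using that unfolding carrM by (simp add: mem_mpoly_ring_iff)
  have \<pi>_eq: "?\<pi> f = ?\<pi> h \<longleftrightarrow> (\<lambda>m. f m \<ominus> h m) \<in> J" if "is_mpoly V f" "is_mpoly V h" for f h
    using P.quotient_eq_iff_same_a_r_cos[OF J, of f h] that by (simp add: mem_mpoly_ring_iff minus_mpoly_ring)
  let ?pM = "generate (add_monoid ?M) {a \<odot>\<^bsub>?M\<^esub> y | a y. a \<in> p \<and> y \<in> carrier ?M}"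
  let ?pP = "{f. is_mpoly V f \<and> (\<forall>m. f m \<in> p)}"
  have "?\<pi> f \<in> ?pM" if f: "is_mpoly V f" "\<And>m. f m \<in> p" for f
    using f(1) f(2) pz
  proof (induction rule: is_mpoly_coeff_induct)
    case zero
    show ?case using generate.one[of "add_monoid ?M"] by (simp add: zeroM)
  next
    case (add_monom c a g)
    have t: "is_mpoly V (mpoly_term \<one> a)" by (rule is_mpoly_term[OF one_closed add_monom(3)])
    have "c \<odot>\<^bsub>?M\<^esub> ?\<pi> (mpoly_term \<one> a) = ?\<pi> (mpoly_term c a)"
    proof -
      have "(\<lambda>m. c \<otimes> mpoly_term \<one> a m) = mpoly_term c a"
        using add_monom(1) by (auto simp: mpoly_term_def)
      then show ?thesis using smultM[OF add_monom(1) t] by simp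
    qed
    moreover have "c \<odot>\<^bsub>?M\<^esub> ?\<pi> (mpoly_term \<one> a) \<in> ?pM"
      using add_monom(2) \<pi>M[OF t] by (intro generate.incl) blast
    ultimately have "?\<pi> (mpoly_term c a) \<oplus>\<^bsub>?M\<^esub> ?\<pi> g \<in> ?pM"
      using generate.eng[OF _ add_monom.IH, of "?\<pi> (mpoly_term c a)"] by simp
    then show ?case using addM[OF is_mpoly_term[OF add_monom(1,3)] add_monom(4)] by simp
  qed
  then have pP_pM: "?\<pi> f \<in> ?pM" if "f \<in> ?pP" for f using that by simp

  have "subgroup (?\<pi> ` ?pP) (add_monoid ?M)"
  proof (rule M.add.subgroupI)
    show "?\<pi> ` ?pP \<subseteq> carrier ?M" using \<pi>M by auto
    show "?\<pi> ` ?pP \<noteq> {}" using is_mpoly_zero[of V] pz by auto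
    fix y assume "y \<in> ?\<pi> ` ?pP"
    then obtain f where f: "y = ?\<pi> f" "is_mpoly V f" "\<And>m. f m \<in> p" by blast
    note fc = is_mpoly_coeff[OF f(2)]
    have nf: "is_mpoly V (\<lambda>m. \<ominus> \<one> \<otimes> f m)" by (intro is_mpoly_smult f(2)) simp
    have "?\<pi> (\<lambda>m. \<ominus> \<one> \<otimes> f m) \<oplus>\<^bsub>?M\<^esub> y = \<zero>\<^bsub>?M\<^esub>"
      using addM[OF nf f(2)] fc unfolding f(1) by (simp add: zeroM[symmetric] l_minus l_neg)
    then have "\<ominus>\<^bsub>?M\<^esub> y = ?\<pi> (\<lambda>m. \<ominus> \<one> \<otimes> f m)"
      using \<pi>M[OF nf] \<pi>M[OF f(2)] unfolding f(1) by (intro M.minus_equality)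
    moreover have "\<ominus> \<one> \<otimes> f m \<in> p" for m by (rule p.I_l_closed[OF f(3)]) simp
    ultimately show "\<ominus>\<^bsub>?M\<^esub> y \<in> ?\<pi> ` ?pP" using nf by simp
    fix z assume "z \<in> ?\<pi> ` ?pP"
    then obtain h where h: "z = ?\<pi> h" "is_mpoly V h" "\<And>m. h m \<in> p" by blast
    have "y \<oplus>\<^bsub>?M\<^esub> z = ?\<pi> (\<lambda>m. f m \<oplus> h m)" unfolding f(1) h(1) by (rule addM[OF f(2) h(2)])
    moreover have "f m \<oplus> h m \<in> p" for m
      by (rule p.I_add[OF f(3) h(3)])
    ultimately show "y \<oplus>\<^bsub>?M\<^esub> z \<in> ?\<pi> ` ?pP" using is_mpoly_add[OF f(2) h(2)] by simp
  qed
  then have "?pM \<subseteq> ?\<pi> ` ?pP"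
  proof (rule M.add.generate_subgroup_incl[rotated], clarify)
    fix a y assume a: "a \<in> p" and "y \<in> carrier ?M"
    then obtain f where f: "y = ?\<pi> f" "is_mpoly V f" unfolding carrM by (auto simp: mem_mpoly_ring_iff)
    have ac: "a \<in> carrier R" using a by (rule p.Icarr)
    have "a \<otimes> f m \<in> p" for m using p.I_r_closed[OF a is_mpoly_coeff[OF f(2)]] .
    then show "a \<odot>\<^bsub>?M\<^esub> y \<in> ?\<pi> ` ?pP"
      unfolding f(1) smultM[OF ac f(2)] using is_mpoly_smult[OF ac f(2)] by simp
  qed

  note gc = is_mpoly_coeff[OF g] and jc = is_mpoly_coeff[OF mem_mpoly_ideal[OF J j]]
  have sgP: "is_mpoly V (\<lambda>m. s \<otimes> g m)" by (rule is_mpoly_smult[OF s(1) g])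
  have h: "(\<lambda>m. s \<otimes> g m \<ominus> j m) \<in> ?pP" using is_mpoly_minus[OF sgP mem_mpoly_ideal[OF J j]] sg by simp
  have "s \<otimes> g m \<ominus> (s \<otimes> g m \<ominus> j m) = j m" for m
    using s(1) gc[of m] jc[of m] by algebra
  then have "?\<pi> (\<lambda>m. s \<otimes> g m) = ?\<pi> (\<lambda>m. s \<otimes> g m \<ominus> j m)"
    using h j by (subst \<pi>_eq[OF sgP]) auto
  then have "s \<odot>\<^bsub>?M\<^esub> ?\<pi> g \<in> ?pM" using pP_pM[OF h] smultM[OF s(1) g] by simp
  then have "?\<pi> g \<in> ?pM" by (rule flat_torsion_free_mod_prime[OF flat p s \<pi>M[OF g]])
  then obtain f where f: "?\<pi> g = ?\<pi> f" "is_mpoly V f" "\<And>m. f m \<in> p"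
    using \<open>?pM \<subseteq> ?\<pi> ` ?pP\<close> by blast
  have "(\<lambda>m. g m \<ominus> f m) \<in> J" using f(1) \<pi>_eq[OF g f(2)] by simp
  moreover have "g m \<ominus> (g m \<ominus> f m) = f m" for m
    using gc[of m] is_mpoly_coeff[OF f(2), of m] by algebra
  ultimately show ?thesis using f(3) by (intro bexI[of _ "\<lambda>m. g m \<ominus> f m"]) simp_all
qed

section \<open>Homogenization in a fixed degree\<close>

text \<open>Homogenization in a prescribed degree is additive, which \<open>homogenize\<close> is not because the degree of
  a sum may drop.\<close>

definition (in ring) homogenize_in :: "nat \<Rightarrow> (nat multiset \<Rightarrow> 'a) \<Rightarrow> nat multiset \<Rightarrow> 'a" where
  "homogenize_in d f = (\<lambda>m. if size m = d then f (filter_mset (\<lambda>i. i \<noteq> 0) m) else \<zero>)"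

text \<open>The component of degree \<open>d\<close> with \<open>x\<^sub>0\<close> set to 1. Within one degree, different monomials remain
  different under this substitution, so no coefficients have to be summed.\<close>

definition (in ring) dehomogenize_in :: "nat \<Rightarrow> (nat multiset \<Rightarrow> 'a) \<Rightarrow> nat multiset \<Rightarrow> 'a" where
  "dehomogenize_in d g =
     (\<lambda>m. if 0 \<notin># m \<and> size m \<le> d then g (m + replicate_mset (d - size m) 0) else \<zero>)"

lemma nonzero_mset_split: "filter_mset (\<lambda>i. i \<noteq> (0::nat)) m + replicate_mset (count m 0) 0 = m"
  by (rule multiset_eqI) auto

lemma size_nonzero_mset: "size (filter_mset (\<lambda>i. i \<noteq> (0::nat)) m) + count m 0 = size m"
  using arg_cong[OF nonzero_mset_split[of m], of size] by simp

context ring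
begin

lemma is_mpoly_vanishes_above_degree:
  assumes f: "is_mpoly V f" and "f m \<noteq> \<zero>"
  shows "size m \<le> total_degree R f"
proof -
  have "finite (insert 0 (size ` {m. f m \<noteq> \<zero>}))" using f by (simp add: is_mpoly_def)
  then show ?thesis unfolding total_degree_def using assms(2) by (intro Max_ge) auto
qed

lemma is_mpoly_homogenize_in:
  assumes f: "is_mpoly {1..n} f"
  shows "is_mpoly {0..n} (homogenize_in d f)"
proof -
  have supp: "size m = d" "set_mset m \<subseteq> {0..n}" if "homogenize_in d f m \<noteq> \<zero>" for m
  proof -
    show "size m = d" using that by (auto simp: homogenize_in_def split: if_splits)
    have "set_mset (filter_mset (\<lambda>i. i \<noteq> 0) m) \<subseteq> {1..n}"
      using that by (intro is_mpoly_support[OF f]) (auto simp: homogenize_in_def split: if_splits)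
    then show "set_mset m \<subseteq> {0..n}" by (force simp: subset_iff)
  qed
  then have "{m. homogenize_in d f m \<noteq> \<zero>} \<subseteq> multisets_of_size {0..n} d"
    by (auto simp: multisets_of_size_def)
  then have fin: "finite {m. homogenize_in d f m \<noteq> \<zero>}" by (rule finite_subset) auto
  have "homogenize_in d f m \<in> carrier R" for m
    by (simp add: homogenize_in_def is_mpoly_coeff[OF f])
  then show ?thesis
    unfolding is_mpoly_def by (intro conjI allI impI fin supp(2))
qed

lemma homogenize_eq_homogenize_in: "homogenize R f = homogenize_in (total_degree R f) f"
  by (simp add: homogenize_def homogenize_in_def)

lemma homogenize_in_eq_power_mult:
  assumes f: "is_mpoly {1..n} f" and d: "total_degree R f \<le> d"
  shows "homogenize_in d f =
    mpoly_term \<one> (replicate_mset (d - total_degree R f) 0) \<otimes>\<^bsub>mpoly_ring R {0..n}\<^esub> homogenize R f"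
proof
  fix m :: "nat multiset"
  let ?k = "d - total_degree R f"
  let ?r = "replicate_mset ?k (0::nat)"
  note fc = is_mpoly_coeff[OF f]
  have hf: "is_mpoly {0..n} (homogenize R f)"
    unfolding homogenize_eq_homogenize_in by (rule is_mpoly_homogenize_in[OF f])
  have eq: "(mpoly_term \<one> ?r \<otimes>\<^bsub>mpoly_ring R {0..n}\<^esub> homogenize R f) m =
      (if ?r \<subseteq># m then homogenize R f (m - ?r) else \<zero>)"
    using is_mpoly_coeff[OF hf] by (simp add: term_mult_mpoly[OF one_closed hf])
  show "homogenize_in d f m = (mpoly_term \<one> ?r \<otimes>\<^bsub>mpoly_ring R {0..n}\<^esub> homogenize R f) m"
  proof (cases "?r \<subseteq># m")
    case True
    then obtain m' where m': "m = ?r + m'" by (metis subset_mset.le_iff_add)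
    have sz: "size m = d \<longleftrightarrow> size m' = total_degree R f" using d unfolding m' by auto
    have fil: "filter_mset (\<lambda>i. i \<noteq> 0) m = filter_mset (\<lambda>i. i \<noteq> 0) m'"
      unfolding m' by (rule multiset_eqI) auto
    have diff: "m - ?r = m'" unfolding m' by simp
    show ?thesis
      unfolding eq if_P[OF True] unfolding homogenize_in_def homogenize_def diff sz fil ..
  next
    case False
    have "f (filter_mset (\<lambda>i. i \<noteq> 0) m) = \<zero>" if "size m = d"
    proof (rule ccontr)
      assume "f (filter_mset (\<lambda>i. i \<noteq> 0) m) \<noteq> \<zero>"
      then have "size (filter_mset (\<lambda>i. i \<noteq> 0) m) \<le> total_degree R f"
        by (rule is_mpoly_vanishes_above_degree[OF f])
      then have "?k \<le> count m 0" using size_nonzero_mset[of m] that by simp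
      then show False using False by (simp add: count_le_replicate_mset_subset_eq)
    qed
    then show ?thesis unfolding eq if_not_P[OF False] by (simp add: homogenize_in_def)
  qed
qed

lemma dehomogenize_in_homogenize_in:
  assumes f: "is_mpoly {1..n} f" and d: "total_degree R f \<le> d"
  shows "dehomogenize_in d (homogenize_in d f) = f"
proof
  fix m
  show "dehomogenize_in d (homogenize_in d f) m = f m"
  proof (cases "0 \<notin># m \<and> size m \<le> d")
    case True
    then have fil: "filter_mset (\<lambda>i. i \<noteq> 0) (m + replicate_mset (d - size m) 0) = m"
      by (intro multiset_eqI) (auto simp: not_in_iff)
    show ?thesis
      unfolding dehomogenize_in_def homogenize_in_def fil using True by simp
  next
    case False
    have "f m = \<zero>"
    proof (rule ccontr)
      assume nz: "f m \<noteq> \<zero>"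
      then have "set_mset m \<subseteq> {1..n}" using f by (simp add: is_mpoly_def)
      then show False using False d is_mpoly_vanishes_above_degree[OF f nz] by force
    qed
    then show ?thesis using False by (auto simp: dehomogenize_in_def)
  qed
qed

lemma dehomogenize_in_homogenize_in_other:
  assumes "d \<noteq> e"
  shows "dehomogenize_in d (homogenize_in e f) = (\<lambda>_. \<zero>)"
  using assms by (auto simp: dehomogenize_in_def homogenize_in_def fun_eq_iff)

lemma dehomogenize_in_add:
  "dehomogenize_in d (\<lambda>m. f m \<oplus> g m) = (\<lambda>m. dehomogenize_in d f m \<oplus> dehomogenize_in d g m)"
  by (auto simp: dehomogenize_in_def fun_eq_iff)

lemma dehomogenize_in_zero: "dehomogenize_in d (\<lambda>_. \<zero>) = (\<lambda>_. \<zero>)"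
  by (simp add: dehomogenize_in_def)

text \<open>The monomials of degree \<open>d\<close> in \<open>c x\<^sup>a g\<close> come from those of degree \<open>d - |a|\<close> in \<open>g\<close>.\<close>

lemma dehomogenize_in_term_mult:
  assumes c: "c \<in> carrier R" and g: "is_mpoly {0..n} g"
    and g': "is_mpoly {1..n} (dehomogenize_in (d - size a) g)"
  shows "dehomogenize_in d (mpoly_term c a \<otimes>\<^bsub>mpoly_ring R {0..n}\<^esub> g) =
    (if size a \<le> d
     then mpoly_term c (filter_mset (\<lambda>i. i \<noteq> 0) a) \<otimes>\<^bsub>mpoly_ring R {1..n}\<^esub> dehomogenize_in (d - size a) g
     else (\<lambda>_. \<zero>))"
proof
  fix m
  define b where "b = filter_mset (\<lambda>i. i \<noteq> 0) a"
  let ?k = "count a 0"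
  have a: "a = b + replicate_mset ?k 0" unfolding b_def by (rule nonzero_mset_split[symmetric])
  have size_a: "size a = size b + ?k" unfolding b_def by (rule size_nonzero_mset[symmetric])
  have count_b: "count b i = (if i = 0 then 0 else count a i)" for i by (simp add: b_def)
  note gc = is_mpoly_coeff[OF g]
  have lhs: "dehomogenize_in d (mpoly_term c a \<otimes>\<^bsub>mpoly_ring R {0..n}\<^esub> g) m =
      (if 0 \<notin># m \<and> size m \<le> d then if a \<subseteq># m + replicate_mset (d - size m) 0
        then c \<otimes> g (m + replicate_mset (d - size m) 0 - a) else \<zero> else \<zero>)"
    unfolding term_mult_mpoly[OF c g] unfolding dehomogenize_in_def ..
  have rhs: "(mpoly_term c b \<otimes>\<^bsub>mpoly_ring R {1..n}\<^esub> dehomogenize_in (d - size a) g) m =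
      (if b \<subseteq># m then c \<otimes> (if 0 \<notin># m - b \<and> size (m - b) \<le> d - size a
        then g (m - b + replicate_mset (d - size a - size (m - b)) 0) else \<zero>) else \<zero>)"
    unfolding term_mult_mpoly[OF c g'] unfolding dehomogenize_in_def ..
  have zero_in: "0 \<in># m - b \<longleftrightarrow> 0 \<in># m" by (simp add: in_diff_count count_b)
  have size_diff: "size (m - b) = size m - size b" "size b \<le> size m" if "b \<subseteq># m"
    using that by (simp_all add: size_Diff_submset size_mset_mono)
  have "dehomogenize_in d (mpoly_term c a \<otimes>\<^bsub>mpoly_ring R {0..n}\<^esub> g) m =
    (if size a \<le> d
     then mpoly_term c b \<otimes>\<^bsub>mpoly_ring R {1..n}\<^esub> dehomogenize_in (d - size a) g
     else (\<lambda>_. \<zero>)) m"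
  proof (cases "0 \<notin># m \<and> size m \<le> d \<and> a \<subseteq># m + replicate_mset (d - size m) 0")
    case True
    let ?r = "replicate_mset (d - size m) (0::nat)"
    have cnt: "count a i \<le> count (m + ?r) i" for i using True mset_subset_eq_count[of a "m + ?r" i] by blast
    have "count b i \<le> count m i" for i using cnt[of i] by (cases "i = 0") (simp_all add: count_b)
    then have am: "b \<subseteq># m" by (rule mset_subset_eqI)
    have m0: "count m 0 = 0" using True by (simp add: not_in_iff)
    have k: "?k \<le> d - size m" using cnt[of 0] m0 by simp
    note sz = size_diff[OF am]
    have ad: "size a \<le> d" using k sz True unfolding size_a by linarith
    have "m + ?r - a = m - b + replicate_mset (d - size a - size (m - b)) 0"
    proof (rule multiset_eqI)
      fix i
      show "count (m + ?r - a) i = count (m - b + replicate_mset (d - size a - size (m - b)) 0) i"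
        using sz k m0 True by (auto simp: size_a count_b)
    qed
    moreover have "size (m - b) \<le> d - size a" using k sz True unfolding size_a by linarith
    ultimately show ?thesis
      unfolding lhs if_P[OF ad] rhs using True am zero_in by simp
  next
    case False
    have outside: "\<not> (b \<subseteq># m \<and> 0 \<notin># m - b \<and> size (m - b) \<le> d - size a \<and> size a \<le> d)"
    proof
      assume *: "b \<subseteq># m \<and> 0 \<notin># m - b \<and> size (m - b) \<le> d - size a \<and> size a \<le> d"
      note sz = size_diff[OF conjunct1[OF *]]
      have k: "?k \<le> d - size m" "size m \<le> d" using * sz unfolding size_a by linarith+
      have "b + replicate_mset ?k 0 \<subseteq># m + replicate_mset (d - size m) 0"
        using * k(1) by (intro subset_mset.add_mono) (simp_all flip: count_le_replicate_mset_subset_eq)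
      then show False using False * k(2) zero_in unfolding a[symmetric] by simp
    qed
    have zero: "dehomogenize_in d (mpoly_term c a \<otimes>\<^bsub>mpoly_ring R {0..n}\<^esub> g) m = \<zero>"
      unfolding lhs using False by auto
    show ?thesis
    proof (cases "size a \<le> d")
      case ad: True
      show ?thesis
        unfolding zero if_P[OF ad] rhs
      proof (cases "b \<subseteq># m")
        case True
        with outside ad have "\<not> (0 \<notin># m - b \<and> size (m - b) \<le> d - size a)" by blast
        then show "\<zero> = (if b \<subseteq># m then c \<otimes> (if 0 \<notin># m - b \<and> size (m - b) \<le> d - size a
            then g (m - b + replicate_mset (d - size a - size (m - b)) 0) else \<zero>) else \<zero>)"
          unfolding if_P[OF True] by (simp only: if_False r_null[OF c])
      qed simp
    qed (simp add: zero)
  qed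
  then show "dehomogenize_in d (mpoly_term c a \<otimes>\<^bsub>mpoly_ring R {0..n}\<^esub> g) m =
    (if size a \<le> d
     then mpoly_term c (filter_mset (\<lambda>i. i \<noteq> 0) a) \<otimes>\<^bsub>mpoly_ring R {1..n}\<^esub> dehomogenize_in (d - size a) g
     else (\<lambda>_. \<zero>)) m"
    unfolding b_def .
qed

end

text \<open>The polynomials all of whose components dehomogenize into \<open>I\<close> form an ideal; it suffices to
  multiply by single terms. This ideal contains the generators of the homogenized ideal.\<close>

lemma (in cring) dehomogenize_in_homogenized_ideal:
  assumes I: "ideal I (mpoly_ring R {1..n})" and g: "g \<in> homogenized_ideal R n I"
  shows "dehomogenize_in d g \<in> I"
proof -
  let ?P = "mpoly_ring R {0..n}"
  interpret P: cring ?P by (rule cring_mpoly_ring)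
  let ?Q = "{g. is_mpoly {0..n} g \<and> (\<forall>d. dehomogenize_in d g \<in> I)}"
  have QI: "g \<in> ?Q" if "is_mpoly {0..n} g" "\<And>d. dehomogenize_in d g \<in> I" for g using that by simp
  have sum: "(\<lambda>m. g m \<oplus> h m) \<in> ?Q" if "g \<in> ?Q" "h \<in> ?Q" for g h
    using that by (intro QI) (simp_all add: is_mpoly_add dehomogenize_in_add add_mem_mpoly_ideal[OF I])
  have mult_term: "mpoly_term c a \<otimes>\<^bsub>?P\<^esub> g \<in> ?Q"
    if c: "c \<in> carrier R" and a: "set_mset a \<subseteq> {0..n}" and g: "g \<in> ?Q" for c a g
  proof (rule QI)
    show "is_mpoly {0..n} (mpoly_term c a \<otimes>\<^bsub>?P\<^esub> g)"
      using g c a by (simp add: is_mpoly_mult is_mpoly_term)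
    fix d
    have gP: "is_mpoly {0..n} g" and gI: "dehomogenize_in (d - size a) g \<in> I" using g by simp_all
    have "set_mset (filter_mset (\<lambda>i. i \<noteq> 0) a) \<subseteq> {1..n}" using a by force
    then show "dehomogenize_in d (mpoly_term c a \<otimes>\<^bsub>?P\<^esub> g) \<in> I"
      using dehomogenize_in_term_mult[OF c gP mem_mpoly_ideal[OF I gI]]
        term_mult_mem_ideal[OF I gI c] zero_mem_mpoly_ideal[OF I] by simp
  qed
  have mult: "f \<otimes>\<^bsub>?P\<^esub> g \<in> ?Q" if f: "is_mpoly {0..n} f" and g: "g \<in> ?Q" for f g
    using f
  proof (induction rule: is_mpoly_induct)
    case zero
    show ?case
      using g by (intro QI) (simp_all add: mpoly_mult_zero is_mpoly_zero dehomogenize_in_zero zero_mem_mpoly_ideal[OF I])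
  next
    case (monom c a)
    then show ?case using mult_term g by blast
  next
    case (add f h)
    have gP: "is_mpoly {0..n} g" using g by simp
    show ?case
      unfolding mpoly_mult_distrib(1)[OF add(1,2) gP] by (rule sum[OF add(3,4)])
  qed
  have "ideal ?Q ?P"
  proof (rule idealI[OF P.ring_axioms])
    show "subgroup ?Q (add_monoid ?P)"
    proof (rule P.add.subgroupI)
      show "?Q \<subseteq> carrier ?P" by (auto simp: mem_mpoly_ring_iff)
      have "(\<lambda>_. \<zero>) \<in> ?Q" by (intro QI) (simp_all add: is_mpoly_zero dehomogenize_in_zero zero_mem_mpoly_ideal[OF I])
      then show "?Q \<noteq> {}" by (metis empty_iff)
      fix g assume g: "g \<in> ?Q"
      then have gP: "g \<in> carrier ?P" by (simp add: mem_mpoly_ring_iff)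
      have "\<ominus>\<^bsub>?P\<^esub> \<one>\<^bsub>?P\<^esub> \<otimes>\<^bsub>?P\<^esub> g \<in> ?Q"
        using P.a_inv_closed[OF P.one_closed] by (intro mult g) (simp only: mem_mpoly_ring_iff)
      moreover have "\<ominus>\<^bsub>?P\<^esub> \<one>\<^bsub>?P\<^esub> \<otimes>\<^bsub>?P\<^esub> g = \<ominus>\<^bsub>?P\<^esub> g"
        using P.l_minus[OF P.one_closed gP] P.l_one[OF gP] by simp
      ultimately show "\<ominus>\<^bsub>?P\<^esub> g \<in> ?Q" by simp
      fix h assume h: "h \<in> ?Q"
      show "g \<oplus>\<^bsub>?P\<^esub> h \<in> ?Q" using sum[OF g h] by (simp only: add_mpoly_ring)
    qed
    fix g x assume g: "g \<in> ?Q" and x: "x \<in> carrier ?P"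
    then have gP: "g \<in> carrier ?P" by (simp add: mem_mpoly_ring_iff)
    have xP: "is_mpoly {0..n} x" using x by (simp only: mem_mpoly_ring_iff)
    show "x \<otimes>\<^bsub>?P\<^esub> g \<in> ?Q" by (rule mult[OF xP g])
    then show "g \<otimes>\<^bsub>?P\<^esub> x \<in> ?Q" unfolding P.m_comm[OF gP x] .
  qed
  moreover have "homogenize R ` I \<subseteq> ?Q"
  proof (intro image_subsetI QI)
    fix f d assume f: "f \<in> I"
    note fP = mem_mpoly_ideal[OF I f]
    show "is_mpoly {0..n} (homogenize R f)"
      unfolding homogenize_eq_homogenize_in by (rule is_mpoly_homogenize_in[OF fP])
    show "dehomogenize_in d (homogenize R f) \<in> I"
      unfolding homogenize_eq_homogenize_in
      using dehomogenize_in_homogenize_in[OF fP order_refl] f zero_mem_mpoly_ideal[OF I]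
        dehomogenize_in_homogenize_in_other[of d "total_degree R f" f]
      by (cases "d = total_degree R f") simp_all
  qed
  ultimately have "homogenized_ideal R n I \<subseteq> ?Q"
    unfolding homogenized_ideal_def by (rule P.genideal_minimal)
  then show ?thesis using g by blast
qed

context cring
begin

lemma homogenize_image_subset:
  assumes "ideal I (mpoly_ring R {1..n})"
  shows "homogenize R ` I \<subseteq> carrier (mpoly_ring R {0..n})"
  unfolding homogenize_eq_homogenize_in
  using is_mpoly_homogenize_in[OF mem_mpoly_ideal[OF assms]] by (auto simp: mem_mpoly_ring_iff)

lemma ideal_homogenized_ideal:
  assumes "ideal I (mpoly_ring R {1..n})"
  shows "ideal (homogenized_ideal R n I) (mpoly_ring R {0..n})"
proof -
  interpret P: cring "mpoly_ring R {0..n}" by (rule cring_mpoly_ring)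
  show ?thesis
    unfolding homogenized_ideal_def by (rule P.genideal_ideal[OF homogenize_image_subset[OF assms]])
qed

lemma homogenize_in_mem_homogenized_ideal:
  assumes I: "ideal I (mpoly_ring R {1..n})" and f: "f \<in> I" and d: "total_degree R f \<le> d"
  shows "homogenize_in d f \<in> homogenized_ideal R n I"
proof -
  let ?P = "mpoly_ring R {0..n}"
  interpret P: cring ?P by (rule cring_mpoly_ring)
  have "homogenize R f \<in> homogenized_ideal R n I"
    using P.genideal_self[OF homogenize_image_subset[OF I]] f unfolding homogenized_ideal_def by blast
  then have "mpoly_term \<one> (replicate_mset (d - total_degree R f) 0) \<otimes>\<^bsub>?P\<^esub> homogenize R f
      \<in> homogenized_ideal R n I"
    by (rule term_mult_mem_ideal[OF ideal_homogenized_ideal[OF I]]) (auto split: if_splits)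
  then show ?thesis
    by (simp only: homogenize_in_eq_power_mult[OF mem_mpoly_ideal[OF I f] d])
qed

end

text \<open>The relation \<open>s f \<in> I + pR[x]\<close> is homogenized in a common degree \<open>d\<close>, where flatness cancels \<open>s\<close>.
  Dehomogenizing gives \<open>f \<in> I + pR[x]\<close>, which contains no scalar that could fall into \<open>q\<close>.\<close>

lemma (in cring) fibre_member_specializes_if_flat:
  assumes I: "ideal I (mpoly_ring R {1..n})"
    and flat: "flat R (mpoly_quotient R {0..n} (homogenized_ideal R n I))"
    and p: "primeideal p R" and q: "primeideal q R" "p \<subseteq> q"
    and f: "is_mpoly {1..n} f" and mem: "fibre_member R I p f"
  shows "fibre_member R I q f"
proof -
  interpret p: primeideal p R by (rule p)
  interpret q: primeideal q R by (rule q(1))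
  have pz: "\<zero> \<in> p" by (rule p.I_zero)
  obtain s j where s: "s \<in> carrier R" "s \<notin> p" and j: "j \<in> I" and sj: "\<And>m. s \<otimes> f m \<ominus> j m \<in> p"
    using mem unfolding fibre_member_def by blast
  define d where "d = max (total_degree R f) (total_degree R j)"
  have d: "total_degree R f \<le> d" "total_degree R j \<le> d" by (simp_all add: d_def)
  have "s \<otimes> homogenize_in d f m \<ominus> homogenize_in d j m \<in> p" for m
    using sj s(1) pz by (simp add: homogenize_in_def minus_eq)
  from mem_ideal_plus_prime_if_flat[OF ideal_homogenized_ideal[OF I] flat p s
      is_mpoly_homogenize_in[OF f] homogenize_in_mem_homogenized_ideal[OF I j d(2)] this]
  obtain h where h: "h \<in> homogenized_ideal R n I" "\<And>m. homogenize_in d f m \<ominus> h m \<in> p" by blast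
  have "dehomogenize_in d h \<in> I" by (rule dehomogenize_in_homogenized_ideal[OF I h(1)])
  moreover have "f m \<ominus> dehomogenize_in d h m \<in> p" for m
  proof -
    have "f m = dehomogenize_in d (homogenize_in d f) m"
      by (simp only: dehomogenize_in_homogenize_in[OF f d(1)])
    then show ?thesis using h(2) pz by (simp add: dehomogenize_in_def minus_eq)
  qed
  moreover have "\<one> \<in> carrier R - q" by (rule q.one_in_complement)
  ultimately show ?thesis
    unfolding fibre_member_def using q(2) is_mpoly_coeff[OF f]
    by (intro bexI[of _ \<one>] bexI[of _ "dehomogenize_in d h"] allI) auto
qed

section \<open>Finite generation\<close>

lemma (in ring_hom_ring) noetherian_ring_image:
  assumes R: "noetherian_ring R" and surj: "h ` carrier R = carrier S"
  shows "noetherian_ring S"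
proof (rule S.noetherian_ringI)
  interpret noetherian_ring R by (rule R)
  fix I assume I: "ideal I S"
  obtain A where A: "A \<subseteq> carrier R" "finite A" "{r \<in> carrier R. h r \<in> I} = Idl A"
    using finetely_gen[OF ideal_vimage[OF I]] by blast
  have hA: "h ` A \<subseteq> carrier S" using A(1) by auto
  have "I \<subseteq> Idl\<^bsub>S\<^esub> (h ` A)"
  proof
    fix y assume y: "y \<in> I"
    then have "y \<in> h ` carrier R" using ideal.Icarr[OF I] surj by simp
    then obtain x where x: "x \<in> carrier R" "y = h x" by blast
    have "Idl A \<subseteq> {r \<in> carrier R. h r \<in> Idl\<^bsub>S\<^esub> (h ` A)}"
      using A(1) S.genideal_self[OF hA] by (intro R.genideal_minimal ideal_vimage S.genideal_ideal[OF hA]) auto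
    moreover have "x \<in> Idl A" using x y unfolding A(3)[symmetric] by simp
    ultimately show "y \<in> Idl\<^bsub>S\<^esub> (h ` A)" unfolding x(2) by blast
  qed
  moreover have "Idl\<^bsub>S\<^esub> (h ` A) \<subseteq> I"
  proof (rule S.genideal_minimal[OF I])
    have "A \<subseteq> {r \<in> carrier R. h r \<in> I}" unfolding A(3) by (rule R.genideal_self[OF A(1)])
    then show "h ` A \<subseteq> I" by blast
  qed
  ultimately show "\<exists>A \<subseteq> carrier S. finite A \<and> I = Idl\<^bsub>S\<^esub> A"
    using hA A(2) by (intro exI[of _ "h ` A"]) simp
qed

lemma (in field) noetherian_ring_field: "noetherian_ring R"
proof (rule noetherian_ringI)
  fix I assume "ideal I R"
  then have "I = {\<zero>} \<or> I = carrier R" using all_ideals by blast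
  then have "I = Idl {\<zero>} \<or> I = Idl {\<one>}" by (simp only: genideal_zero genideal_one)
  then show "\<exists>A \<subseteq> carrier R. finite A \<and> I = Idl A"
    by (elim disjE) (intro exI[of _ "{\<zero>}"] exI[of _ "{\<one>}"]; simp)+
qed

lemma noetherian_ring_if_finite_type:
  assumes K: "field K" and S: "finite_type_algebra K S"
  shows "cring S" "noetherian_ring S"
proof -
  interpret K: field K by (rule K)
  have "Module.algebra K S" using S by (simp add: finite_type_algebra_def)
  then interpret S: cring S by (rule algebra.axioms(2))
  show "cring S" by (rule S.is_cring)
  obtain r :: nat and h where h: "h \<in> ring_hom (mpoly_ring K {1..r}) S"
    and surj: "h ` carrier (mpoly_ring K {1..r}) = carrier S"
    using S unfolding finite_type_algebra_def by blast
  interpret P: cring "mpoly_ring K {1..r}" by (rule K.cring_mpoly_ring)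
  interpret ring_hom_ring "mpoly_ring K {1..r}" S h
    by (rule ring_hom_ringI2[OF P.ring_axioms S.ring_axioms h])
  have "noetherian_ring (mpoly_ring K {1..r})"
    by (rule K.noetherian_mpoly_ring[OF K.noetherian_ring_field]) simp
  then show "noetherian_ring S" using surj by (rule noetherian_ring_image)
qed

section \<open>The locus of containment\<close>

text \<open>At a point \<open>p\<close> of the set, the product of the scalars that witness the finitely many memberships
  is the open condition; at other points a single polynomial \<open>f\<close> decides.\<close>

lemma (in cring) generically_constant_containment:
  fixes V :: "'v :: wellorder set"
  assumes V: "finite V" and J: "ideal J (mpoly_ring R V)"
    and A: "finite A" "A \<subseteq> carrier (mpoly_ring R V)"
  shows "generically_constant R {p \<in> Spec R. \<forall>f \<in> A. fibre_member R J p f}" (is "generically_constant R ?E")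
  unfolding generically_constant_def
proof (intro conjI ballI)
  fix p assume pS: "p \<in> Spec R"
  then interpret p: primeideal p R by (simp add: Spec_def)
  show "\<exists>a \<in> carrier R - p. \<forall>q \<in> Spec R. p \<subseteq> q \<longrightarrow> a \<notin> q \<longrightarrow> (q \<in> ?E \<longleftrightarrow> p \<in> ?E)"
  proof (cases "p \<in> ?E")
    case True
    have "\<exists>a \<in> carrier R - p. \<forall>q \<in> Spec R. p \<subseteq> q \<longrightarrow> a \<notin> q \<longrightarrow> (\<forall>f \<in> B. fibre_member R J q f)"
      if "finite B" "B \<subseteq> A" for B
      using that
    proof induction
      case empty
      have "\<one> \<in> carrier R - p" by (rule p.one_in_complement)
      then show ?case by blast
    next
      case (insert f B)
      then obtain a where a: "a \<in> carrier R" "a \<notin> p"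
        and aB: "\<forall>q \<in> Spec R. p \<subseteq> q \<longrightarrow> a \<notin> q \<longrightarrow> (\<forall>f \<in> B. fibre_member R J q f)" by blast
      have "fibre_member R J p f" using True insert.prems by blast
      then obtain s j where s: "s \<in> carrier R" "s \<notin> p" and j: "j \<in> J" and sj: "\<forall>m. s \<otimes> f m \<ominus> j m \<in> p"
        unfolding fibre_member_def by blast
      have "\<forall>f \<in> insert f B. fibre_member R J q f" if q: "q \<in> Spec R" "p \<subseteq> q" "a \<otimes> s \<notin> q" for q
      proof -
        interpret q: primeideal q R using q(1) by (simp add: Spec_def)
        have "a \<notin> q" "s \<notin> q" using q(3) q.I_r_closed[OF _ s(1)] q.I_l_closed[OF _ a(1)] by blast+
        moreover have "fibre_member R J q f" if "s \<notin> q"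
          unfolding fibre_member_def using that s(1) j sj q(2)
          by (intro bexI[of _ s] bexI[of _ j]) auto
        ultimately show ?thesis using aB q by simp
      qed
      moreover have "a \<otimes> s \<in> carrier R - p" using a s p.I_prime[of a s] by auto
      ultimately show ?case by (intro bexI[of _ "a \<otimes> s"]) simp_all
    qed
    from this[OF A(1) order_refl] True show ?thesis by auto
  next
    case False
    then obtain f where f: "f \<in> A" "\<not> fibre_member R J p f" using pS by blast
    have fP: "is_mpoly V f" using A(2) f(1) by (auto simp: mem_mpoly_ring_iff)
    obtain a where "a \<in> carrier R - p"
      and a: "\<And>q. primeideal q R \<Longrightarrow> p \<subseteq> q \<Longrightarrow> a \<notin> q \<Longrightarrow> \<not> fibre_member R J q f"
      using fibre_nonmember_generic[OF V J p.primeideal_axioms fP f(2)] by metis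
    then show ?thesis
    proof (intro bexI[of _ a] ballI impI)
      fix q assume "q \<in> Spec R" "p \<subseteq> q" "a \<notin> q"
      then have "q \<notin> ?E" using a[of q] f(1) by (auto simp: Spec_def)
      then show "q \<in> ?E \<longleftrightarrow> p \<in> ?E" using False by (simp only: refl)
    qed
  qed
qed blast

theorem theorem2p5:
  fixes K :: "('k, 'r) ring_scheme" and S :: "('k, 'a, 'm) module_scheme" and n :: nat
    and I1 I2 :: "(nat multiset \<Rightarrow> 'a) set"
  assumes "field K" and "finite_type_algebra K S" and "connected_ring S"
    and "ideal I1 (mpoly_ring S {1..n})" and "ideal I2 (mpoly_ring S {1..n})"
  shows "constructible_in (zariski S)
           {\<pp> \<in> Spec S. residue_extension S {1..n} \<pp> I1 \<subseteq> residue_extension S {1..n} \<pp> I2} \<and>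
         (flat S (mpoly_quotient S {0..n} (homogenized_ideal S n I2)) \<longrightarrow>
          closedin (zariski S)
           {\<pp> \<in> Spec S. residue_extension S {1..n} \<pp> I1 \<subseteq> residue_extension S {1..n} \<pp> I2})"
proof -
  note S = noetherian_ring_if_finite_type[OF assms(1,2)]
  interpret S: cring S by (rule S(1))
  interpret P: noetherian_ring "mpoly_ring S {1..n}"
    by (rule S.noetherian_mpoly_ring[OF S(2)]) simp
  obtain A where A: "A \<subseteq> carrier (mpoly_ring S {1..n})" "finite A"
    and I1: "I1 = Idl\<^bsub>mpoly_ring S {1..n}\<^esub> A"
    using P.finetely_gen[OF assms(4)] by blast
  let ?E = "{\<pp> \<in> Spec S. \<forall>f \<in> A. fibre_member S I2 \<pp> f}"
  have E: "{\<pp> \<in> Spec S. residue_extension S {1..n} \<pp> I1 \<subseteq> residue_extension S {1..n} \<pp> I2} = ?E"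
    using residue_extension_subset_iff[OF S(1) _ assms(4,5) A(1) I1] by auto
  have const: "generically_constant S ?E"
    by (rule S.generically_constant_containment[OF _ assms(5) A(2,1)]) simp
  have "closedin (zariski S) ?E" if flat: "flat S (mpoly_quotient S {0..n} (homogenized_ideal S n I2))"
  proof (rule closed_if_generically_constant[OF S const])
    fix p q assume p: "p \<in> ?E" and q: "q \<in> Spec S" "p \<subseteq> q"
    have "fibre_member S I2 q f" if f: "f \<in> A" for f
    proof (rule S.fibre_member_specializes_if_flat[OF assms(5) flat _ _ q(2)])
      show "primeideal p S" "primeideal q S" using p q(1) by (simp_all add: Spec_def)
      show "S.is_mpoly {1..n} f" using A(1) f by (auto simp: S.mem_mpoly_ring_iff)
      show "fibre_member S I2 p f" using p f by blast
    qed
    then show "q \<in> ?E" using q(1) by blast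
  qed
  then show ?thesis
    unfolding E using constructible_if_generically_constant[OF S const] by blast
qed

end
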